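(* Let $k$ be a field, let $Q$ be a strongly locally finite quiver, and let $f:M\to N$ be an irreducible morphism in $\overline{\mathrm{rep}}(Q)$ with $M,N$ indecomposable. Then one of the following four cases holds: (1) $M,N\in\mathrm{rep}^+(Q)$; (2) $M,N\in\mathrm{rep}^-(Q)$; (3) $M\in\mathrm{rep}^-(Q)$ is infinite dimensional and $N$ is doubly-infinite; (4) $N\in\mathrm{rep}^+(Q)$ is infinite dimensional and $M$ is doubly-infinite.
   Context: A quiver $Q=(Q_0,Q_1)$ is strongly locally finite if it is locally finite (each vertex is attached to finitely many arrows) and interval-finite (for all vertices $x,y$ the set $Q(x,y)$ of paths from $x$ to $y$, including trivial paths, is finite). $\mathrm{rep}(Q)$ is the abelian category of locally finite dimensional representations $M$ of $Q$ over $k$ ($M(x)$ is finite dimensional for every $x\in Q_0$); $M$ is finite dimensional if $\bigoplus_x M(x)$ is. For $a\in Q_0$: $P_a$ is the representation with $P_a(x)$ the vector space with basis $Q(a,x)$, arrows acting by extending paths; $I_a$ is the representation with $I_a(x)$ the vector space with basis $Q(x,a)$, an arrow $\alpha:x\to y$ acting by the transpose of the map $kQ(y,a)\to kQ(x,a)$ given by multiplication by $\alpha$. $\mathrm{rep}^+(Q)$ is the full subcategory of $\mathrm{rep}(Q)$ of finitely presented representations: those $M$ with an exact sequence $0\to P'\to P\to M\to 0$ where $P,P'$ are finite direct sums of representations $P_x$. $\mathrm{rep}^-(Q)$ is the full subcategory of finitely co-presented representations: those $M$ with an exact sequence $0\to M\to I\to I'\to 0$ where $I,I'$ are finite direct sums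 of representations $I_x$. An arrow $\alpha$ supports $M$ if $M(\alpha)\neq 0$. A short exact sequence $0\to L\to M\to N\to 0$ in $\mathrm{rep}(Q)$ is called a finite extension of $N$ by $L$ (and $M$ a finite extension-representation of $N$ by $L$) if all but finitely many arrows supporting $M$ support $L\oplus N$. $\overline{\mathrm{rep}}(Q)$ is the full (abelian) subcategory of $\mathrm{rep}(Q)$ of those $M$ which are finite extension-representations of $N$ by $L$ for some $L\in\mathrm{rep}^+(Q)$ and $N\in\mathrm{rep}^-(Q)$. A morphism $f$ in an additive category is irreducible if it is neither a section nor a retraction and every factorization $f=gh$ implies that $h$ is a section or $g$ is a retraction. An indecomposable representation in $\overline{\mathrm{rep}}(Q)$ which lies neither in $\mathrm{rep}^+(Q)$ nor in $\mathrm{rep}^-(Q)$ is called doubly-infinite. *)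

theory Defs
  imports "Graph_Theory.Arc_Walk" "HOL-Library.Function_Algebras" "HOL-Library.Product_Plus"
begin

text \<open>
  A quiver is a well-formed multidigraph: arrows may be parallel or loops, and vertices and arrows
  may be infinite in number. A path from \<open>x\<close> to \<open>y\<close> is the list of its arrows in
  the order in which they are traversed, starting at \<open>x\<close>; the trivial path at \<open>x\<close>
  is the empty list.
\<close>

definition paths :: "('v, 'a) pre_digraph \<Rightarrow> 'v \<Rightarrow> 'v \<Rightarrow> 'a list set" where
  "paths Q x y = {p. pre_digraph.awalk Q x p y}"

definition locally_finite_quiver :: "('v, 'a) pre_digraph \<Rightarrow> bool" where
  "locally_finite_quiver Q \<longleftrightarrow>
     wf_digraph Q \<and> (\<forall>x \<in> verts Q. finite (in_arcs Q x) \<and> finite (out_arcs Q x))"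

definition interval_finite :: "('v, 'a) pre_digraph \<Rightarrow> bool" where
  "interval_finite Q \<longleftrightarrow> (\<forall>x \<in> verts Q. \<forall>y \<in> verts Q. finite (paths Q x y))"

definition strongly_locally_finite :: "('v, 'a) pre_digraph \<Rightarrow> bool" where
  "strongly_locally_finite Q \<longleftrightarrow> locally_finite_quiver Q \<and> interval_finite Q"

text \<open>
  Vector spaces are subspaces of an ambient vector space, given by a type with its addition and a
  scalar multiplication \<open>s\<close> such that \<open>vector_space s\<close>. The ambient space plays the
  role of a universe: as soon as it is infinite dimensional, every locally finite dimensional
  representation is isomorphic to one with all its spaces inside it. Different representations may
  have different ambient spaces, hence the several scalar multiplications below.

  Linear maps are total functions of which only the values on the given subspaces matter.
\<close>

definition fd_space :: "('k::field \<Rightarrow> 'u::ab_group_add \<Rightarrow> 'u) \<Rightarrow> 'u set \<Rightarrow> bool" where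
  "fd_space s S \<longleftrightarrow> module.subspace s S \<and> (\<exists>B. finite B \<and> B \<subseteq> S \<and> module.span s B = S)"

definition linear_map_on ::
  "('k::field \<Rightarrow> 'u::ab_group_add \<Rightarrow> 'u) \<Rightarrow> ('k \<Rightarrow> 'w::ab_group_add \<Rightarrow> 'w)
    \<Rightarrow> 'u set \<Rightarrow> 'w set \<Rightarrow> ('u \<Rightarrow> 'w) \<Rightarrow> bool" where
  "linear_map_on s t S T f \<longleftrightarrow>
     f ` S \<subseteq> T \<and> (\<forall>u \<in> S. \<forall>v \<in> S. f (u + v) = f u + f v) \<and>
     (\<forall>c. \<forall>u \<in> S. f (s c u) = t c (f u))"

definition fun_scale :: "('k \<Rightarrow> 'u \<Rightarrow> 'u) \<Rightarrow> 'k \<Rightarrow> ('i \<Rightarrow> 'u) \<Rightarrow> 'i \<Rightarrow> 'u" where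
  "fun_scale s c f = (\<lambda>i. s c (f i))"

definition prod_scale :: "('k \<Rightarrow> 'u \<Rightarrow> 'u) \<Rightarrow> ('k \<Rightarrow> 'w \<Rightarrow> 'w) \<Rightarrow> 'k \<Rightarrow> 'u \<times> 'w \<Rightarrow> 'u \<times> 'w" where
  "prod_scale s t c p = (s c (fst p), t c (snd p))"

record ('v, 'a, 'u) rep =
  spc :: "'v \<Rightarrow> 'u set"
  act :: "'a \<Rightarrow> 'u \<Rightarrow> 'u"

text \<open>The objects of \<open>rep(Q)\<close>: locally finite dimensional representations.\<close>

definition is_rep ::
  "('k::field \<Rightarrow> 'u::ab_group_add \<Rightarrow> 'u) \<Rightarrow> ('v, 'a) pre_digraph \<Rightarrow> ('v, 'a, 'u) rep \<Rightarrow> bool" where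
  "is_rep s Q M \<longleftrightarrow>
     (\<forall>x \<in> verts Q. fd_space s (spc M x)) \<and>
     (\<forall>\<alpha> \<in> arcs Q. linear_map_on s s (spc M (tail Q \<alpha>)) (spc M (head Q \<alpha>)) (act M \<alpha>))"

definition rep_hom ::
  "('k::field \<Rightarrow> 'u::ab_group_add \<Rightarrow> 'u) \<Rightarrow> ('k \<Rightarrow> 'w::ab_group_add \<Rightarrow> 'w) \<Rightarrow> ('v, 'a) pre_digraph
    \<Rightarrow> ('v, 'a, 'u) rep \<Rightarrow> ('v, 'a, 'w) rep \<Rightarrow> ('v \<Rightarrow> 'u \<Rightarrow> 'w) \<Rightarrow> bool" where
  "rep_hom s t Q M N f \<longleftrightarrow>
     (\<forall>x \<in> verts Q. linear_map_on s t (spc M x) (spc N x) (f x)) \<and>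
     (\<forall>\<alpha> \<in> arcs Q. \<forall>v \<in> spc M (tail Q \<alpha>).
        f (head Q \<alpha>) (act M \<alpha> v) = act N \<alpha> (f (tail Q \<alpha>) v))"

definition rep_section ::
  "('k::field \<Rightarrow> 'u::ab_group_add \<Rightarrow> 'u) \<Rightarrow> ('k \<Rightarrow> 'w::ab_group_add \<Rightarrow> 'w) \<Rightarrow> ('v, 'a) pre_digraph
    \<Rightarrow> ('v, 'a, 'u) rep \<Rightarrow> ('v, 'a, 'w) rep \<Rightarrow> ('v \<Rightarrow> 'u \<Rightarrow> 'w) \<Rightarrow> bool" where
  "rep_section s t Q M N f \<longleftrightarrow>
     rep_hom s t Q M N f \<and>
     (\<exists>r. rep_hom t s Q N M r \<and> (\<forall>x \<in> verts Q. \<forall>v \<in> spc M x. r x (f x v) = v))"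

definition rep_retraction ::
  "('k::field \<Rightarrow> 'u::ab_group_add \<Rightarrow> 'u) \<Rightarrow> ('k \<Rightarrow> 'w::ab_group_add \<Rightarrow> 'w) \<Rightarrow> ('v, 'a) pre_digraph
    \<Rightarrow> ('v, 'a, 'u) rep \<Rightarrow> ('v, 'a, 'w) rep \<Rightarrow> ('v \<Rightarrow> 'u \<Rightarrow> 'w) \<Rightarrow> bool" where
  "rep_retraction s t Q M N f \<longleftrightarrow>
     rep_hom s t Q M N f \<and>
     (\<exists>i. rep_hom t s Q N M i \<and> (\<forall>x \<in> verts Q. \<forall>v \<in> spc N x. f x (i x v) = v))"

definition rep_isomorphic ::
  "('k::field \<Rightarrow> 'u::ab_group_add \<Rightarrow> 'u) \<Rightarrow> ('k \<Rightarrow> 'w::ab_group_add \<Rightarrow> 'w) \<Rightarrow> ('v, 'a) pre_digraph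
    \<Rightarrow> ('v, 'a, 'u) rep \<Rightarrow> ('v, 'a, 'w) rep \<Rightarrow> bool" where
  "rep_isomorphic s t Q M N \<longleftrightarrow>
     (\<exists>f. rep_hom s t Q M N f \<and> (\<forall>x \<in> verts Q. bij_betw (f x) (spc M x) (spc N x)))"

definition short_exact ::
  "('k::field \<Rightarrow> 'u1::ab_group_add \<Rightarrow> 'u1) \<Rightarrow> ('k \<Rightarrow> 'u2::ab_group_add \<Rightarrow> 'u2)
    \<Rightarrow> ('k \<Rightarrow> 'u3::ab_group_add \<Rightarrow> 'u3) \<Rightarrow> ('v, 'a) pre_digraph
    \<Rightarrow> ('v, 'a, 'u1) rep \<Rightarrow> ('v, 'a, 'u2) rep \<Rightarrow> ('v, 'a, 'u3) rep
    \<Rightarrow> ('v \<Rightarrow> 'u1 \<Rightarrow> 'u2) \<Rightarrow> ('v \<Rightarrow> 'u2 \<Rightarrow> 'u3) \<Rightarrow> bool" where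
  "short_exact s1 s2 s3 Q L M N f g \<longleftrightarrow>
     rep_hom s1 s2 Q L M f \<and> rep_hom s2 s3 Q M N g \<and>
     (\<forall>x \<in> verts Q. inj_on (f x) (spc L x) \<and>
        f x ` spc L x = {v \<in> spc M x. g x v = 0} \<and>
        g x ` spc M x = spc N x)"

definition is_zero_rep :: "('v, 'a) pre_digraph \<Rightarrow> ('v, 'a, 'u::zero) rep \<Rightarrow> bool" where
  "is_zero_rep Q M \<longleftrightarrow> (\<forall>x \<in> verts Q. spc M x = {0})"

definition rep_sum2 ::
  "('v, 'a, 'u) rep \<Rightarrow> ('v, 'a, 'w) rep \<Rightarrow> ('v, 'a, 'u \<times> 'w) rep" where
  "rep_sum2 M N = \<lparr>spc = (\<lambda>x. spc M x \<times> spc N x), act = (\<lambda>\<alpha>. map_prod (act M \<alpha>) (act N \<alpha>))\<rparr>"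

definition rep_sum :: "nat \<Rightarrow> (nat \<Rightarrow> ('v, 'a, 'u::zero) rep) \<Rightarrow> ('v, 'a, nat \<Rightarrow> 'u) rep" where
  "rep_sum n R =
     \<lparr>spc = (\<lambda>x. {f. (\<forall>i < n. f i \<in> spc (R i) x) \<and> (\<forall>i \<ge> n. f i = 0)}),
      act = (\<lambda>\<alpha> f i. if i < n then act (R i) \<alpha> (f i) else 0)\<rparr>"

definition indecomposable ::
  "('k::field \<Rightarrow> 'u::ab_group_add \<Rightarrow> 'u) \<Rightarrow> ('v, 'a) pre_digraph \<Rightarrow> ('v, 'a, 'u) rep \<Rightarrow> bool" where
  "indecomposable s Q M \<longleftrightarrow>
     is_rep s Q M \<and> \<not> is_zero_rep Q M \<and>
     (\<forall>X Y :: ('v, 'a, 'u) rep. is_rep s Q X \<and> is_rep s Q Y \<and>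
        rep_isomorphic s (prod_scale s s) Q M (rep_sum2 X Y) \<longrightarrow> is_zero_rep Q X \<or> is_zero_rep Q Y)"

text \<open>The space \<open>\<Oplus>\<^sub>x M(x)\<close> consists of the finitely supported families.\<close>

definition total_space :: "('v, 'a) pre_digraph \<Rightarrow> ('v, 'a, 'u::zero) rep \<Rightarrow> ('v \<Rightarrow> 'u) set" where
  "total_space Q M =
     {m. (\<forall>x \<in> verts Q. m x \<in> spc M x) \<and> (\<forall>x. x \<notin> verts Q \<longrightarrow> m x = 0) \<and> finite {x. m x \<noteq> 0}}"

definition finite_dimensional_rep ::
  "('k::field \<Rightarrow> 'u::ab_group_add \<Rightarrow> 'u) \<Rightarrow> ('v, 'a) pre_digraph \<Rightarrow> ('v, 'a, 'u) rep \<Rightarrow> bool" where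
  "finite_dimensional_rep s Q M \<longleftrightarrow> is_rep s Q M \<and> fd_space (fun_scale s) (total_space Q M)"

text \<open>
  The vector space with basis \<open>B\<close> consists of the finitely supported functions vanishing
  outside \<open>B\<close>. The linear extension of a map \<open>g\<close> of bases sends \<open>f = \<Sum> f(p) p\<close> to
  \<open>\<Sum> f(p) g(p)\<close>; its transpose with respect to the bases sends \<open>f\<close> to \<open>f \<circ> g\<close>.
\<close>

definition free_space :: "'b set \<Rightarrow> ('b \<Rightarrow> 'k::field) set" where
  "free_space B = {f. finite {p. f p \<noteq> 0} \<and> {p. f p \<noteq> 0} \<subseteq> B}"

definition free_map :: "('b \<Rightarrow> 'c) \<Rightarrow> ('b \<Rightarrow> 'k::field) \<Rightarrow> 'c \<Rightarrow> 'k" where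
  "free_map g f = (\<lambda>q. \<Sum>p | f p \<noteq> 0 \<and> g p = q. f p)"

definition free_map_transpose :: "('b \<Rightarrow> 'c) \<Rightarrow> ('c \<Rightarrow> 'k::field) \<Rightarrow> 'b \<Rightarrow> 'k" where
  "free_map_transpose g f = (\<lambda>p. f (g p))"

definition proj_rep :: "('v, 'a) pre_digraph \<Rightarrow> 'v \<Rightarrow> ('v, 'a, 'a list \<Rightarrow> 'k::field) rep" where
  "proj_rep Q a = \<lparr>spc = (\<lambda>x. free_space (paths Q a x)), act = (\<lambda>\<alpha>. free_map (\<lambda>p. p @ [\<alpha>]))\<rparr>"

definition inj_rep :: "('v, 'a) pre_digraph \<Rightarrow> 'v \<Rightarrow> ('v, 'a, 'a list \<Rightarrow> 'k::field) rep" where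
  "inj_rep Q a =
     \<lparr>spc = (\<lambda>x. free_space (paths Q x a)), act = (\<lambda>\<alpha>. free_map_transpose (\<lambda>p. \<alpha> # p))\<rparr>"

definition proj_sum ::
  "('v, 'a) pre_digraph \<Rightarrow> 'v list \<Rightarrow> ('v, 'a, nat \<Rightarrow> 'a list \<Rightarrow> 'k::field) rep" where
  "proj_sum Q as = rep_sum (length as) (\<lambda>i. proj_rep Q (as ! i))"

definition inj_sum ::
  "('v, 'a) pre_digraph \<Rightarrow> 'v list \<Rightarrow> ('v, 'a, nat \<Rightarrow> 'a list \<Rightarrow> 'k::field) rep" where
  "inj_sum Q as = rep_sum (length as) (\<lambda>i. inj_rep Q (as ! i))"

definition sum_scale :: "'k::field \<Rightarrow> (nat \<Rightarrow> 'b \<Rightarrow> 'k) \<Rightarrow> nat \<Rightarrow> 'b \<Rightarrow> 'k" where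
  "sum_scale = fun_scale (fun_scale (*))"

definition rep_plus ::
  "('k::field \<Rightarrow> 'u::ab_group_add \<Rightarrow> 'u) \<Rightarrow> ('v, 'a) pre_digraph \<Rightarrow> ('v, 'a, 'u) rep \<Rightarrow> bool" where
  "rep_plus s Q M \<longleftrightarrow>
     is_rep s Q M \<and>
     (\<exists>as bs f g. set as \<subseteq> verts Q \<and> set bs \<subseteq> verts Q \<and>
        short_exact sum_scale sum_scale s Q (proj_sum Q bs) (proj_sum Q as) M f g)"

definition rep_minus ::
  "('k::field \<Rightarrow> 'u::ab_group_add \<Rightarrow> 'u) \<Rightarrow> ('v, 'a) pre_digraph \<Rightarrow> ('v, 'a, 'u) rep \<Rightarrow> bool" where
  "rep_minus s Q M \<longleftrightarrow>
     is_rep s Q M \<and>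
     (\<exists>as bs f g. set as \<subseteq> verts Q \<and> set bs \<subseteq> verts Q \<and>
        short_exact s sum_scale sum_scale Q M (inj_sum Q as) (inj_sum Q bs) f g)"

definition supports :: "('v, 'a) pre_digraph \<Rightarrow> ('v, 'a, 'u::zero) rep \<Rightarrow> 'a \<Rightarrow> bool" where
  "supports Q M \<alpha> \<longleftrightarrow> \<alpha> \<in> arcs Q \<and> (\<exists>v \<in> spc M (tail Q \<alpha>). act M \<alpha> v \<noteq> 0)"

definition finite_extension ::
  "('k::field \<Rightarrow> 'u::ab_group_add \<Rightarrow> 'u) \<Rightarrow> ('v, 'a) pre_digraph
    \<Rightarrow> ('v, 'a, 'u) rep \<Rightarrow> ('v, 'a, 'u) rep \<Rightarrow> ('v, 'a, 'u) rep
    \<Rightarrow> ('v \<Rightarrow> 'u \<Rightarrow> 'u) \<Rightarrow> ('v \<Rightarrow> 'u \<Rightarrow> 'u) \<Rightarrow> bool" where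
  "finite_extension s Q L M N f g \<longleftrightarrow>
     short_exact s s s Q L M N f g \<and>
     finite {\<alpha>. supports Q M \<alpha> \<and> \<not> supports Q (rep_sum2 L N) \<alpha>}"

definition rep_bar ::
  "('k::field \<Rightarrow> 'u::ab_group_add \<Rightarrow> 'u) \<Rightarrow> ('v, 'a) pre_digraph \<Rightarrow> ('v, 'a, 'u) rep \<Rightarrow> bool" where
  "rep_bar s Q M \<longleftrightarrow>
     is_rep s Q M \<and>
     (\<exists>L N f g. rep_plus s Q L \<and> rep_minus s Q N \<and> finite_extension s Q L M N f g)"

text \<open>Irreducible morphisms of the full subcategory of \<open>rep(Q)\<close> with objects \<open>C\<close>.\<close>

definition irreducible_in ::
  "(('v, 'a, 'u) rep \<Rightarrow> bool) \<Rightarrow> ('k::field \<Rightarrow> 'u::ab_group_add \<Rightarrow> 'u) \<Rightarrow> ('v, 'a) pre_digraph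
    \<Rightarrow> ('v, 'a, 'u) rep \<Rightarrow> ('v, 'a, 'u) rep \<Rightarrow> ('v \<Rightarrow> 'u \<Rightarrow> 'u) \<Rightarrow> bool" where
  "irreducible_in C s Q M N f \<longleftrightarrow>
     C M \<and> C N \<and> rep_hom s s Q M N f \<and>
     \<not> rep_section s s Q M N f \<and> \<not> rep_retraction s s Q M N f \<and>
     (\<forall>X g h. C X \<and> rep_hom s s Q M X h \<and> rep_hom s s Q X N g \<and>
        (\<forall>x \<in> verts Q. \<forall>v \<in> spc M x. f x v = g x (h x v)) \<longrightarrow>
        rep_section s s Q M X h \<or> rep_retraction s s Q X N g)"

definition doubly_infinite ::
  "('k::field \<Rightarrow> 'u::ab_group_add \<Rightarrow> 'u) \<Rightarrow> ('v, 'a) pre_digraph \<Rightarrow> ('v, 'a, 'u) rep \<Rightarrow> bool" where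
  "doubly_infinite s Q M \<longleftrightarrow>
     indecomposable s Q M \<and> rep_bar s Q M \<and> \<not> rep_plus s Q M \<and> \<not> rep_minus s Q M"

end

theory Submission
  imports Defs
begin

text \<open>
  Let \<open>Pred F\<close> and \<open>Succ F\<close> be the sets of vertices with a path to, respectively from, a
  finite set \<open>F\<close>; by interval-finiteness \<open>Pred F \<inter> Succ F\<close> is finite. For \<open>M\<close> in the category
  of finite extensions and \<open>F\<close> large, the quotient \<open>M|\<^bsub>Pred F\<^esub>\<close> is finitely co-presented, the
  subrepresentation \<open>M|\<^bsub>Succ F\<^esub>\<close> is finitely presented, and no arrow from outside \<open>Succ F\<close> to
  outside \<open>Pred F\<close> supports \<open>M\<close>.

  If \<open>N\<close> is finitely co-presented, then \<open>f : M \<rightarrow> N\<close> factors through \<open>M|\<^bsub>Pred F\<^esub>\<close>. For large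
  \<open>F\<close> a section \<open>N \<rightarrow> M|\<^bsub>Pred F\<^esub>\<close> lifts to \<open>M\<close>, so irreducibility makes \<open>M \<rightarrow> M|\<^bsub>Pred F\<^esub>\<close>
  injective and \<open>M\<close> is finitely co-presented. Dually, if \<open>M\<close> is finitely presented then so is
  \<open>N\<close>.

  The main point is that \<open>M\<close> is finitely co-presented or \<open>N\<close> is finitely presented. Otherwise
  factor \<open>f\<close> through the pullback \<open>Y\<close> of \<open>M|\<^bsub>Pred F\<^esub> \<rightarrow> N/N|\<^bsub>Succ F\<^esub> \<leftarrow> N\<close>. If \<open>M \<rightarrow> Y\<close> is a
  section, it yields \<open>v : N|\<^bsub>Succ F\<^esub> \<rightarrow> M\<close> with \<open>v f = 1\<close> outside \<open>Pred F\<close>. On a smaller fixed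
  finite set of vertices \<open>v\<close> agrees with a morphism \<open>w : N \<rightarrow> M\<close>, provided \<open>F\<close> was chosen large,
  because only finitely many linear conditions matter there. Gluing \<open>v\<close> and \<open>w\<close> along this set
  gives a morphism \<open>w' : N \<rightarrow> M\<close> such that \<open>w' f\<close> fixes a nonzero vector, and hence is invertible by
  Fitting's lemma since \<open>M\<close> is indecomposable: \<open>f\<close> is a section. If \<open>Y \<rightarrow> N\<close> is a retraction,
  the dual argument makes \<open>f\<close> a retraction.

  Finally, if \<open>M\<close> is finitely co-presented and \<open>N\<close> finitely presented, then the image of \<open>f\<close> has
  finite support, and \<open>f\<close> factors through it.
\<close>

section \<open>Quivers and linear algebra\<close>

text \<open>What the overview takes for granted is that finite presentation and co-presentation
  survive changes at finitely many vertices. A (co-)presentation that is exact except on a finite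
  set is repaired one vector at a time. Since Q has no oriented cycles, the defect has a source or a
  sink to start from. Since Q is locally finite, each repair adds only finitely many relations.

  The obstacle in the main step is that \<open>v\<close>, extended by zero to N, fails to commute
  with the arrows entering Succ F, which move as F grows. Gluing needs \<open>v\<close> only up to
  its values on a finite set D fixed in advance. The finitely many arrows whose conditions decide
  these values depend on D alone, so F can be chosen after them.

  M may have infinite total dimension, so Fitting's lemma is used vertex by vertex, with an exponent
  that may vary with the vertex. The pullback Y lives in a product of two copies of the ambient
  space, whereas irreducibility is tested on representations in one copy. Infinite dimension of the
  ambient space allows Y to be moved there.\<close>

definition succs :: "('v, 'a) pre_digraph \<Rightarrow> 'v set \<Rightarrow> 'v set" where
  "succs Q F = {y. \<exists>x \<in> F. paths Q x y \<noteq> {}}"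

definition preds :: "('v, 'a) pre_digraph \<Rightarrow> 'v set \<Rightarrow> 'v set" where
  "preds Q F = {x. \<exists>y \<in> F. paths Q x y \<noteq> {}}"

section \<open>Paths in a strongly locally finite quiver\<close>

locale slf_quiver =
  fixes Q :: "('v, 'a) pre_digraph"
  assumes slf: "strongly_locally_finite Q"
begin

sublocale wf_digraph Q
  using slf by (simp add: strongly_locally_finite_def locally_finite_quiver_def)

lemma finite_arcs_at: "x \<in> verts Q \<Longrightarrow> finite (in_arcs Q x)" "x \<in> verts Q \<Longrightarrow> finite (out_arcs Q x)"
  using slf by (simp_all add: strongly_locally_finite_def locally_finite_quiver_def)

lemma paths_verts: "p \<in> paths Q x y \<Longrightarrow> x \<in> verts Q" "p \<in> paths Q x y \<Longrightarrow> y \<in> verts Q"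
  by (auto simp: paths_def)

lemma finite_paths: "finite (paths Q x y)"
proof (cases "paths Q x y = {}")
  case False
  then have "x \<in> verts Q" "y \<in> verts Q" using paths_verts by blast+
  then show ?thesis using slf by (simp add: strongly_locally_finite_def interval_finite_def)
qed simp

lemma Nil_in_paths: "[] \<in> paths Q x y \<longleftrightarrow> x = y \<and> x \<in> verts Q"
  by (simp add: paths_def awalk_Nil_iff)

lemma Cons_in_paths:
  "\<alpha> # p \<in> paths Q x y \<longleftrightarrow> \<alpha> \<in> arcs Q \<and> x = tail Q \<alpha> \<and> p \<in> paths Q (head Q \<alpha>) y"
  by (simp add: paths_def awalk_Cons_iff)

lemma append_in_paths:
  assumes "p \<in> paths Q x y" "q \<in> paths Q y z"
  shows "p @ q \<in> paths Q x z"
  using assms by (auto simp: paths_def)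

lemma append_in_pathsE:
  assumes "p @ q \<in> paths Q x z"
  obtains y where "p \<in> paths Q x y" "q \<in> paths Q y z"
  using assms by (auto simp: paths_def)

lemma snoc_in_paths:
  "p @ [\<alpha>] \<in> paths Q x y \<longleftrightarrow> \<alpha> \<in> arcs Q \<and> y = head Q \<alpha> \<and> p \<in> paths Q x (tail Q \<alpha>)"
proof
  assume "p @ [\<alpha>] \<in> paths Q x y"
  then obtain z where "p \<in> paths Q x z" "[\<alpha>] \<in> paths Q z y" by (rule append_in_pathsE)
  then show "\<alpha> \<in> arcs Q \<and> y = head Q \<alpha> \<and> p \<in> paths Q x (tail Q \<alpha>)"
    by (auto simp: Cons_in_paths Nil_in_paths)
next
  assume "\<alpha> \<in> arcs Q \<and> y = head Q \<alpha> \<and> p \<in> paths Q x (tail Q \<alpha>)"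
  then show "p @ [\<alpha>] \<in> paths Q x y"
    by (auto intro!: append_in_paths simp: Cons_in_paths Nil_in_paths)
qed

lemma arc_in_paths: "\<alpha> \<in> arcs Q \<Longrightarrow> [\<alpha>] \<in> paths Q (tail Q \<alpha>) (head Q \<alpha>)"
  by (simp add: Cons_in_paths Nil_in_paths)

text \<open>There are no oriented cycles: the powers of a nontrivial closed path have different
  lengths, so they would be infinitely many paths with the same end points.\<close>

lemma paths_same:
  assumes "x \<in> verts Q" shows "paths Q x x = {[]}"
proof (rule ccontr)
  assume "paths Q x x \<noteq> {[]}"
  then obtain p where p: "p \<in> paths Q x x" "p \<noteq> []"
    using assms by (auto simp: Nil_in_paths)
  have "concat (replicate n p) \<in> paths Q x x" for n
    by (induction n) (use p assms in \<open>auto simp: Nil_in_paths intro: append_in_paths\<close>)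
  then have "range (\<lambda>n. concat (replicate n p)) \<subseteq> paths Q x x" by blast
  moreover have "inj (\<lambda>n. concat (replicate n p))"
  proof (rule injI)
    fix m n assume "concat (replicate m p) = concat (replicate n p)"
    then have "length (concat (replicate m p)) = length (concat (replicate n p))" by simp
    then show "m = n" using p(2) by (simp add: length_concat sum_list_replicate)
  qed
  ultimately show False
    using finite_paths[of x x] finite_subset range_inj_infinite by blast
qed

lemma succs_verts: "succs Q F \<subseteq> verts Q" and preds_verts: "preds Q F \<subseteq> verts Q"
  by (auto simp: succs_def preds_def dest: paths_verts)

lemma subset_succs: "F \<subseteq> verts Q \<Longrightarrow> F \<subseteq> succs Q F"
  and subset_preds: "F \<subseteq> verts Q \<Longrightarrow> F \<subseteq> preds Q F"
  using Nil_in_paths by (fastforce simp: succs_def preds_def)+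

lemma succs_mono: "F \<subseteq> G \<Longrightarrow> succs Q F \<subseteq> succs Q G"
  and preds_mono: "F \<subseteq> G \<Longrightarrow> preds Q F \<subseteq> preds Q G"
  by (auto simp: succs_def preds_def)

lemma succs_head: "\<alpha> \<in> arcs Q \<Longrightarrow> tail Q \<alpha> \<in> succs Q F \<Longrightarrow> head Q \<alpha> \<in> succs Q F"
  unfolding succs_def using append_in_paths[OF _ arc_in_paths] by blast

lemma preds_tail: "\<alpha> \<in> arcs Q \<Longrightarrow> head Q \<alpha> \<in> preds Q F \<Longrightarrow> tail Q \<alpha> \<in> preds Q F"
  unfolding preds_def using append_in_paths[OF arc_in_paths] by blast

text \<open>Such a vertex lies on a path from \<open>F\<close> to \<open>G\<close>. There are
  finitely many of these paths, and each visits finitely many vertices.\<close>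

lemma finite_succs_Int_preds:
  assumes "finite F" "finite G" shows "finite (succs Q F \<inter> preds Q G)"
proof (rule finite_subset)
  show "succs Q F \<inter> preds Q G \<subseteq> (\<Union>x\<in>F. \<Union>y\<in>G. \<Union>p\<in>paths Q x y. set (awalk_verts x p))"
  proof
    fix z assume "z \<in> succs Q F \<inter> preds Q G"
    then obtain x y p q where z: "x \<in> F" "y \<in> G" "p \<in> paths Q x z" "q \<in> paths Q z y"
      by (auto simp: succs_def preds_def)
    then have "p @ q \<in> paths Q x y" by (simp add: append_in_paths)
    moreover have "z \<in> set (awalk_verts x (p @ q))"
    proof -
      have "awlast x p = z" using z(3) by (simp add: paths_def)
      moreover have "awalk_verts x (p @ q) = awalk_verts x p @ tl (awalk_verts (awlast x p) q)"
        using awalk_verts_append[of x p q y] \<open>p @ q \<in> paths Q x y\<close> by (simp add: paths_def)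
      moreover have "awlast x p \<in> set (awalk_verts x p)" by simp
      ultimately show ?thesis by simp
    qed
    ultimately show "z \<in> (\<Union>x\<in>F. \<Union>y\<in>G. \<Union>p\<in>paths Q x y. set (awalk_verts x p))"
      using z by blast
  qed
qed (use assms finite_paths in auto)

text \<open>The start of a longest path is a source of \<open>D\<close> and its end a sink, because
  an arrow from \<open>D\<close> into the start or from the end into \<open>D\<close> would lengthen
  it. Inner vertices of the path may lie outside \<open>D\<close>.\<close>

lemma ex_longest_path:
  assumes "finite D" "D \<noteq> {}" "D \<subseteq> verts Q"
  obtains x y p where "x \<in> D" "y \<in> D" "p \<in> paths Q x y"
    "\<And>x' y' q. x' \<in> D \<Longrightarrow> y' \<in> D \<Longrightarrow> q \<in> paths Q x' y' \<Longrightarrow> length q \<le> length p"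
proof -
  define W where "W = (\<Union>x\<in>D. \<Union>y\<in>D. paths Q x y)"
  have "finite W" using assms by (auto simp: W_def finite_paths)
  moreover from assms obtain x0 where "x0 \<in> D" by blast
  then have "[] \<in> W" using assms by (auto simp: W_def Nil_in_paths)
  ultimately obtain p where p: "p \<in> W" "\<And>q. q \<in> W \<Longrightarrow> length q \<le> length p"
    using Max_in[of "length ` W"] Max_ge[of "length ` W"]
    by (metis (no_types, lifting) empty_iff finite_imageI imageE image_eqI)
  obtain x y where "x \<in> D" "y \<in> D" "p \<in> paths Q x y" using p(1) by (auto simp: W_def)
  moreover have "length q \<le> length p" if "x' \<in> D" "y' \<in> D" "q \<in> paths Q x' y'" for x' y' q
    using that by (intro p(2)) (auto simp: W_def)
  ultimately show ?thesis by (rule that)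
qed

lemma ex_source:
  assumes "finite D" "D \<noteq> {}" "D \<subseteq> verts Q"
  shows "\<exists>x\<in>D. \<forall>\<alpha>\<in>arcs Q. head Q \<alpha> = x \<longrightarrow> tail Q \<alpha> \<notin> D"
proof -
  obtain x y p where p: "x \<in> D" "y \<in> D" "p \<in> paths Q x y"
    "\<And>x' y' q. x' \<in> D \<Longrightarrow> y' \<in> D \<Longrightarrow> q \<in> paths Q x' y' \<Longrightarrow> length q \<le> length p"
    by (rule ex_longest_path[OF assms]) (rule that)
  have "tail Q \<alpha> \<notin> D" if "\<alpha> \<in> arcs Q" "head Q \<alpha> = x" for \<alpha>
    using p(4)[of "tail Q \<alpha>" y "\<alpha> # p"] p(2,3) that by (auto simp: Cons_in_paths)
  then show ?thesis using p(1) by blast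
qed

lemma ex_sink:
  assumes "finite D" "D \<noteq> {}" "D \<subseteq> verts Q"
  shows "\<exists>x\<in>D. \<forall>\<alpha>\<in>arcs Q. tail Q \<alpha> = x \<longrightarrow> head Q \<alpha> \<notin> D"
proof -
  obtain x y p where p: "x \<in> D" "y \<in> D" "p \<in> paths Q x y"
    "\<And>x' y' q. x' \<in> D \<Longrightarrow> y' \<in> D \<Longrightarrow> q \<in> paths Q x' y' \<Longrightarrow> length q \<le> length p"
    by (rule ex_longest_path[OF assms]) (rule that)
  have "head Q \<alpha> \<notin> D" if "\<alpha> \<in> arcs Q" "tail Q \<alpha> = y" for \<alpha>
    using p(4)[of x "head Q \<alpha>" "p @ [\<alpha>]"] p(1,3) that by (auto simp: snoc_in_paths)
  then show ?thesis using p(2) by blast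
qed

end

section \<open>Linear algebra on subspaces of a vector space\<close>

lemma vector_space_fun_scale:
  assumes "vector_space s" shows "vector_space (fun_scale s)"
proof -
  interpret vector_space s by fact
  show ?thesis by unfold_locales (auto simp: fun_scale_def algebra_simps fun_eq_iff)
qed

lemma vector_space_mult: "vector_space ((*) :: 'k::field \<Rightarrow> 'k \<Rightarrow> 'k)"
  by unfold_locales (auto simp: algebra_simps)

lemma vector_space_sum_scale: "vector_space (sum_scale :: 'k::field \<Rightarrow> _)"
  unfolding sum_scale_def by (intro vector_space_fun_scale vector_space_mult)

lemma vector_space_prod_scale:
  assumes "vector_space s" "vector_space t" shows "vector_space (prod_scale s t)"
proof -
  interpret s: vector_space s by fact
  interpret t: vector_space t by fact
  show ?thesis
    by unfold_locales (auto simp: prod_scale_def s.scale_right_distrib t.scale_right_distrib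
        s.scale_left_distrib t.scale_left_distrib)
qed

lemma fd_spaceD: "fd_space s S \<Longrightarrow> module.subspace s S"
  by (simp add: fd_space_def)

context vector_space
begin

lemma fd_space_basis:
  assumes "fd_space scale S"
  obtains B where "finite B" "B \<subseteq> S" "independent B" "span B = S"
proof -
  obtain C where C: "finite C" "C \<subseteq> S" "span C = S"
    using assms by (auto simp: fd_space_def)
  obtain B where B: "B \<subseteq> C" "independent B" "C \<subseteq> span B"
    using maximal_independent_subset by blast
  have "span B = S"
    using B(1,3) C(3) by (metis span_mono span_span subset_antisym)
  then show ?thesis using that[of B] B C by (meson finite_subset subset_trans)
qed

lemma fd_space_subspace:
  assumes "fd_space scale S" "subspace T" "T \<subseteq> S"
  shows "fd_space scale T"
proof -
  obtain B where B: "finite B" "B \<subseteq> S" "independent B" "span B = S"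
    using assms(1) by (rule fd_space_basis)
  obtain C where C: "C \<subseteq> T" "independent C" "T \<subseteq> span C"
    using maximal_independent_subset by blast
  have "finite C"
    using independent_span_bound[OF B(1) C(2)] C(1) assms(3) B(4) by blast
  then show ?thesis
    unfolding fd_space_def using C assms(2) by (metis span_minimal subset_antisym)
qed

text \<open>The ambient space of the theorem has infinite dimension, so \<open>dim\<close> is
  compared only inside a finite-dimensional subspace. These comparisons give the decreasing measures
  of the repairs and the stationary chains of Fitting's lemma.\<close>

lemma fd_space_dim_le:
  assumes "fd_space scale S" "T \<subseteq> S"
  shows "dim T \<le> dim S"
proof -
  obtain B where B: "finite B" "B \<subseteq> S" "independent B" "span B = S"
    using assms(1) by (rule fd_space_basis)
  then have "dim S = card B" using basis_card_eq_dim span_superset by (metis subset_refl)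
  then show ?thesis using dim_le_card[of T B] B assms(2) by simp
qed

lemma fd_space_dim_less:
  assumes "fd_space scale S" "subspace T" "T \<subset> S"
  shows "dim T < dim S"
proof -
  obtain B where B: "finite B" "B \<subseteq> T" "independent B" "span B = T"
    using fd_space_subspace[OF assms(1,2)] assms(3) fd_space_basis by (metis psubset_imp_subset)
  obtain a where a: "a \<in> S" "a \<notin> T" using assms(3) by blast
  have i: "independent (insert a B)" using B a by (simp add: independent_insertI)
  have "dim T = card B" using B basis_card_eq_dim span_superset by (metis subset_refl)
  moreover have "dim (insert a B) = card (insert a B)"
    using i by (rule dim_eq_card_independent)
  moreover have "card (insert a B) = Suc (card B)"
    using B a span_base by (metis card_insert_disjoint)
  moreover have "dim (insert a B) \<le> dim S"
    using fd_space_dim_le[OF assms(1)] B a assms(3) by auto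
  ultimately show ?thesis by simp
qed

lemma fd_space_0: "fd_space scale {0}"
  unfolding fd_space_def by (auto intro!: exI[of _ "{}"])

end

lemma linear_map_onI:
  assumes "\<And>u. u \<in> S \<Longrightarrow> f u \<in> T"
    and "\<And>u v. u \<in> S \<Longrightarrow> v \<in> S \<Longrightarrow> f (u + v) = f u + f v"
    and "\<And>c u. u \<in> S \<Longrightarrow> f (s c u) = t c (f u)"
  shows "linear_map_on s t S T f"
  using assms by (auto simp: linear_map_on_def)

lemma linear_map_onD:
  assumes "linear_map_on s t S T f"
  shows "u \<in> S \<Longrightarrow> f u \<in> T"
    and "u \<in> S \<Longrightarrow> v \<in> S \<Longrightarrow> f (u + v) = f u + f v"
    and "u \<in> S \<Longrightarrow> f (s c u) = t c (f u)"
  using assms by (auto simp: linear_map_on_def)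

lemma linear_map_on_comp:
  assumes "linear_map_on s t S T f" "linear_map_on t r T U g"
  shows "linear_map_on s r S U (\<lambda>v. g (f v))"
  using assms by (auto simp: linear_map_on_def image_subset_iff)

lemma linear_map_on_cong:
  assumes "linear_map_on s t S T f" "module.subspace s S" "module s" "\<And>v. v \<in> S \<Longrightarrow> f v = g v"
  shows "linear_map_on s t S T g"
proof -
  interpret module s by fact
  show ?thesis
    using assms(1,2,4) subspace_add subspace_scale
    by (fastforce simp: linear_map_on_def image_subset_iff)
qed

context vector_space_pair
begin

lemma linear_map_on_zero:
  assumes "linear_map_on s1 s2 S T f" "vs1.subspace S"
  shows "f 0 = 0"
proof -
  have "0 \<in> S" using assms(2) by (rule vs1.subspace_0)
  then have "f (s1 0 0) = s2 0 (f 0)" using assms(1) by (metis linear_map_onD(3))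
  then show ?thesis by simp
qed

lemma linear_map_on_diff:
  assumes "linear_map_on s1 s2 S T f" "vs1.subspace S" "u \<in> S" "v \<in> S"
  shows "f (u - v) = f u - f v"
proof -
  have "f ((u - v) + v) = f (u - v) + f v"
    using assms vs1.subspace_diff by (metis linear_map_onD(2))
  then show ?thesis by simp
qed

lemma linear_map_on_sum:
  assumes "linear_map_on s1 s2 S T f" "vs1.subspace S" "\<And>i. i \<in> I \<Longrightarrow> h i \<in> S"
  shows "f (\<Sum>i\<in>I. h i) = (\<Sum>i\<in>I. f (h i))"
  using assms(3)
proof (induction I rule: infinite_finite_induct)
  case (insert i I)
  have "f (h i + sum h I) = f (h i) + f (sum h I)"
    using insert.prems by (intro linear_map_onD(2)[OF assms(1)] vs1.subspace_sum[OF assms(2)]) auto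
  then show ?case using insert by simp
qed (use linear_map_on_zero[OF assms(1,2)] in auto)

text \<open>A function that is linear on \<open>S\<close> is arbitrary elsewhere. Prescribing its
  values on a basis of \<open>S\<close> replaces it by a linear map on the whole ambient space, to
  which the theory of spans and bases applies.\<close>

lemma linear_map_on_extend:
  assumes "linear_map_on s1 s2 S T f" "vs1.subspace S"
  obtains g where "Vector_Spaces.linear s1 s2 g" "\<And>v. v \<in> S \<Longrightarrow> g v = f v"
proof -
  obtain B where B: "B \<subseteq> S" "vs1.independent B" "S \<subseteq> vs1.span B"
    using vs1.maximal_independent_subset by blast
  obtain g where g: "Vector_Spaces.linear s1 s2 g" "\<forall>v\<in>B. g v = f v"
    using linear_independent_extend[OF B(2)] by blast
  interpret g: Vector_Spaces.linear s1 s2 g by fact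
  have "g v = f v" if v: "v \<in> vs1.span B" for v
  proof -
    have sub: "vs1.span B \<subseteq> S" using B(1) assms(2) by (rule vs1.span_minimal)
    from v have "v \<in> S \<and> g v = f v"
    proof (induction rule: vs1.span_induct_alt)
      case base then show ?case using linear_map_on_zero[OF assms] vs1.subspace_0[OF assms(2)] by simp
    next
      case (step c x y)
      have x: "x \<in> S" using step B by blast
      have cx: "s1 c x \<in> S" using x assms(2) by (simp add: vs1.subspace_scale)
      show ?case
        using step cx x g(2) assms(2) vs1.subspace_add[OF assms(2) cx]
        by (simp add: g.add g.scale linear_map_onD[OF assms(1)])
    qed
    then show ?thesis by simp
  qed
  then show ?thesis using that g(1) B(3) by blast
qed

lemma linear_map_on_linear:
  assumes "Vector_Spaces.linear s1 s2 g" "g ` S \<subseteq> T" shows "linear_map_on s1 s2 S T g"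
proof -
  interpret g: Vector_Spaces.linear s1 s2 g by fact
  show ?thesis using assms(2) by (auto simp: linear_map_on_def g.add g.scale)
qed

lemma linear_map_on_inj_iff:
  assumes "linear_map_on s1 s2 S T f" "vs1.subspace S"
  shows "inj_on f S \<longleftrightarrow> (\<forall>v\<in>S. f v = 0 \<longrightarrow> v = 0)"
proof
  assume "inj_on f S"
  then show "\<forall>v\<in>S. f v = 0 \<longrightarrow> v = 0"
    using linear_map_on_zero[OF assms] vs1.subspace_0[OF assms(2)] by (metis inj_onD)
next
  assume k: "\<forall>v\<in>S. f v = 0 \<longrightarrow> v = 0"
  show "inj_on f S"
  proof (rule inj_onI)
    fix u v assume uv: "u \<in> S" "v \<in> S" "f u = f v"
    then have "u - v \<in> S" "f (u - v) = 0"
      using assms by (auto simp: linear_map_on_diff intro: vs1.subspace_diff)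
    then show "u = v" using k by auto
  qed
qed

lemma subspace_image_on:
  assumes "linear_map_on s1 s2 S T f" "vs1.subspace S"
  shows "vs2.subspace (f ` S)"
proof (rule vs2.subspaceI)
  show "0 \<in> f ` S" using linear_map_on_zero[OF assms] vs1.subspace_0[OF assms(2)] by force
next
  fix x y assume "x \<in> f ` S" "y \<in> f ` S"
  then show "x + y \<in> f ` S"
    using linear_map_onD(2)[OF assms(1)] vs1.subspace_add[OF assms(2)] by (force simp: image_iff)
next
  fix c x assume "x \<in> f ` S"
  then obtain u where "u \<in> S" "x = f u" by blast
  then show "s2 c x \<in> f ` S"
    using linear_map_onD(3)[OF assms(1)] vs1.subspace_scale[OF assms(2)] by (metis imageI)
qed

lemma subspace_kernel_on:
  assumes "linear_map_on s1 s2 S T f" "vs1.subspace S"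
  shows "vs1.subspace {v \<in> S. f v = 0}"
  by (rule vs1.subspaceI)
    (use assms in \<open>auto simp: linear_map_onD[OF assms(1)] linear_map_on_zero
      intro: vs1.subspace_0 vs1.subspace_add vs1.subspace_scale\<close>)

lemma fd_space_image:
  assumes "linear_map_on s1 s2 S T f" "fd_space s1 S"
  shows "fd_space s2 (f ` S)"
proof -
  have S: "vs1.subspace S" using assms(2) by (rule fd_spaceD)
  obtain B where B: "finite B" "B \<subseteq> S" "vs1.span B = S"
    using assms(2) by (auto simp: fd_space_def)
  obtain g where g: "Vector_Spaces.linear s1 s2 g" "\<And>v. v \<in> S \<Longrightarrow> g v = f v"
    using linear_map_on_extend[OF assms(1) S] by blast
  interpret g: Vector_Spaces.linear s1 s2 g by fact
  have "g ` S = f ` S" using g(2) by auto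
  moreover have "vs2.span (g ` B) = g ` S" using g.span_image[of B] B by simp
  ultimately show ?thesis
    unfolding fd_space_def using subspace_image_on[OF assms(1) S] B
    by (metis finite_imageI image_mono)
qed

lemma linear_map_on_inverse:
  assumes "linear_map_on s1 s2 S T f" "vs1.subspace S" "bij_betw f S T"
  shows "linear_map_on s2 s1 T S (the_inv_into S f)"
proof (rule linear_map_onI)
  have inj: "inj_on f S" and im: "f ` S = T" using assms(3) by (auto simp: bij_betw_def)
  fix u assume u: "u \<in> T"
  then obtain a where a: "a \<in> S" "u = f a" using im by blast
  then show "the_inv_into S f u \<in> S" using inj by (simp add: the_inv_into_f_f)
  fix c
  have "f (s1 c a) = s2 c u" using a linear_map_onD(3)[OF assms(1)] by simp
  then show "the_inv_into S f (s2 c u) = s1 c (the_inv_into S f u)"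
    using a inj the_inv_into_f_f vs1.subspace_scale[OF assms(2)] by metis
  fix v assume v: "v \<in> T"
  then obtain b where b: "b \<in> S" "v = f b" using im by blast
  have "f (a + b) = u + v" using a b linear_map_onD(2)[OF assms(1)] by simp
  then show "the_inv_into S f (u + v) = the_inv_into S f u + the_inv_into S f v"
    using a b inj the_inv_into_f_f vs1.subspace_add[OF assms(2)] by metis
qed

end

section \<open>Representations\<close>

text \<open>The linear part of \<open>is_rep\<close>. Most lemmas on morphisms assume only this, and
  it is all that is proved about the sums of the P_a and of the I_a.\<close>

definition lin_rep ::
  "('k::field \<Rightarrow> 'u::ab_group_add \<Rightarrow> 'u) \<Rightarrow> ('v, 'a) pre_digraph \<Rightarrow> ('v, 'a, 'u) rep \<Rightarrow> bool" where
  "lin_rep s Q M \<longleftrightarrow>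
     (\<forall>x \<in> verts Q. module.subspace s (spc M x)) \<and>
     (\<forall>\<alpha> \<in> arcs Q. linear_map_on s s (spc M (tail Q \<alpha>)) (spc M (head Q \<alpha>)) (act M \<alpha>))"

text \<open>Restriction to \<open>D\<close>, extended by zero. It is a subrepresentation if
  \<open>D\<close> is closed under successors and a quotient if \<open>D\<close> is closed under
  predecessors. For other \<open>D\<close> it is still a representation, as a quiver imposes no
  relations.\<close>

definition rep_res :: "('v, 'a) pre_digraph \<Rightarrow> ('v, 'a, 'u::zero) rep \<Rightarrow> 'v set \<Rightarrow> ('v, 'a, 'u) rep" where
  "rep_res Q M D =
     \<lparr>spc = (\<lambda>x. if x \<in> D then spc M x else {0}),
      act = (\<lambda>\<alpha> v. if tail Q \<alpha> \<in> D \<and> head Q \<alpha> \<in> D then act M \<alpha> v else 0)\<rparr>"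

definition list_sum :: "('v \<Rightarrow> ('v, 'a, 'u::zero) rep) \<Rightarrow> 'v list \<Rightarrow> ('v, 'a, nat \<Rightarrow> 'u) rep" where
  "list_sum R as = rep_sum (length as) (\<lambda>i. R (as ! i))"

text \<open>The projection of a sum onto its first \<open>n\<close> summands. The embedding in the
  other direction is the identity, because elements of a sum vanish at all further indices.\<close>

definition trunc :: "nat \<Rightarrow> (nat \<Rightarrow> 'u::zero) \<Rightarrow> nat \<Rightarrow> 'u" where
  "trunc n F = (\<lambda>i. if i < n then F i else 0)"

lemma proj_sum_eq: "proj_sum Q as = list_sum (proj_rep Q) as"
  and inj_sum_eq: "inj_sum Q as = list_sum (inj_rep Q) as"
  by (simp_all add: proj_sum_def inj_sum_def list_sum_def)

lemma is_rep_lin_rep: "is_rep s Q M \<Longrightarrow> lin_rep s Q M"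
  by (simp add: is_rep_def lin_rep_def fd_space_def)

lemma lin_repD:
  assumes "lin_rep s Q M"
  shows "x \<in> verts Q \<Longrightarrow> module.subspace s (spc M x)"
    and "\<alpha> \<in> arcs Q \<Longrightarrow> linear_map_on s s (spc M (tail Q \<alpha>)) (spc M (head Q \<alpha>)) (act M \<alpha>)"
    and "\<alpha> \<in> arcs Q \<Longrightarrow> v \<in> spc M (tail Q \<alpha>) \<Longrightarrow> act M \<alpha> v \<in> spc M (head Q \<alpha>)"
  using assms unfolding lin_rep_def by (blast, blast, blast intro: linear_map_onD(1))

lemma is_repD: "is_rep s Q M \<Longrightarrow> x \<in> verts Q \<Longrightarrow> fd_space s (spc M x)"
  by (simp add: is_rep_def)

lemma rep_homD:
  assumes "rep_hom s t Q M N f"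
  shows "x \<in> verts Q \<Longrightarrow> linear_map_on s t (spc M x) (spc N x) (f x)"
    and "\<alpha> \<in> arcs Q \<Longrightarrow> v \<in> spc M (tail Q \<alpha>) \<Longrightarrow>
           f (head Q \<alpha>) (act M \<alpha> v) = act N \<alpha> (f (tail Q \<alpha>) v)"
    and "x \<in> verts Q \<Longrightarrow> v \<in> spc M x \<Longrightarrow> f x v \<in> spc N x"
  using assms unfolding rep_hom_def by (blast, blast, blast intro: linear_map_onD(1))

lemma rep_homI:
  assumes "\<And>x. x \<in> verts Q \<Longrightarrow> linear_map_on s t (spc M x) (spc N x) (f x)"
    and "\<And>\<alpha> v. \<alpha> \<in> arcs Q \<Longrightarrow> v \<in> spc M (tail Q \<alpha>) \<Longrightarrow>
           f (head Q \<alpha>) (act M \<alpha> v) = act N \<alpha> (f (tail Q \<alpha>) v)"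
  shows "rep_hom s t Q M N f"
  using assms by (auto simp: rep_hom_def)

lemma linear_map_on_mono:
  "linear_map_on s t S T f \<Longrightarrow> S' \<subseteq> S \<Longrightarrow> f ` S' \<subseteq> T' \<Longrightarrow> linear_map_on s t S' T' f"
  unfolding linear_map_on_def by blast

section \<open>Morphisms, restrictions and finite sums\<close>

context slf_quiver
begin

lemma rep_hom_comp:
  assumes "rep_hom s t Q L M f" "rep_hom t r Q M N g"
  shows "rep_hom s r Q L N (\<lambda>x v. g x (f x v))"
proof (rule rep_homI)
  fix x assume x: "x \<in> verts Q"
  show "linear_map_on s r (spc L x) (spc N x) (\<lambda>v. g x (f x v))"
    by (rule linear_map_on_comp[OF rep_homD(1)[OF assms(1) x] rep_homD(1)[OF assms(2) x]])
next
  fix \<alpha> v assume "\<alpha> \<in> arcs Q" "v \<in> spc L (tail Q \<alpha>)"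
  then show "g (head Q \<alpha>) (f (head Q \<alpha>) (act L \<alpha> v)) = act N \<alpha> (g (tail Q \<alpha>) (f (tail Q \<alpha>) v))"
    using rep_homD(2,3)[OF assms(1)] rep_homD(2)[OF assms(2)] by simp
qed

lemma rep_hom_id: "lin_rep s Q M \<Longrightarrow> rep_hom s s Q M M (\<lambda>x v. v)"
  by (rule rep_homI) (auto intro: linear_map_onI)

lemma rep_hom_cong:
  assumes "rep_hom s t Q M N f" "lin_rep s Q M" "module s"
    "\<And>x v. x \<in> verts Q \<Longrightarrow> v \<in> spc M x \<Longrightarrow> f x v = g x v"
  shows "rep_hom s t Q M N g"
proof (rule rep_homI)
  fix x assume x: "x \<in> verts Q"
  show "linear_map_on s t (spc M x) (spc N x) (g x)"
    using linear_map_on_cong[OF rep_homD(1)[OF assms(1) x] lin_repD(1)[OF assms(2) x] assms(3)]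
      assms(4)[OF x] by blast
next
  fix \<alpha> v assume "\<alpha> \<in> arcs Q" "v \<in> spc M (tail Q \<alpha>)"
  then show "g (head Q \<alpha>) (act M \<alpha> v) = act N \<alpha> (g (tail Q \<alpha>) v)"
    using rep_homD(2)[OF assms(1)] assms(4) lin_repD(3)[OF assms(2)]
        by (metis head_in_verts tail_in_verts)
qed

lemma rep_hom_add:
  assumes "vector_space t" "lin_rep t Q N" "rep_hom s t Q M N f" "rep_hom s t Q M N g"
  shows "rep_hom s t Q M N (\<lambda>x v. f x v + g x v)"
proof (rule rep_homI)
  interpret t: vector_space t by fact
  fix x assume x: "x \<in> verts Q"
  note f = rep_homD(1)[OF assms(3) x] and g = rep_homD(1)[OF assms(4) x]
  show "linear_map_on s t (spc M x) (spc N x) (\<lambda>v. f x v + g x v)"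
    using linear_map_onD[OF f] linear_map_onD[OF g] lin_repD(1)[OF assms(2) x]
    by (intro linear_map_onI) (simp_all add: t.subspace_add t.scale_right_distrib)
next
  fix \<alpha> v assume \<alpha>: "\<alpha> \<in> arcs Q" and v: "v \<in> spc M (tail Q \<alpha>)"
  then show "f (head Q \<alpha>) (act M \<alpha> v) + g (head Q \<alpha>) (act M \<alpha> v) =
      act N \<alpha> (f (tail Q \<alpha>) v + g (tail Q \<alpha>) v)"
    using linear_map_onD(2)[OF lin_repD(2)[OF assms(2) \<alpha>]] rep_homD(2,3)[OF assms(3)]
      rep_homD(2,3)[OF assms(4)] by simp
qed

lemma rep_hom_zero:
  assumes "vector_space s" "vector_space t" "lin_rep s Q M" "lin_rep t Q N"
  shows "rep_hom s t Q M N (\<lambda>x v. 0)"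
proof -
  interpret t: vector_space t by fact
  interpret vector_space_pair t t by unfold_locales
  show ?thesis
  proof (rule rep_homI)
    fix x assume "x \<in> verts Q"
    from lin_repD(1)[OF assms(4) this]
    show "linear_map_on s t (spc M x) (spc N x) (\<lambda>v. 0)"
      by (intro linear_map_onI) (simp_all add: t.subspace_0)
  next
    fix \<alpha> assume "\<alpha> \<in> arcs Q"
    then show "0 = act N \<alpha> 0"
      using linear_map_on_zero[OF lin_repD(2)[OF assms(4)] lin_repD(1)[OF assms(4)]] by simp
  qed
qed

lemma rep_hom_sum:
  assumes "vector_space s" "vector_space t" "lin_rep s Q M" "lin_rep t Q N"
    "\<And>i. i \<in> I \<Longrightarrow> rep_hom s t Q M N (f i)"
  shows "rep_hom s t Q M N (\<lambda>x v. \<Sum>i\<in>I. f i x v)"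
  using assms(5)
  by (induction I rule: infinite_finite_induct) (auto intro!: rep_hom_zero rep_hom_add assms(1-4))

lemma rep_hom_inverse:
  assumes "vector_space s" "vector_space t" "lin_rep s Q M" "rep_hom s t Q M N f"
    "\<And>x. x \<in> verts Q \<Longrightarrow> bij_betw (f x) (spc M x) (spc N x)"
  shows "rep_hom t s Q N M (\<lambda>x. the_inv_into (spc M x) (f x))"
proof -
  interpret vector_space_pair s t using assms(1,2) by (simp add: vector_space_pair_def)
  show ?thesis
  proof (rule rep_homI)
    fix x assume "x \<in> verts Q"
    then show "linear_map_on t s (spc N x) (spc M x) (the_inv_into (spc M x) (f x))"
      by (intro linear_map_on_inverse rep_homD(1)[OF assms(4)] lin_repD(1)[OF assms(3)] assms(5))
  next
    fix \<alpha> v assume \<alpha>: "\<alpha> \<in> arcs Q" and v: "v \<in> spc N (tail Q \<alpha>)"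
    note bt = assms(5)[OF tail_in_verts[OF \<alpha>]] and bh = assms(5)[OF head_in_verts[OF \<alpha>]]
    obtain u where u: "u \<in> spc M (tail Q \<alpha>)" "v = f (tail Q \<alpha>) u"
      using bt v by (auto simp: bij_betw_def)
    have "act N \<alpha> v = f (head Q \<alpha>) (act M \<alpha> u)" using u \<alpha> rep_homD(2)[OF assms(4)] by simp
    then show "the_inv_into (spc M (head Q \<alpha>)) (f (head Q \<alpha>)) (act N \<alpha> v) =
        act M \<alpha> (the_inv_into (spc M (tail Q \<alpha>)) (f (tail Q \<alpha>)) v)"
      using u bt bh lin_repD(3)[OF assms(3) \<alpha>] by (simp add: bij_betw_def the_inv_into_f_f)
  qed
qed

lemma linear_map_on_fold_act:
  assumes "lin_rep s Q M" "p \<in> paths Q x y"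
  shows "linear_map_on s s (spc M x) (spc M y) (fold (act M) p)"
  using assms(2)
proof (induction p arbitrary: x)
  case Nil then show ?case by (auto simp: Nil_in_paths intro: linear_map_onI)
next
  case (Cons \<alpha> p)
  then have \<alpha>: "\<alpha> \<in> arcs Q" "x = tail Q \<alpha>" "p \<in> paths Q (head Q \<alpha>) y"
    by (simp_all add: Cons_in_paths)
  have "linear_map_on s s (spc M x) (spc M y) (\<lambda>v. fold (act M) p (act M \<alpha> v))"
    using linear_map_on_comp[OF lin_repD(2)[OF assms(1) \<alpha>(1)] Cons.IH[OF \<alpha>(3)]] \<alpha>(2) by simp
  then show ?case by (simp add: comp_def)
qed

lemma rep_hom_fold_act:
  assumes "lin_rep s Q M" "rep_hom s t Q M N f" "p \<in> paths Q x y" "v \<in> spc M x"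
  shows "f y (fold (act M) p v) = fold (act N) p (f x v)"
  using assms(3,4)
proof (induction p arbitrary: x v)
  case (Cons \<alpha> p)
  then show ?case using lin_repD(3)[OF assms(1)] rep_homD(2)[OF assms(2)] by (auto simp: Cons_in_paths)
qed (auto simp: Nil_in_paths)

lemma is_rep_rep_res:
  assumes "vector_space s" "is_rep s Q M"
  shows "is_rep s Q (rep_res Q M D)"
proof -
  interpret vector_space s by fact
  interpret vector_space_pair s s by unfold_locales
  have "linear_map_on s s (spc (rep_res Q M D) (tail Q \<alpha>)) (spc (rep_res Q M D) (head Q \<alpha>))
      (act (rep_res Q M D) \<alpha>)" if \<alpha>: "\<alpha> \<in> arcs Q" for \<alpha>
  proof -
    note l = lin_repD(2)[OF is_rep_lin_rep[OF assms(2)] \<alpha>]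
    have "0 \<in> spc M (head Q \<alpha>)"
      using subspace_0[OF lin_repD(1)[OF is_rep_lin_rep[OF assms(2)] head_in_verts[OF \<alpha>]]] .
    then show ?thesis using linear_map_onD[OF l]
      by (intro linear_map_onI) (auto simp: rep_res_def)
  qed
  then show ?thesis using assms(2) fd_space_0 by (auto simp: is_rep_def rep_res_def)
qed

lemma spc_rep_res: "spc (rep_res Q M D) x = (if x \<in> D then spc M x else {0})"
  and act_rep_res: "tail Q \<alpha> \<in> D \<Longrightarrow> head Q \<alpha> \<in> D \<Longrightarrow> act (rep_res Q M D) \<alpha> v = act M \<alpha> v"
  by (simp_all add: rep_res_def)

lemma rep_hom_res_incl:
  assumes "vector_space s" "is_rep s Q M" "\<And>\<alpha>. \<alpha> \<in> arcs Q \<Longrightarrow> tail Q \<alpha> \<in> D \<Longrightarrow> head Q \<alpha> \<in> D"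
  shows "rep_hom s s Q (rep_res Q M D) M (\<lambda>x v. v)"
proof -
  interpret vector_space s by fact
  interpret vector_space_pair s s by unfold_locales
  note lin = is_rep_lin_rep[OF assms(2)]
  show ?thesis
  proof (rule rep_homI)
    fix x assume "x \<in> verts Q"
    then show "linear_map_on s s (spc (rep_res Q M D) x) (spc M x) (\<lambda>v. v)"
      using subspace_0 lin_repD(1)[OF lin]
          by (intro linear_map_onI) (auto simp: spc_rep_res split: if_splits)
  next
    fix \<alpha> v assume "\<alpha> \<in> arcs Q" "v \<in> spc (rep_res Q M D) (tail Q \<alpha>)"
    then show "act (rep_res Q M D) \<alpha> v = act M \<alpha> v"
      using assms(3) linear_map_on_zero[OF lin_repD(2)[OF lin] lin_repD(1)[OF lin]]
      by (auto simp: rep_res_def split: if_splits)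
  qed
qed

lemma rep_hom_res_proj:
  assumes "vector_space s" "is_rep s Q M" "\<And>\<alpha>. \<alpha> \<in> arcs Q \<Longrightarrow> head Q \<alpha> \<in> D \<Longrightarrow> tail Q \<alpha> \<in> D"
  shows "rep_hom s s Q M (rep_res Q M D) (\<lambda>x v. if x \<in> D then v else 0)"
proof -
  interpret vector_space s by fact
  show ?thesis using assms(3)
    by (intro rep_homI linear_map_onI) (auto simp: rep_res_def)
qed

lemma lin_rep_list_sum:
  assumes "vector_space t" "\<And>a. a \<in> set as \<Longrightarrow> lin_rep t Q (R a)"
  shows "lin_rep (fun_scale t) Q (list_sum R as)"
proof -
  interpret t: vector_space t by fact
  interpret tp: vector_space_pair t t by unfold_locales
  interpret ft: vector_space "fun_scale t" using assms(1) by (rule vector_space_fun_scale)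
  have l: "lin_rep t Q (R (as ! i))" if "i < length as" for i using that assms(2) by simp
  show ?thesis
    unfolding lin_rep_def
  proof (intro conjI ballI)
    fix x assume "x \<in> verts Q"
    then show "ft.subspace (spc (list_sum R as) x)"
      using lin_repD(1)[OF l]
      by (intro ft.subspaceI)
        (auto simp: list_sum_def rep_sum_def fun_scale_def intro: t.subspace_0 t.subspace_add
            t.subspace_scale)
  next
    fix \<alpha> assume "\<alpha> \<in> arcs Q"
    then show "linear_map_on (fun_scale t) (fun_scale t) (spc (list_sum R as) (tail Q \<alpha>))
        (spc (list_sum R as) (head Q \<alpha>)) (act (list_sum R as) \<alpha>)"
      using linear_map_onD[OF lin_repD(2)[OF l]]
      by (intro linear_map_onI) (auto simp: list_sum_def rep_sum_def fun_scale_def fun_eq_iff)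
  qed
qed

lemma rep_hom_tuple:
  assumes "vector_space t" "\<And>i. i < length as \<Longrightarrow> rep_hom s t Q M (R (as ! i)) (h i)"
  shows "rep_hom s (fun_scale t) Q M (list_sum R as) (\<lambda>x v i. if i < length as then h i x v else 0)"
proof (rule rep_homI)
  interpret t: vector_space t by fact
  fix x assume x: "x \<in> verts Q"
  note l = rep_homD(1)[OF assms(2) x]
  show "linear_map_on s (fun_scale t) (spc M x) (spc (list_sum R as) x)
      (\<lambda>v i. if i < length as then h i x v else 0)"
    by (rule linear_map_onI) (simp_all add: list_sum_def rep_sum_def fun_scale_def fun_eq_iff
        linear_map_onD[OF l])
next
  fix \<alpha> v assume "\<alpha> \<in> arcs Q" "v \<in> spc M (tail Q \<alpha>)"
  then show "(\<lambda>i. if i < length as then h i (head Q \<alpha>) (act M \<alpha> v) else 0) =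
      act (list_sum R as) \<alpha> (\<lambda>i. if i < length as then h i (tail Q \<alpha>) v else 0)"
    using rep_homD(2)[OF assms(2)] by (simp add: list_sum_def rep_sum_def fun_eq_iff)
qed

lemma rep_hom_component:
  assumes "i < length as"
  shows "rep_hom (fun_scale t) t Q (list_sum R as) (R (as ! i)) (\<lambda>x F. F i)"
  using assms by (intro rep_homI linear_map_onI) (auto simp: list_sum_def rep_sum_def fun_scale_def)

lemma rep_hom_trunc:
  assumes "vector_space t"
  shows "rep_hom (fun_scale t) (fun_scale t) Q (list_sum R (as @ bs)) (list_sum R as) (\<lambda>x. trunc
      (length as))"
proof -
  have "rep_hom (fun_scale t) t Q (list_sum R (as @ bs)) (R (as ! i)) (\<lambda>x F. F i)"
    if "i < length as" for i
    using rep_hom_component[of i "as @ bs" t R] that by (simp add: nth_append)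
  from rep_hom_tuple[where h = "\<lambda>i x F. F i", OF assms this] show ?thesis
    by (simp add: trunc_def[abs_def])
qed

end

section \<open>Finitely co-presented representations\<close>

text \<open>
  Yoneda: the functional \<open>\<xi>\<close> on \<open>M(a)\<close> corresponds to a morphism from \<open>M\<close> to the
  injective \<open>I\<^sub>a\<close>.
\<close>

definition cofree ::
  "('v, 'a) pre_digraph \<Rightarrow> ('v, 'a, 'u) rep \<Rightarrow> 'v \<Rightarrow> ('u \<Rightarrow> 'k::zero) \<Rightarrow> 'v \<Rightarrow> 'u \<Rightarrow> 'a list \<Rightarrow> 'k" where
  "cofree Q M a \<xi> z m = (\<lambda>p. if p \<in> paths Q z a then \<xi> (fold (act M) p m) else 0)"

text \<open>
  Exactness of \<open>E \<rightarrow> I \<rightarrow> I' \<rightarrow> 0\<close>; the map \<open>E \<rightarrow> I\<close> need not be injective.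
\<close>

definition copresentation ::
  "('k::field \<Rightarrow> 'u::ab_group_add \<Rightarrow> 'u) \<Rightarrow> ('v, 'a) pre_digraph \<Rightarrow> ('v, 'a, 'u) rep \<Rightarrow> 'v list \<Rightarrow> 'v list
    \<Rightarrow> ('v \<Rightarrow> 'u \<Rightarrow> nat \<Rightarrow> 'a list \<Rightarrow> 'k) \<Rightarrow> ('v \<Rightarrow> (nat \<Rightarrow> 'a list \<Rightarrow> 'k) \<Rightarrow> nat \<Rightarrow> 'a list \<Rightarrow> 'k) \<Rightarrow> bool" where
  "copresentation s Q E as bs g h \<longleftrightarrow>
     set as \<subseteq> verts Q \<and> set bs \<subseteq> verts Q \<and>
     rep_hom s sum_scale Q E (inj_sum Q as) g \<and>
     rep_hom sum_scale sum_scale Q (inj_sum Q as) (inj_sum Q bs) h \<and>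
     (\<forall>z \<in> verts Q. g z ` spc E z = {\<phi> \<in> spc (inj_sum Q as) z. h z \<phi> = 0} \<and>
        h z ` spc (inj_sum Q as) z = spc (inj_sum Q bs) z)"

lemma sum_scale_apply: "sum_scale c F = (\<lambda>i p. c * F i p)"
  by (simp add: sum_scale_def fun_scale_def)

context slf_quiver
begin

text \<open>Path sets are finite, so of the conditions on a finitely supported function only the
  location of the support remains.\<close>

lemma free_space_paths: "F \<in> free_space (paths Q x y) \<longleftrightarrow> (\<forall>p. F p \<noteq> 0 \<longrightarrow> p \<in> paths Q x y)"
  using finite_subset[OF _ finite_paths[of x y], of "{p. F p \<noteq> 0}"] by (auto simp: free_space_def)

lemma act_inj_rep: "act (inj_rep Q a) \<alpha> F = (\<lambda>p. F (\<alpha> # p))"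
  by (simp add: inj_rep_def free_map_transpose_def)

lemma spc_inj_rep: "F \<in> spc (inj_rep Q a) z \<longleftrightarrow> (\<forall>p. F p \<noteq> 0 \<longrightarrow> p \<in> paths Q z a)"
  by (simp add: inj_rep_def free_space_paths)

lemma spc_inj_sum:
  "F \<in> spc (inj_sum Q as) z \<longleftrightarrow> (\<forall>i p. F i p \<noteq> 0 \<longrightarrow> i < length as \<and> p \<in> paths Q z (as ! i))"
proof -
  have "F \<in> spc (inj_sum Q as) z \<longleftrightarrow>
      (\<forall>i<length as. \<forall>p. F i p \<noteq> 0 \<longrightarrow> p \<in> paths Q z (as ! i)) \<and> (\<forall>i\<ge>length as. \<forall>p. F i p = 0)"
    by (simp add: inj_sum_eq list_sum_def rep_sum_def spc_inj_rep fun_eq_iff)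
  then show ?thesis by (meson not_less)
qed

lemma lin_rep_inj_rep: "lin_rep (fun_scale (*)) Q (inj_rep Q a :: ('v, 'a, _ \<Rightarrow> 'k::field) rep)"
proof -
  interpret vector_space "fun_scale (*) :: 'k \<Rightarrow> ('a list \<Rightarrow> 'k) \<Rightarrow> _"
    by (intro vector_space_fun_scale vector_space_mult)
  show ?thesis
    unfolding lin_rep_def
  proof (intro conjI ballI)
    fix x show "subspace (spc (inj_rep Q a) x)"
      by (rule subspaceI) (auto simp: spc_inj_rep fun_scale_def, metis add.right_neutral)
  next
    fix \<alpha> assume "\<alpha> \<in> arcs Q"
    then show "linear_map_on (fun_scale (*)) (fun_scale (*)) (spc (inj_rep Q a) (tail Q \<alpha>))
        (spc (inj_rep Q a) (head Q \<alpha>)) (act (inj_rep Q a :: ('v, 'a, _ \<Rightarrow> 'k) rep) \<alpha>)"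
      by (intro linear_map_onI) (auto simp: spc_inj_rep act_inj_rep fun_scale_def Cons_in_paths)
  qed
qed

lemma lin_rep_inj_sum: "lin_rep sum_scale Q (inj_sum Q as :: ('v, 'a, _ \<Rightarrow> _ \<Rightarrow> 'k::field) rep)"
  unfolding sum_scale_def inj_sum_eq
  by (intro lin_rep_list_sum vector_space_fun_scale vector_space_mult lin_rep_inj_rep)

text \<open>Each arrow strips itself off the front of the path, so acting along \<open>q\<close>
  shifts the coefficients. The hypothesis covers the indices from \<open>length as\<close> on, where
  an arrow returns 0 whatever \<open>F\<close> is.\<close>

lemma fold_act_inj_sum:
  assumes "F \<in> spc (inj_sum Q as) z"
  shows "fold (act (inj_sum Q as)) q F = (\<lambda>i p. F i (q @ p))"
proof -
  have "\<forall>i\<ge>length as. F i = (\<lambda>p. 0)"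
    using assms unfolding spc_inj_sum fun_eq_iff by (meson leD)
  then show ?thesis
    by (induction q arbitrary: F)
      (auto simp: inj_sum_eq list_sum_def rep_sum_def act_inj_rep fun_eq_iff)
qed

lemma rep_hom_cofree:
  fixes s :: "'k::field \<Rightarrow> 'u::ab_group_add \<Rightarrow> 'u"
  assumes "lin_rep s Q M" "linear_map_on s (*) (spc M a) UNIV \<xi>"
  shows "rep_hom s (fun_scale (*)) Q M (inj_rep Q a) (cofree Q M a \<xi>)"
proof (rule rep_homI)
  fix x assume "x \<in> verts Q"
  show "linear_map_on s (fun_scale (*)) (spc M x) (spc (inj_rep Q a) x) (cofree Q M a \<xi> x)"
  proof (rule linear_map_onI)
    fix u assume u: "u \<in> spc M x"
    show "cofree Q M a \<xi> x u \<in> spc (inj_rep Q a) x" by (auto simp: spc_inj_rep cofree_def)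
    have 1: "\<xi> (fold (act M) p (s c u)) = c * \<xi> (fold (act M) p u)" if "p \<in> paths Q x a" for c p
      using linear_map_onD(1,3)[OF linear_map_on_fold_act[OF assms(1) that] u]
        linear_map_onD(3)[OF assms(2)] by simp
    then show "cofree Q M a \<xi> x (s c u) = fun_scale (*) c (cofree Q M a \<xi> x u)" for c
      by (auto simp: cofree_def fun_scale_def)
    fix v assume v: "v \<in> spc M x"
    have "\<xi> (fold (act M) p (u + v)) = \<xi> (fold (act M) p u) + \<xi> (fold (act M) p v)"
      if "p \<in> paths Q x a" for p
      using linear_map_onD(1,2)[OF linear_map_on_fold_act[OF assms(1) that]] u v
        linear_map_onD(2)[OF assms(2)] by simp
    then show "cofree Q M a \<xi> x (u + v) = cofree Q M a \<xi> x u + cofree Q M a \<xi> x v"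
      by (auto simp: cofree_def)
  qed
next
  fix \<alpha> v assume "\<alpha> \<in> arcs Q"
  then show "cofree Q M a \<xi> (head Q \<alpha>) (act M \<alpha> v) = act (inj_rep Q a) \<alpha> (cofree Q M a \<xi> (tail Q \<alpha>) v)"
    by (auto simp: cofree_def act_inj_rep Cons_in_paths)
qed

text \<open>
  Enlarge \<open>I\<close> by \<open>I\<^sub>x\<close> to detect the kernel vector \<open>e\<close>, and \<open>I'\<close> by one \<open>I\<^sub>y\<close> for
  each arrow \<open>\<alpha> : y \<rightarrow> x\<close>. The relation imposed by \<open>\<alpha>\<close> is that the functional \<open>\<xi> \<circ> \<alpha>\<close> on
  \<open>E(y)\<close> is read off from \<open>I\<close>, which is possible because \<open>E(y) \<rightarrow> I(y)\<close> is injective.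
\<close>

lemma copresentation_step:
  fixes s :: "'k::field \<Rightarrow> 'u::ab_group_add \<Rightarrow> 'u"
  assumes vs: "vector_space s" and E: "is_rep s Q E" and cop: "copresentation s Q E as bs g h"
    and x: "x \<in> verts Q" and e: "e \<in> spc E x" "e \<noteq> 0" "g x e = 0"
    and inj: "\<And>\<alpha>. \<alpha> \<in> arcs Q \<Longrightarrow> head Q \<alpha> = x \<Longrightarrow> inj_on (g (tail Q \<alpha>)) (spc E (tail Q \<alpha>))"
  obtains as' bs' g' h' where "copresentation s Q E as' bs' g' h'" "g' x e \<noteq> 0"
    "\<And>z m. g' z m = 0 \<Longrightarrow> z \<in> verts Q \<Longrightarrow> m \<in> spc E z \<Longrightarrow> g z m = 0"
proof -
  interpret vs: vector_space s by fact
  interpret ss: vector_space "sum_scale :: 'k \<Rightarrow> (nat \<Rightarrow> 'a list \<Rightarrow> 'k) \<Rightarrow> _"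
      by (rule vector_space_sum_scale)
  interpret f1: vector_space "fun_scale (*) :: 'k \<Rightarrow> ('a list \<Rightarrow> 'k) \<Rightarrow> _"
    by (intro vector_space_fun_scale vector_space_mult)
  interpret k: vector_space "(*) :: 'k \<Rightarrow> 'k \<Rightarrow> 'k" by (rule vector_space_mult)
  interpret sk: vector_space_pair s "(*) :: 'k \<Rightarrow> 'k \<Rightarrow> 'k" by unfold_locales
  interpret Fk: vector_space_pair "sum_scale :: 'k \<Rightarrow> (nat \<Rightarrow> 'a list \<Rightarrow> 'k) \<Rightarrow> _" "(*) :: 'k \<Rightarrow> 'k \<Rightarrow> 'k"
    by unfold_locales
  interpret sF: vector_space_pair s "sum_scale :: 'k \<Rightarrow> (nat \<Rightarrow> 'a list \<Rightarrow> 'k) \<Rightarrow> _" by unfold_locales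
  interpret FF: vector_space_pair "sum_scale :: 'k \<Rightarrow> (nat \<Rightarrow> 'a list \<Rightarrow> 'k) \<Rightarrow> _"
      "sum_scale :: 'k \<Rightarrow> (nat \<Rightarrow> 'a list \<Rightarrow> 'k) \<Rightarrow> _" by unfold_locales
  note lE = is_rep_lin_rep[OF E]
  have as: "set as \<subseteq> verts Q" and bs: "set bs \<subseteq> verts Q"
    and g: "rep_hom s sum_scale Q E (inj_sum Q as) g"
    and h: "rep_hom sum_scale sum_scale Q (inj_sum Q as) (inj_sum Q bs) h"
    and exact: "\<And>z. z \<in> verts Q \<Longrightarrow> g z ` spc E z = {\<phi> \<in> spc (inj_sum Q as) z. h z \<phi> = 0}"
    and surj: "\<And>z. z \<in> verts Q \<Longrightarrow> h z ` spc (inj_sum Q as) z = spc (inj_sum Q bs) z"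
    using cop by (auto simp: copresentation_def)
  have "vs.independent {e}" using e(2) by simp
  from sk.linear_independent_extend[OF this, of "\<lambda>_. 1"]
  obtain \<xi> where \<xi>l: "Vector_Spaces.linear s (*) \<xi>" and \<xi>e: "\<xi> e = 1" by auto
  interpret \<xi>: Vector_Spaces.linear s "(*)" \<xi> by (rule \<xi>l)
  have \<xi>: "linear_map_on s (*) (spc E z) UNIV \<xi>" for z by (rule sk.linear_map_on_linear[OF \<xi>l]) simp
  obtain ins where ins: "set ins = in_arcs Q x" "distinct ins"
    using finite_distinct_list[OF finite_arcs_at(1)[OF x]] by blast
  have ins_nth: "ins ! j \<in> arcs Q" "head Q (ins ! j) = x" if "j < length ins" for j
    using nth_mem[OF that] ins(1) by auto
  define n m k where "n = length as" and "m = length bs" and "k = length ins"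
  have "\<exists>\<eta>. Vector_Spaces.linear sum_scale (*) \<eta> \<and>
      (\<forall>v\<in>spc E (tail Q (ins ! j)). \<eta> (g (tail Q (ins ! j)) v) = \<xi> (act E (ins ! j) v))"
    if j: "j < k" for j
  proof -
    define \<alpha> where "\<alpha> = ins ! j"
    have \<alpha>: "\<alpha> \<in> arcs Q" "head Q \<alpha> = x" using ins_nth j by (simp_all add: \<alpha>_def k_def)
    let ?y = "tail Q \<alpha>"
    have y: "?y \<in> verts Q" using \<alpha> by simp
    have gl: "linear_map_on s sum_scale (spc E ?y) (g ?y ` spc E ?y) (g ?y)"
      using linear_map_on_mono[OF rep_homD(1)[OF g y]] by blast
    have sub: "vs.subspace (spc E ?y)" using lin_repD(1)[OF lE y] .
    have bij: "bij_betw (g ?y) (spc E ?y) (g ?y ` spc E ?y)"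
      using inj[OF \<alpha>] by (simp add: bij_betw_def)
    have "linear_map_on sum_scale (*) (g ?y ` spc E ?y) UNIV
        (\<lambda>w. \<xi> (act E \<alpha> (the_inv_into (spc E ?y) (g ?y) w)))"
      using linear_map_on_comp[OF linear_map_on_comp[OF sF.linear_map_on_inverse[OF gl sub bij]
            lin_repD(2)[OF lE \<alpha>(1)]] \<xi>] by simp
    moreover have "ss.subspace (g ?y ` spc E ?y)" using sF.subspace_image_on[OF gl sub] .
    ultimately obtain \<eta> where \<eta>: "Vector_Spaces.linear sum_scale (*) \<eta>"
      "\<And>w. w \<in> g ?y ` spc E ?y \<Longrightarrow> \<eta> w = \<xi> (act E \<alpha> (the_inv_into (spc E ?y) (g ?y) w))"
      using Fk.linear_map_on_extend by blast
    have "\<eta> (g ?y v) = \<xi> (act E \<alpha> v)" if "v \<in> spc E ?y" for v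
      using \<eta>(2) that the_inv_into_f_f[OF inj[OF \<alpha>]] by simp
    then show ?thesis using \<eta>(1) by (auto simp: \<alpha>_def)
  qed
  then obtain \<eta> where \<eta>l: "\<And>j. j < k \<Longrightarrow> Vector_Spaces.linear sum_scale (*) (\<eta> j)"
    and \<eta>g: "\<And>j v. j < k \<Longrightarrow> v \<in> spc E (tail Q (ins ! j)) \<Longrightarrow>
       \<eta> j (g (tail Q (ins ! j)) v) = \<xi> (act E (ins ! j) v)"
    by metis
  define as' bs' where "as' = as @ [x]" and "bs' = bs @ map (tail Q) ins"
  have len: "length as' = Suc n" "length bs' = m + k"
    by (simp_all add: as'_def bs'_def n_def m_def k_def)
  have as'_nth: "as' ! i = (if i < n then as ! i else x)" if "i < Suc n" for i
    using that by (auto simp: as'_def n_def nth_append)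
  have bs'_nth: "bs' ! i = (if i < m then bs ! i else tail Q (ins ! (i - m)))" if "i < m + k" for i
    using that by (auto simp: bs'_def m_def k_def nth_append)
  \<comment> \<open>On a value of \<open>g'\<close> at \<open>v\<close>, the coefficient at the
    one-arrow path \<open>[ins ! j]\<close> is \<open>\<xi> (act E (ins ! j) v)\<close>, and
    \<open>\<eta> j\<close> reads the same number off the old summands. Their difference is the
    relation for this arrow.\<close>
  define \<zeta> where "\<zeta> j \<Phi> = \<Phi> n [ins ! j] - \<eta> j (trunc n \<Phi>)" for j \<Phi>
  have \<zeta>: "linear_map_on sum_scale (*) S UNIV (\<zeta> j)" if "j < k" for j S
  proof -
    interpret \<eta>: Vector_Spaces.linear sum_scale "(*)" "\<eta> j" using \<eta>l[OF that] .
    have 1: "trunc n (u + v) = trunc n u + trunc n v"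
        "trunc n (sum_scale c u) = sum_scale c (trunc n u)"
      for u v :: "nat \<Rightarrow> 'a list \<Rightarrow> 'k" and c
      by (auto simp: trunc_def sum_scale_apply fun_eq_iff)
    show ?thesis
      by (rule linear_map_onI)
        (simp_all add: \<zeta>_def 1 \<eta>.add \<eta>.scale, simp_all add: sum_scale_apply algebra_simps)
  qed
  define g' where "g' z v = (\<lambda>i. if i < n then g z v i else if i = n then cofree Q E x \<xi> z v else
      0)" for z v
  define h' where "h' z \<Phi> = (\<lambda>i. if i < m then h z (trunc n \<Phi>) i
      else if i < m + k then cofree Q (inj_sum Q as') (tail Q (ins ! (i - m))) (\<zeta> (i - m)) z \<Phi> else
          0)" for z \<Phi>
  note tr = rep_hom_trunc[of "fun_scale (*) :: 'k \<Rightarrow> ('a list \<Rightarrow> 'k) \<Rightarrow> _" "inj_rep Q" as "[x]",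
      OF f1.vector_space_axioms, folded sum_scale_def inj_sum_eq as'_def n_def]
  have g'_hom: "rep_hom s sum_scale Q E (inj_sum Q as') g'"
  proof -
    have "rep_hom s (fun_scale (*)) Q E (inj_rep Q (as' ! i))
        (\<lambda>z v. if i < n then g z v i else cofree Q E x \<xi> z v)" if i: "i < length as'" for i
    proof (cases "i < n")
      case True
      then show ?thesis
        using rep_hom_comp[OF g[unfolded sum_scale_def inj_sum_eq] rep_hom_component] i
        by (simp add: as'_nth len n_def)
    next
      case False
      then show ?thesis using rep_hom_cofree[OF lE \<xi>] i by (simp add: as'_nth len)
    qed
    from rep_hom_tuple[where R = "inj_rep Q" and as = as'
        and h = "\<lambda>i z v. if i < n then g z v i else cofree Q E x \<xi> z v", OF f1.vector_space_axioms this]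
    have "rep_hom s sum_scale Q E (inj_sum Q as')
        (\<lambda>z v i. if i < length as' then if i < n then g z v i else cofree Q E x \<xi> z v else 0)"
      by (simp add: sum_scale_def inj_sum_eq)
    also have "(\<lambda>z v i. if i < length as' then if i < n then g z v i else cofree Q E x \<xi> z v else 0)
        = g'"
      by (auto simp: g'_def len fun_eq_iff)
    finally show ?thesis .
  qed
  have h'_hom: "rep_hom sum_scale sum_scale Q (inj_sum Q as') (inj_sum Q bs') h'"
  proof -
    have "rep_hom sum_scale (fun_scale (*)) Q (inj_sum Q as') (inj_rep Q (bs' ! i))
        (\<lambda>z \<Phi>. if i < m then h z (trunc n \<Phi>) i else
           cofree Q (inj_sum Q as') (tail Q (ins ! (i - m))) (\<zeta> (i - m)) z \<Phi>)" if i: "i < length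
               bs'" for i
    proof (cases "i < m")
      case True
      then show ?thesis
        using rep_hom_comp[OF rep_hom_comp[OF tr h, unfolded inj_sum_eq sum_scale_def]
            rep_hom_component] i
        by (simp add: bs'_nth len m_def inj_sum_eq sum_scale_def)
    next
      case False
      then show ?thesis using rep_hom_cofree[OF lin_rep_inj_sum \<zeta>[of "i - m"]] i
          by (simp add: bs'_nth len)
    qed
    from rep_hom_tuple[where R = "inj_rep Q" and as = bs'
        and h = "\<lambda>i z \<Phi>. if i < m then h z (trunc n \<Phi>) i else
           cofree Q (inj_sum Q as') (tail Q (ins ! (i - m))) (\<zeta> (i - m)) z \<Phi>",
        OF f1.vector_space_axioms this]
    have "rep_hom sum_scale sum_scale Q (inj_sum Q as') (inj_sum Q bs')
        (\<lambda>z \<Phi> i. if i < length bs' then if i < m then h z (trunc n \<Phi>) i else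
           cofree Q (inj_sum Q as') (tail Q (ins ! (i - m))) (\<zeta> (i - m)) z \<Phi> else 0)"
      by (simp add: sum_scale_def inj_sum_eq)
    also have "(\<lambda>z \<Phi> i. if i < length bs' then if i < m then h z (trunc n \<Phi>) i else
           cofree Q (inj_sum Q as') (tail Q (ins ! (i - m))) (\<zeta> (i - m)) z \<Phi> else 0) = h'"
      by (auto simp: h'_def len fun_eq_iff)
    finally show ?thesis .
  qed
  have trg': "trunc n (g' z v) = g z v" if "z \<in> verts Q" "v \<in> spc E z" for z v
  proof -
    have "g z v i = 0" if "\<not> i < n" for i
      using rep_homD(3)[OF g \<open>z \<in> verts Q\<close> \<open>v \<in> spc E z\<close>] that
      by (auto simp: spc_inj_sum n_def fun_eq_iff)
    then show ?thesis by (auto simp: trunc_def g'_def fun_eq_iff)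
  qed
  have trmem: "trunc n \<Phi> \<in> spc (inj_sum Q as) z" if "\<Phi> \<in> spc (inj_sum Q as') z" "z \<in> verts Q"
    for \<Phi> :: "nat \<Rightarrow> 'a list \<Rightarrow> 'k" and z
    using rep_homD(3)[OF tr that(2,1)] .
  have \<zeta>_fold: "\<zeta> j (fold (act (inj_sum Q as')) p \<Phi>) =
      \<Phi> n (p @ [ins ! j]) - \<eta> j (fold (act (inj_sum Q as)) p (trunc n \<Phi>))"
    if "\<Phi> \<in> spc (inj_sum Q as') z" "z \<in> verts Q" for j p \<Phi> z
  proof -
    have "trunc n (\<lambda>i q. \<Phi> i (p @ q)) = (\<lambda>i q. trunc n \<Phi> i (p @ q))"
      by (auto simp: trunc_def fun_eq_iff)
    then show ?thesis
      using fold_act_inj_sum[OF that(1)] fold_act_inj_sum[OF trmem[OF that]] by (simp add: \<zeta>_def)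
  qed
  have h'g': "h' z (g' z v) = 0" if z: "z \<in> verts Q" and v: "v \<in> spc E z" for z v
  proof -
    have "h z (g z v) = 0" using exact[OF z] v by blast
    moreover have "\<zeta> j (fold (act (inj_sum Q as')) p (g' z v)) = 0"
      if j: "j < k" and p: "p \<in> paths Q z (tail Q (ins ! j))" for j p
    proof -
      have a: "ins ! j \<in> arcs Q" "head Q (ins ! j) = x" using ins_nth j by (simp_all add: k_def)
      have "p @ [ins ! j] \<in> paths Q z x" using a p by (simp add: snoc_in_paths)
      then show ?thesis
        using \<zeta>_fold[OF rep_homD(3)[OF g'_hom z v] z, of j p] p j
          rep_hom_fold_act[OF lE g p v] \<eta>g[OF j linear_map_onD(1)[OF linear_map_on_fold_act[OF lE p] v]]
        by (simp add: trg'[OF z v]) (simp add: g'_def cofree_def)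
    qed
    ultimately show ?thesis
      by (auto simp: h'_def trg'[OF z v] cofree_def fun_eq_iff)
  qed
  have "copresentation s Q E as' bs' g' h'"
    unfolding copresentation_def
  proof (intro conjI ballI g'_hom h'_hom)
    show "set as' \<subseteq> verts Q" using as x by (simp add: as'_def)
    show "set bs' \<subseteq> verts Q" using bs ins(1) by (auto simp: bs'_def)
    fix z assume z: "z \<in> verts Q"
    show "g' z ` spc E z = {\<phi> \<in> spc (inj_sum Q as') z. h' z \<phi> = 0}"
    proof (intro subset_antisym subsetI)
      fix \<Phi> assume "\<Phi> \<in> g' z ` spc E z"
      then show "\<Phi> \<in> {\<phi> \<in> spc (inj_sum Q as') z. h' z \<phi> = 0}"
        using h'g'[OF z] rep_homD(3)[OF g'_hom z] by auto
    next
      fix \<Phi> assume "\<Phi> \<in> {\<phi> \<in> spc (inj_sum Q as') z. h' z \<phi> = 0}"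
      then have \<Phi>: "\<Phi> \<in> spc (inj_sum Q as') z" "h' z \<Phi> = 0" by auto
      have "h z (trunc n \<Phi>) = 0"
      proof -
        have "h z (trunc n \<Phi>) i = 0" for i
        proof (cases "i < m")
          case True
          then show ?thesis using fun_cong[OF \<Phi>(2), of i] by (simp add: h'_def)
        next
          case False
          then show ?thesis using rep_homD(3)[OF h z trmem[OF \<Phi>(1) z]]
            by (auto simp: spc_inj_sum m_def fun_eq_iff)
        qed
        then show ?thesis by auto
      qed
      then have "trunc n \<Phi> \<in> g z ` spc E z" using exact[OF z] trmem[OF \<Phi>(1) z] by simp
      then obtain v where v: "v \<in> spc E z" "g z v = trunc n \<Phi>" by auto
      define \<Psi> where "\<Psi> = \<Phi> - g' z v"
      have g'v: "g' z v \<in> spc (inj_sum Q as') z" using rep_homD(3)[OF g'_hom z v(1)] .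
      have sub: "ss.subspace (spc (inj_sum Q as') z)" using lin_repD(1)[OF lin_rep_inj_sum z] .
      have \<Psi>: "\<Psi> \<in> spc (inj_sum Q as') z" unfolding \<Psi>_def using ss.subspace_diff[OF sub \<Phi>(1) g'v] .
      have h\<Psi>: "h' z \<Psi> = 0"
        unfolding \<Psi>_def using FF.linear_map_on_diff[OF rep_homD(1)[OF h'_hom z] sub \<Phi>(1) g'v]
            \<Phi>(2) h'g'[OF z v(1)]
        by simp
      have tr\<Psi>: "trunc n \<Psi> = 0"
        using trg'[OF z v(1)] v(2) by (auto simp: \<Psi>_def trunc_def fun_eq_iff split: if_splits)
      \<comment> \<open>A nontrivial path into \<open>x\<close> ends with some
        \<open>ins ! j\<close>. As the old summands of \<open>\<Psi>\<close> vanish, its coefficient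
        there is a component of \<open>h' z \<Psi>\<close>, hence 0. Only the trivial path at
        \<open>x\<close> escapes the relations.\<close>
      have \<Psi>0: "\<Psi> i q = 0" if "\<not> (i = n \<and> q = [] \<and> z = x)" for i q
      proof (rule ccontr)
        assume nz: "\<Psi> i q \<noteq> 0"
        have "i = n"
        proof (rule ccontr)
          assume "i \<noteq> n"
          then have "i < n" using nz \<Psi> len by (auto simp: spc_inj_sum less_Suc_eq)
          then show False using nz fun_cong[OF tr\<Psi>, of i] by (auto simp: trunc_def fun_eq_iff)
        qed
        then have q: "q \<in> paths Q z x" using nz \<Psi> as'_nth[of n] by (auto simp: spc_inj_sum)
        then have "q \<noteq> []" using that \<open>i = n\<close> by (auto simp: Nil_in_paths)
        then obtain p \<alpha> where p: "q = p @ [\<alpha>]" by (metis rev_exhaust)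
        then have \<alpha>: "\<alpha> \<in> in_arcs Q x" "p \<in> paths Q z (tail Q \<alpha>)" using q by (auto simp: snoc_in_paths)
        then have "\<alpha> \<in> set ins" by (simp add: ins(1))
        then obtain j where j: "j < k" "\<alpha> = ins ! j" by (metis in_set_conv_nth k_def)
        interpret \<eta>: Vector_Spaces.linear sum_scale "(*)" "\<eta> j" using \<eta>l[OF j(1)] .
        have "0 = h' z \<Psi> (m + j) p" by (simp add: h\<Psi>)
        also have "\<dots> = \<zeta> j (fold (act (inj_sum Q as')) p \<Psi>)"
          using j \<alpha>(2) by (simp add: h'_def cofree_def)
        also have "\<dots> = \<Psi> n q - \<eta> j (fold (act (inj_sum Q as)) p 0)"
          using \<zeta>_fold[OF \<Psi> z] tr\<Psi> p j(2) by simp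
        also have "fold (act (inj_sum Q as)) p 0 = (0 :: nat \<Rightarrow> 'a list \<Rightarrow> 'k)"
          using fold_act_inj_sum[of 0 as z p] by (simp add: spc_inj_sum fun_eq_iff)
        finally show False using nz \<open>i = n\<close> \<eta>.zero by (simp add: zero_fun_def)
      qed
      show "\<Phi> \<in> g' z ` spc E z"
      proof (cases "z = x")
        case False
        then have "\<Psi> = 0" using \<Psi>0 by (auto simp: fun_eq_iff)
        then show ?thesis using v(1) by (auto simp: \<Psi>_def)
      next
        case True
        \<comment> \<open>The vector \<open>s c e\<close> accounts for the remaining coefficient:
          \<open>\<xi> e = 1\<close> gives the value \<open>c\<close> at the trivial path,
          \<open>x\<close> has no other closed path, and \<open>g x e = 0\<close> leaves the old
          summands zero.\<close>
        define c where "c = \<Psi> n []"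
        have ce: "s c e \<in> spc E z" using e(1) True vs.subspace_scale[OF lin_repD(1)[OF lE x]] by simp
        have "g z (s c e) = 0" using linear_map_onD(3)[OF rep_homD(1)[OF g x] e(1)] e(3) True by simp
        moreover have "cofree Q E x \<xi> z (s c e) q = (if q = [] then c else 0)" for q
          using True x paths_same[OF x] by (simp add: cofree_def \<xi>.scale \<xi>e)
        ultimately have "g' z (s c e) = \<Psi>"
          using \<Psi>0 by (auto simp: g'_def fun_eq_iff c_def)
        then have "g' z (v + s c e) = \<Phi>"
          using linear_map_onD(2)[OF rep_homD(1)[OF g'_hom z] v(1) ce] by (simp add: \<Psi>_def)
        then show ?thesis
          using vs.subspace_add[OF lin_repD(1)[OF lE z] v(1) ce] by blast
      qed
    qed
    show "h' z ` spc (inj_sum Q as') z = spc (inj_sum Q bs') z"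
    proof (intro subset_antisym subsetI)
      fix \<Theta> assume "\<Theta> \<in> h' z ` spc (inj_sum Q as') z"
      then show "\<Theta> \<in> spc (inj_sum Q bs') z" using rep_homD(3)[OF h'_hom z] by auto
    next
      fix \<Theta> :: "nat \<Rightarrow> 'a list \<Rightarrow> 'k" assume \<Theta>: "\<Theta> \<in> spc (inj_sum Q bs') z"
      have "trunc m \<Theta> \<in> spc (inj_sum Q bs) z"
        unfolding spc_inj_sum
      proof (intro allI impI)
        fix i p assume "trunc m \<Theta> i p \<noteq> 0"
        then have i: "i < m" "\<Theta> i p \<noteq> 0" by (auto simp: trunc_def split: if_splits)
        then have "p \<in> paths Q z (bs' ! i)" using \<Theta> by (auto simp: spc_inj_sum)
        then show "i < length bs \<and> p \<in> paths Q z (bs ! i)" using i bs'_nth[of i] by (simp add: m_def)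
      qed
      then have "trunc m \<Theta> \<in> h z ` spc (inj_sum Q as) z" by (simp add: surj[OF z])
      then obtain \<phi> where \<phi>: "\<phi> \<in> spc (inj_sum Q as) z" "h z \<phi> = trunc m \<Theta>" by auto
      define idx where "idx \<alpha> = (SOME j. j < k \<and> ins ! j = \<alpha>)" for \<alpha>
      have idx: "idx (ins ! j) = j" if "j < k" for j
        unfolding idx_def
        by (rule some_equality) (use that ins(2) in \<open>auto simp: nth_eq_iff_index_eq k_def\<close>)
      \<comment> \<open>A preimage of \<open>\<Theta>\<close>: the old summands come from
        \<open>\<phi>\<close>, and the coefficient at \<open>p @ [ins ! j]\<close> is the one that
        solves the relation \<open>j\<close> at \<open>p\<close>. The trivial path occurs in no
        relation and gets 0.\<close>
      define \<Phi> where "\<Phi> i q = (if i < n then \<phi> i q else if i = n \<and> q \<noteq> [] \<and> q \<in> paths Q z x then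
          \<Theta> (m + idx (last q)) (butlast q) + \<eta> (idx (last q)) (fold (act (inj_sum Q as)) (butlast q)
              \<phi>) else 0)" for i q
      have \<Phi>: "\<Phi> \<in> spc (inj_sum Q as') z"
        using \<phi>(1) as'_nth unfolding spc_inj_sum by (auto simp: \<Phi>_def len n_def split: if_splits)
      have tr\<Phi>: "trunc n \<Phi> = \<phi>"
        using \<phi>(1) by (auto simp: trunc_def \<Phi>_def fun_eq_iff spc_inj_sum n_def)
      have "h' z \<Phi> i p = \<Theta> i p" for i p
      proof (cases "i < m + k")
        case False
        then show ?thesis using \<Theta> len by (auto simp: h'_def spc_inj_sum)
      next
        case i: True
        show ?thesis
        proof (cases "i < m")
          case True
          then show ?thesis by (simp add: h'_def tr\<Phi> \<phi>(2)) (simp add: trunc_def)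
        next
          case False
          define j where "j = i - m"
          have j: "j < k" "i = m + j" using i False by (auto simp: j_def)
          have a: "ins ! j \<in> arcs Q" "head Q (ins ! j) = x" using ins_nth j by (simp_all add: k_def)
          show ?thesis
          proof (cases "p \<in> paths Q z (tail Q (ins ! j))")
            case True
            then have "p @ [ins ! j] \<in> paths Q z x" using a by (simp add: snoc_in_paths)
            then have "\<Phi> n (p @ [ins ! j]) = \<Theta> i p + \<eta> j (fold (act (inj_sum Q as)) p \<phi>)"
              using idx j by (simp add: \<Phi>_def)
            then show ?thesis
              using True j \<zeta>_fold[OF \<Phi> z, of j p] by (simp add: h'_def cofree_def tr\<Phi>)
          next
            case False
            moreover from this have "p \<notin> paths Q z (bs' ! i)" using j bs'_nth[OF i] by simp
            then have "\<Theta> i p = 0" using \<Theta>[unfolded spc_inj_sum] by blast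
            ultimately show ?thesis using j by (simp add: h'_def cofree_def)
          qed
        qed
      qed
      then have "h' z \<Phi> = \<Theta>" by (simp add: fun_eq_iff)
      then show "\<Theta> \<in> h' z ` spc (inj_sum Q as') z" using \<Phi> by blast
    qed
  qed
  moreover have "g' x e \<noteq> 0"
  proof -
    have "g' x e n [] = 1" using x \<xi>e by (simp add: g'_def cofree_def Nil_in_paths)
    then show ?thesis by auto
  qed
  moreover have "g z v = 0" if "g' z v = 0" "z \<in> verts Q" "v \<in> spc E z" for z v
  proof -
    have "trunc n (0 :: nat \<Rightarrow> 'a list \<Rightarrow> 'k) = 0" by (simp add: trunc_def zero_fun_def fun_eq_iff)
    then show ?thesis using trg'[OF that(2,3)] that(1) by simp
  qed
  ultimately show ?thesis using that by blast
qed

text \<open>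
  The kernel, supported on \<open>D\<close>, is killed vector by vector, always at a source of its support;
  its total dimension decreases.
\<close>

lemma copresentation_rep_minus:
  fixes s :: "'k::field \<Rightarrow> 'u::ab_group_add \<Rightarrow> 'u"
  assumes vs: "vector_space s" and E: "is_rep s Q E" and "copresentation s Q E as bs g h"
    and D: "finite D" and "\<And>x. x \<in> verts Q \<Longrightarrow> x \<notin> D \<Longrightarrow> inj_on (g x) (spc E x)"
  shows "rep_minus s Q E"
proof -
  interpret vs: vector_space s by fact
  interpret ss: vector_space "sum_scale :: 'k \<Rightarrow> (nat \<Rightarrow> 'a list \<Rightarrow> 'k) \<Rightarrow> _"
      by (rule vector_space_sum_scale)
  interpret sF: vector_space_pair s "sum_scale :: 'k \<Rightarrow> (nat \<Rightarrow> 'a list \<Rightarrow> 'k) \<Rightarrow> _" by unfold_locales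
  note lE = is_rep_lin_rep[OF E]
  define K where "K g z = {v \<in> spc E z. g z v = 0}" for g :: "'v \<Rightarrow> 'u \<Rightarrow> nat \<Rightarrow> 'a list \<Rightarrow> 'k" and z
  show ?thesis
    using assms(3,5)
  proof (induction "\<Sum>x\<in>D \<inter> verts Q. vs.dim (K g x)" arbitrary: as bs g h rule: less_induct)
    case less
    have g: "rep_hom s sum_scale Q E (inj_sum Q as) g" using less.prems(1)
        by (simp add: copresentation_def)
    note gl = rep_homD(1)[OF g]
    define X where "X = {x \<in> D \<inter> verts Q. \<not> inj_on (g x) (spc E x)}"
    show ?case
    proof (cases "X = {}")
      case True
      then have "\<And>x. x \<in> verts Q \<Longrightarrow> inj_on (g x) (spc E x)" using less.prems(2) by (auto simp: X_def)
      then have "short_exact s sum_scale sum_scale Q E (inj_sum Q as) (inj_sum Q bs) g h"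
        using less.prems(1) by (auto simp: short_exact_def copresentation_def)
      then show ?thesis using E less.prems(1) by (auto simp: rep_minus_def copresentation_def)
    next
      case False
      have "finite X" "X \<subseteq> verts Q" using D by (auto simp: X_def)
      then obtain x where x: "x \<in> X" "\<And>\<alpha>. \<alpha> \<in> arcs Q \<Longrightarrow> head Q \<alpha> = x \<Longrightarrow> tail Q \<alpha> \<notin> X"
        using ex_source[OF _ False] by blast
      have xQ: "x \<in> verts Q" "x \<in> D" using x(1) by (auto simp: X_def)
      have ninj: "\<not> inj_on (g x) (spc E x)" using x(1) by (simp add: X_def)
      obtain e where e: "e \<in> spc E x" "e \<noteq> 0" "g x e = 0"
        using ninj sF.linear_map_on_inj_iff[OF gl[OF xQ(1)] lin_repD(1)[OF lE xQ(1)]] by blast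
      have "inj_on (g (tail Q \<alpha>)) (spc E (tail Q \<alpha>))" if "\<alpha> \<in> arcs Q" "head Q \<alpha> = x" for \<alpha>
        using x(2)[OF that] less.prems(2)[of "tail Q \<alpha>"] that by (auto simp: X_def)
      from copresentation_step[OF vs E less.prems(1) xQ(1) e this]
      obtain as' bs' g' h' where g': "copresentation s Q E as' bs' g' h'" "g' x e \<noteq> 0"
        "\<And>z m. g' z m = 0 \<Longrightarrow> z \<in> verts Q \<Longrightarrow> m \<in> spc E z \<Longrightarrow> g z m = 0"
        by metis
      have g'h: "rep_hom s sum_scale Q E (inj_sum Q as') g'" using g'(1)
          by (simp add: copresentation_def)
      have Kfd: "fd_space s (K g z)" if "z \<in> verts Q" for z
        using vs.fd_space_subspace[OF is_repD[OF E that] sF.subspace_kernel_on[OF gl[OF that]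
            lin_repD(1)[OF lE that]]]
        by (auto simp: K_def)
      have Ksub: "K g' z \<subseteq> K g z" if "z \<in> verts Q" for z
        using g'(3) that by (auto simp: K_def)
      have "(\<Sum>x\<in>D \<inter> verts Q. vs.dim (K g' x)) < (\<Sum>x\<in>D \<inter> verts Q. vs.dim (K g x))"
      proof (rule sum_strict_mono_ex1)
        show "finite (D \<inter> verts Q)" using D by simp
        show "\<forall>z\<in>D \<inter> verts Q. vs.dim (K g' z) \<le> vs.dim (K g z)"
          using vs.fd_space_dim_le[OF Kfd Ksub] by blast
        have "vs.dim (K g' x) < vs.dim (K g x)"
        proof (rule vs.fd_space_dim_less[OF Kfd[OF xQ(1)]])
          show "vs.subspace (K g' x)"
            using sF.subspace_kernel_on[OF rep_homD(1)[OF g'h xQ(1)] lin_repD(1)[OF lE xQ(1)]]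
            by (simp add: K_def)
          show "K g' x \<subset> K g x" using Ksub[OF xQ(1)] e g'(2) by (auto simp: K_def)
        qed
        then show "\<exists>z\<in>D \<inter> verts Q. vs.dim (K g' z) < vs.dim (K g z)" using xQ by blast
      qed
      moreover have "inj_on (g' z) (spc E z)" if z: "z \<in> verts Q" "z \<notin> D" for z
      proof -
        have "\<forall>v\<in>spc E z. g z v = 0 \<longrightarrow> v = 0"
          using less.prems(2)[OF z] sF.linear_map_on_inj_iff[OF gl[OF z(1)] lin_repD(1)[OF lE z(1)]]
              by blast
        then show ?thesis
          using sF.linear_map_on_inj_iff[OF rep_homD(1)[OF g'h z(1)] lin_repD(1)[OF lE z(1)]]
              g'(3)[of z] z(1) by blast
      qed
      ultimately show ?thesis using less.hyps g'(1) by blast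
    qed
  qed
qed

text \<open>A co-presentation of \<open>N\<close> composed with \<open>f\<close> remains exact at I
  because \<open>f\<close> is onto. It fails to be injective only on \<open>D\<close>, where it can
  be repaired.\<close>

lemma rep_minus_surj:
  fixes s :: "'k::field \<Rightarrow> 'u::ab_group_add \<Rightarrow> 'u" and t :: "'k \<Rightarrow> 'w::ab_group_add \<Rightarrow> 'w"
  assumes vs: "vector_space s" and E: "is_rep s Q E" and N: "rep_minus t Q N"
    and f: "rep_hom s t Q E N f" "\<And>x. x \<in> verts Q \<Longrightarrow> f x ` spc E x = spc N x"
    and D: "finite D" "\<And>x. x \<in> verts Q \<Longrightarrow> x \<notin> D \<Longrightarrow> inj_on (f x) (spc E x)"
  shows "rep_minus s Q E"
proof -
  obtain as bs g h where *: "set as \<subseteq> verts Q" "set bs \<subseteq> verts Q"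
      and ex: "short_exact t sum_scale sum_scale Q N (inj_sum Q as) (inj_sum Q bs) g h"
    using N by (auto simp: rep_minus_def)
  have "copresentation s Q E as bs (\<lambda>x v. g x (f x v)) h"
    using * ex f rep_hom_comp[OF f(1)]
        by (auto simp: copresentation_def short_exact_def image_image[symmetric])
  moreover have "inj_on (\<lambda>v. g x (f x v)) (spc E x)" if "x \<in> verts Q" "x \<notin> D" for x
    using comp_inj_on[OF D(2)[OF that], of "g x"] ex f(2) that by (simp add: short_exact_def comp_def)
  ultimately show ?thesis using copresentation_rep_minus[OF vs E] D(1) by blast
qed

text \<open>The repair starts from I = I' = 0, for which all of \<open>E\<close> is kernel.\<close>

lemma finite_support_rep_minus:
  fixes s :: "'k::field \<Rightarrow> 'u::ab_group_add \<Rightarrow> 'u"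
  assumes vs: "vector_space s" and E: "is_rep s Q E" and D: "finite D"
    and supp: "\<And>x. x \<in> verts Q \<Longrightarrow> x \<notin> D \<Longrightarrow> spc E x = {0}"
  shows "rep_minus s Q E"
proof -
  interpret vs: vector_space s by fact
  have z: "spc (inj_sum Q [] :: ('v, 'a, _ \<Rightarrow> _ \<Rightarrow> 'k) rep) z = {0}" for z
    by (auto simp: spc_inj_sum fun_eq_iff)
  have "spc E x \<noteq> {}" if "x \<in> verts Q" for x
    using vs.subspace_0[OF lin_repD(1)[OF is_rep_lin_rep[OF E] that]] by blast
  then have "copresentation s Q E [] [] (\<lambda>x v. 0) (\<lambda>x v. 0)"
    using rep_hom_zero[OF vs vector_space_sum_scale is_rep_lin_rep[OF E] lin_rep_inj_sum]
      rep_hom_zero[OF vector_space_sum_scale vector_space_sum_scale lin_rep_inj_sum lin_rep_inj_sum]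
    by (simp add: copresentation_def z image_constant_conv)
  moreover have "inj_on (\<lambda>v. 0) (spc E x)" if "x \<in> verts Q" "x \<notin> D" for x
    using supp[OF that] by simp
  ultimately show ?thesis using copresentation_rep_minus[OF vs E] D by blast
qed

text \<open>\<open>M\<close> embeds in a finite sum of representations I_a, and I_a lives on the
  vertices with a path to \<open>a\<close>.\<close>

lemma rep_minus_support:
  fixes s :: "'k::field \<Rightarrow> 'u::ab_group_add \<Rightarrow> 'u"
  assumes "vector_space s" "rep_minus s Q M"
  obtains B where "finite B" "B \<subseteq> verts Q" "\<And>x. x \<in> verts Q \<Longrightarrow> x \<notin> preds Q B \<Longrightarrow> spc M x = {0}"
proof -
  interpret vs: vector_space s by fact
  interpret ss: vector_space "sum_scale :: 'k \<Rightarrow> (nat \<Rightarrow> 'a list \<Rightarrow> 'k) \<Rightarrow> _"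
      by (rule vector_space_sum_scale)
  interpret sF: vector_space_pair s "sum_scale :: 'k \<Rightarrow> (nat \<Rightarrow> 'a list \<Rightarrow> 'k) \<Rightarrow> _" by unfold_locales
  obtain as bs g h where as: "set as \<subseteq> verts Q" and M: "is_rep s Q M"
      and ex: "short_exact s sum_scale sum_scale Q M (inj_sum Q as) (inj_sum Q bs) g h"
    using assms(2) by (auto simp: rep_minus_def)
  have g: "rep_hom s sum_scale Q M (inj_sum Q as) g" and inj: "\<And>x. x \<in> verts Q \<Longrightarrow> inj_on (g x) (spc M x)"
    using ex by (auto simp: short_exact_def)
  have "spc M x = {0}" if x: "x \<in> verts Q" "x \<notin> preds Q (set as)" for x
  proof -
    have sub: "vs.subspace (spc M x)" using lin_repD(1)[OF is_rep_lin_rep[OF M] x(1)] .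
    have "g x v = 0" if v: "v \<in> spc M x" for v
      using rep_homD(3)[OF g x(1) v] x(2) by (fastforce simp: spc_inj_sum preds_def fun_eq_iff)
    then have "\<forall>v\<in>spc M x. v = 0"
      using sF.linear_map_on_inj_iff[OF rep_homD(1)[OF g x(1)] sub] inj[OF x(1)] by blast
    then show ?thesis using vs.subspace_0[OF sub] by blast
  qed
  then show ?thesis using that[of "set as"] as by blast
qed

end

section \<open>Finitely presented representations\<close>

text \<open>By Yoneda, \<open>w\<close> in E(a) determines the morphism from P_a to E that sends a
  path to the image of \<open>w\<close> along it. The sum runs over all paths from \<open>a\<close>
  to \<open>z\<close>, a finite set independent of \<open>F\<close>, which makes linearity in
  \<open>F\<close> immediate.\<close>

definition free_hom ::
  "('k \<Rightarrow> 'u \<Rightarrow> 'u::ab_group_add) \<Rightarrow> ('v, 'a) pre_digraph \<Rightarrow> ('v, 'a, 'u) rep \<Rightarrow> 'v \<Rightarrow> 'u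
    \<Rightarrow> 'v \<Rightarrow> ('a list \<Rightarrow> 'k) \<Rightarrow> 'u" where
  "free_hom s Q E a w z F = (\<Sum>p\<in>paths Q a z. s (F p) (fold (act E) p w))"

text \<open>
  Exactness of \<open>0 \<rightarrow> P' \<rightarrow> P \<rightarrow> E\<close>; the map \<open>P \<rightarrow> E\<close> need not be surjective.
\<close>

definition presentation ::
  "('k::field \<Rightarrow> 'u::ab_group_add \<Rightarrow> 'u) \<Rightarrow> ('v, 'a) pre_digraph \<Rightarrow> ('v, 'a, 'u) rep \<Rightarrow> 'v list \<Rightarrow> 'v list
    \<Rightarrow> ('v \<Rightarrow> (nat \<Rightarrow> 'a list \<Rightarrow> 'k) \<Rightarrow> nat \<Rightarrow> 'a list \<Rightarrow> 'k) \<Rightarrow> ('v \<Rightarrow> (nat \<Rightarrow> 'a list \<Rightarrow> 'k) \<Rightarrow> 'u) \<Rightarrow> bool" where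
  "presentation s Q E bs as f g \<longleftrightarrow>
     set as \<subseteq> verts Q \<and> set bs \<subseteq> verts Q \<and>
     rep_hom sum_scale sum_scale Q (proj_sum Q bs) (proj_sum Q as) f \<and>
     rep_hom sum_scale s Q (proj_sum Q as) E g \<and>
     (\<forall>z \<in> verts Q. inj_on (f z) (spc (proj_sum Q bs) z) \<and>
        f z ` spc (proj_sum Q bs) z = {\<phi> \<in> spc (proj_sum Q as) z. g z \<phi> = 0})"

lemma sum_apply_apply: "(\<Sum>j\<in>J. T j) i q = (\<Sum>j\<in>J. T j i (q :: 'c) :: 'b::comm_monoid_add)"
  by (induction J rule: infinite_finite_induct) simp_all

context slf_quiver
begin

lemma act_proj_rep:
  "act (proj_rep Q a) \<alpha> F = (\<lambda>q. if q \<noteq> [] \<and> last q = \<alpha> then F (butlast q) else 0)"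
proof
  fix q
  have "{p. F p \<noteq> 0 \<and> p @ [\<alpha>] = q} =
      (if q \<noteq> [] \<and> last q = \<alpha> \<and> F (butlast q) \<noteq> 0 then {butlast q} else {})"
    by (auto simp: snoc_eq_iff_butlast)
  then show "act (proj_rep Q a) \<alpha> F q = (if q \<noteq> [] \<and> last q = \<alpha> then F (butlast q) else 0)"
    by (simp add: proj_rep_def free_map_def)
qed

lemma spc_proj_rep: "F \<in> spc (proj_rep Q a) z \<longleftrightarrow> (\<forall>p. F p \<noteq> 0 \<longrightarrow> p \<in> paths Q a z)"
  by (simp add: proj_rep_def free_space_paths)

lemma spc_proj_sum:
  "F \<in> spc (proj_sum Q as) z \<longleftrightarrow> (\<forall>i p. F i p \<noteq> 0 \<longrightarrow> i < length as \<and> p \<in> paths Q (as ! i) z)"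
proof -
  have "F \<in> spc (proj_sum Q as) z \<longleftrightarrow>
      (\<forall>i<length as. \<forall>p. F i p \<noteq> 0 \<longrightarrow> p \<in> paths Q (as ! i) z) \<and> (\<forall>i\<ge>length as. \<forall>p. F i p = 0)"
    by (simp add: proj_sum_eq list_sum_def rep_sum_def spc_proj_rep fun_eq_iff)
  then show ?thesis by (meson not_less)
qed

lemma lin_rep_proj_rep: "lin_rep (fun_scale (*)) Q (proj_rep Q a :: ('v, 'a, _ \<Rightarrow> 'k::field) rep)"
proof -
  interpret vector_space "fun_scale (*) :: 'k \<Rightarrow> ('a list \<Rightarrow> 'k) \<Rightarrow> _"
    by (intro vector_space_fun_scale vector_space_mult)
  show ?thesis
    unfolding lin_rep_def
  proof (intro conjI ballI)
    fix x show "subspace (spc (proj_rep Q a) x)"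
      by (rule subspaceI) (auto simp: spc_proj_rep fun_scale_def, metis add.right_neutral)
  next
    fix \<alpha> assume \<alpha>: "\<alpha> \<in> arcs Q"
    show "linear_map_on (fun_scale (*)) (fun_scale (*)) (spc (proj_rep Q a) (tail Q \<alpha>))
        (spc (proj_rep Q a) (head Q \<alpha>)) (act (proj_rep Q a :: ('v, 'a, _ \<Rightarrow> 'k) rep) \<alpha>)"
    proof (rule linear_map_onI)
      fix u :: "'a list \<Rightarrow> 'k" assume u: "u \<in> spc (proj_rep Q a) (tail Q \<alpha>)"
      have "q \<in> paths Q a (head Q \<alpha>)" if "q \<noteq> []" "last q = \<alpha>" "u (butlast q) \<noteq> 0" for q
        using snoc_in_paths[of "butlast q" \<alpha> a] that u \<alpha> by (auto simp: spc_proj_rep)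
      then show "act (proj_rep Q a) \<alpha> u \<in> spc (proj_rep Q a) (head Q \<alpha>)"
        by (auto simp: spc_proj_rep act_proj_rep)
    qed (auto simp: act_proj_rep fun_scale_def)
  qed
qed

lemma lin_rep_proj_sum: "lin_rep sum_scale Q (proj_sum Q as :: ('v, 'a, _ \<Rightarrow> _ \<Rightarrow> 'k::field) rep)"
  unfolding sum_scale_def proj_sum_eq
  by (intro lin_rep_list_sum vector_space_fun_scale vector_space_mult lin_rep_proj_rep)

lemma act_proj_sum:
  "i < length as \<Longrightarrow> act (proj_sum Q as) \<alpha> G i q = (if q \<noteq> [] \<and> last q = \<alpha> then G i (butlast q) else 0)"
  by (simp add: proj_sum_eq list_sum_def rep_sum_def act_proj_rep)

text \<open>The action does not mix components, so a component that is the basis vector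
  \<open>r\<close> becomes the basis vector \<open>r @ p\<close> whatever the other components are.
  This reads off the new component of the relations in \<open>presentation_step\<close>.\<close>

lemma fold_act_proj_sum_delta:
  fixes G :: "nat \<Rightarrow> 'a list \<Rightarrow> 'k::field"
  assumes "i < length as" "\<And>q. G i q = (if q = r then 1 else 0)"
  shows "fold (act (proj_sum Q as)) p G i q = (if q = r @ p then 1 else 0)"
  using assms(2)
proof (induction p arbitrary: G r)
  case (Cons \<alpha> p)
  have "act (proj_sum Q as) \<alpha> G i q = (if q = r @ [\<alpha>] then 1 else 0)" for q
    using Cons.prems assms(1) by (auto simp: act_proj_sum)
  from Cons.IH[where G = "act (proj_sum Q as) \<alpha> G" and r = "r @ [\<alpha>]", OF this] show ?case by simp
qed simp

lemma rep_hom_free: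
  fixes s :: "'k::field \<Rightarrow> 'u::ab_group_add \<Rightarrow> 'u"
  assumes vs: "vector_space s" and E: "lin_rep s Q E" and w: "w \<in> spc E a"
  shows "rep_hom (fun_scale (*)) s Q (proj_rep Q a) E (free_hom s Q E a w)"
proof (rule rep_homI)
  interpret vs: vector_space s by fact
  fix z assume z: "z \<in> verts Q"
  note fm = linear_map_onD(1)[OF linear_map_on_fold_act[OF E] w]
  show "linear_map_on (fun_scale (*)) s (spc (proj_rep Q a) z) (spc E z) (free_hom s Q E a w z)"
  proof (rule linear_map_onI)
    fix u show "free_hom s Q E a w z u \<in> spc E z"
      unfolding free_hom_def
      by (intro vs.subspace_sum vs.subspace_scale lin_repD(1)[OF E z] fm)
    fix v show "free_hom s Q E a w z (u + v) = free_hom s Q E a w z u + free_hom s Q E a w z v"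
      by (simp add: free_hom_def vs.scale_left_distrib sum.distrib)
    fix c show "free_hom s Q E a w z (fun_scale (*) c u) = s c (free_hom s Q E a w z u)"
      by (simp add: free_hom_def fun_scale_def vs.scale_sum_right)
  qed
next
  interpret vs: vector_space s by fact
  interpret p: vector_space_pair s s by unfold_locales
  fix \<alpha> and F :: "'a list \<Rightarrow> 'k"
  assume \<alpha>: "\<alpha> \<in> arcs Q" and F: "F \<in> spc (proj_rep Q a) (tail Q \<alpha>)"
  let ?P = "paths Q a (tail Q \<alpha>)" and ?P' = "paths Q a (head Q \<alpha>)"
  note fm = linear_map_onD(1)[OF linear_map_on_fold_act[OF E] w]
  note Ea = lin_repD(2)[OF E \<alpha>] and Es = lin_repD(1)[OF E tail_in_verts[OF \<alpha>]]
  have fm': "s (F p) (fold (act E) p w) \<in> spc E (tail Q \<alpha>)" if "p \<in> ?P" for p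
    using vs.subspace_scale[OF Es fm[OF that]] .
  have "free_hom s Q E a w (head Q \<alpha>) (act (proj_rep Q a) \<alpha> F) =
      (\<Sum>q\<in>?P'. s (if q \<noteq> [] \<and> last q = \<alpha> then F (butlast q) else 0) (fold (act E) q w))"
    by (simp add: free_hom_def act_proj_rep)
  also have "\<dots> = (\<Sum>q\<in>(\<lambda>p. p @ [\<alpha>]) ` ?P. s (if q \<noteq> []
      \<and> last q = \<alpha> then F (butlast q) else 0) (fold (act E) q w))"
  proof (rule sum.mono_neutral_right)
    show "(\<lambda>p. p @ [\<alpha>]) ` ?P \<subseteq> ?P'" using \<alpha> by (auto simp: snoc_in_paths)
    show "\<forall>q\<in>?P' - (\<lambda>p. p @ [\<alpha>]) ` ?P. s (if q \<noteq> []
        \<and> last q = \<alpha> then F (butlast q) else 0) (fold (act E) q w) = 0"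
    proof
      fix q assume q: "q \<in> ?P' - (\<lambda>p. p @ [\<alpha>]) ` ?P"
      have False if "q \<noteq> []" "last q = \<alpha>"
      proof -
        have "q = butlast q @ [\<alpha>]" using that append_butlast_last_id[of q] by simp
        then show False using q snoc_in_paths[of "butlast q" \<alpha> a] by (metis DiffE imageI)
      qed
      then show "s (if q \<noteq> [] \<and> last q = \<alpha> then F (butlast q) else 0) (fold (act E) q w) = 0" by auto
    qed
  qed (rule finite_paths)
  also have "\<dots> = (\<Sum>p\<in>?P. s (F p) (act E \<alpha> (fold (act E) p w)))"
    by (subst sum.reindex) (auto simp: inj_on_def)
  also have "\<dots> = (\<Sum>p\<in>?P. act E \<alpha> (s (F p) (fold (act E) p w)))"
    using linear_map_onD(3)[OF Ea fm] by simp
  also have "\<dots> = act E \<alpha> (free_hom s Q E a w (tail Q \<alpha>) F)"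
    unfolding free_hom_def by (rule p.linear_map_on_sum[OF Ea Es fm', symmetric])
  finally show "free_hom s Q E a w (head Q \<alpha>) (act (proj_rep Q a) \<alpha> F) =
      act E \<alpha> (free_hom s Q E a w (tail Q \<alpha>) F)" .
qed

lemma rep_hom_free_hom:
  assumes "vector_space s" "vector_space t" "lin_rep s Q E" "rep_hom s t Q E E' g" "w \<in> spc E a"
      "z \<in> verts Q"
  shows "g z (free_hom s Q E a w z F) = free_hom t Q E' a (g a w) z F"
proof -
  interpret vector_space_pair s t using assms(1,2) by (simp add: vector_space_pair_def)
  note fm = linear_map_onD(1)[OF linear_map_on_fold_act[OF assms(3)] assms(5)]
  have "g z (free_hom s Q E a w z F) = (\<Sum>p\<in>paths Q a z. g z (s (F p) (fold (act E) p w)))"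
    unfolding free_hom_def
    by (rule linear_map_on_sum[OF rep_homD(1)[OF assms(4,6)] lin_repD(1)[OF assms(3,6)]])
      (rule vs1.subspace_scale[OF lin_repD(1)[OF assms(3,6)] fm])
  also have "\<dots> = (\<Sum>p\<in>paths Q a z. t (F p) (fold (act E') p (g a w)))"
    using linear_map_onD(3)[OF rep_homD(1)[OF assms(4,6)] fm] rep_hom_fold_act[OF assms(3,4) _ assms(5)]
    by simp
  finally show ?thesis by (simp add: free_hom_def)
qed

lemma free_hom_zero:
  assumes "vector_space s" "lin_rep s Q E" "a \<in> verts Q"
  shows "free_hom s Q E a 0 z F = 0"
proof -
  interpret vector_space_pair s s using assms(1) by (simp add: vector_space_pair_def)
  show ?thesis
    using linear_map_on_zero[OF linear_map_on_fold_act[OF assms(2)] lin_repD(1)[OF assms(2,3)]]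
    by (simp add: free_hom_def)
qed

lemma free_hom_zero_right: "vector_space s \<Longrightarrow> free_hom s Q E a w z (\<lambda>_. 0) = 0"
proof -
  assume "vector_space s"
  then interpret vector_space s .
  show ?thesis by (simp add: free_hom_def)
qed

lemma free_hom_delta:
  assumes "vector_space s" "p \<in> paths Q a z"
  shows "free_hom s Q E a w z (\<lambda>q. if q = p then 1 else 0) = fold (act E) p w"
proof -
  interpret vector_space s by fact
  have "free_hom s Q E a w z (\<lambda>q. if q = p then 1 else 0) =
      (\<Sum>q\<in>paths Q a z. if q = p then fold (act E) p w else 0)"
    unfolding free_hom_def by (intro sum.cong) auto
  then show ?thesis using assms(2) by (simp add: finite_paths)
qed

lemma rep_hom_embed:
  assumes t: "vector_space t" and R: "\<And>a. lin_rep t Q (R a)"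
  shows "rep_hom (fun_scale t) (fun_scale t) Q (list_sum R as) (list_sum R (as @ bs)) (\<lambda>x F. F)"
proof -
  interpret f: vector_space "fun_scale t" using t by (rule vector_space_fun_scale)
  have "rep_hom (fun_scale t) t Q (list_sum R as) (R ((as @ bs) ! i)) (\<lambda>x F. if i < length as then F
      i else 0)"
    if "i < length (as @ bs)" for i
    using rep_hom_component[where i = i and as = as and t = t and R = R]
        rep_hom_zero[OF f.vector_space_axioms t lin_rep_list_sum[OF t R] R]
    by (cases "i < length as") (auto simp: nth_append)
  from rep_hom_tuple[where R = R and as = "as @ bs"
      and h = "\<lambda>i x F. if i < length as then F i else 0", OF t this]
  show ?thesis
    by (rule rep_hom_cong[OF _ lin_rep_list_sum[OF t R] f.module_axioms])
      (auto simp: list_sum_def rep_sum_def fun_eq_iff)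
qed

text \<open>
  Enlarge \<open>P\<close> by \<open>P\<^sub>x\<close> to reach \<open>e\<close>, and \<open>P'\<close> by one \<open>P\<^sub>y\<close> for each arrow
  \<open>\<alpha> : x \<rightarrow> y\<close>, whose generator records that \<open>\<alpha> e\<close> already comes from some \<open>\<pi> \<in> P(y)\<close>.
\<close>

lemma presentation_step:
  fixes s :: "'k::field \<Rightarrow> 'u::ab_group_add \<Rightarrow> 'u"
  assumes vs: "vector_space s" and E: "is_rep s Q E" and pres: "presentation s Q E bs as f g"
    and x: "x \<in> verts Q" and e: "e \<in> spc E x" "e \<notin> g x ` spc (proj_sum Q as) x"
    and surj: "\<And>\<alpha>. \<alpha> \<in> arcs Q \<Longrightarrow> tail Q \<alpha> = x \<Longrightarrow>
       g (head Q \<alpha>) ` spc (proj_sum Q as) (head Q \<alpha>) = spc E (head Q \<alpha>)"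
  obtains as' bs' f' g' where "presentation s Q E bs' as' f' g'" "e \<in> g' x ` spc (proj_sum Q as') x"
    "\<And>z. z \<in> verts Q \<Longrightarrow> g z ` spc (proj_sum Q as) z \<subseteq> g' z ` spc (proj_sum Q as') z"
proof -
  interpret vs: vector_space s by fact
  interpret ss: vector_space "sum_scale :: 'k \<Rightarrow> (nat \<Rightarrow> 'a list \<Rightarrow> 'k) \<Rightarrow> _"
      by (rule vector_space_sum_scale)
  interpret f1: vector_space "fun_scale (*) :: 'k \<Rightarrow> ('a list \<Rightarrow> 'k) \<Rightarrow> _"
    by (intro vector_space_fun_scale vector_space_mult)
  interpret Fs: vector_space_pair "sum_scale :: 'k \<Rightarrow> (nat \<Rightarrow> 'a list \<Rightarrow> 'k) \<Rightarrow> _" s by unfold_locales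
  interpret FF: vector_space_pair "sum_scale :: 'k \<Rightarrow> (nat \<Rightarrow> 'a list \<Rightarrow> 'k) \<Rightarrow> _"
      "sum_scale :: 'k \<Rightarrow> (nat \<Rightarrow> 'a list \<Rightarrow> 'k) \<Rightarrow> _" by unfold_locales
  note lE = is_rep_lin_rep[OF E]
  have as: "set as \<subseteq> verts Q" and bs: "set bs \<subseteq> verts Q"
    and f: "rep_hom sum_scale sum_scale Q (proj_sum Q bs) (proj_sum Q as) f"
    and g: "rep_hom sum_scale s Q (proj_sum Q as) E g"
    and finj: "\<And>z. z \<in> verts Q \<Longrightarrow> inj_on (f z) (spc (proj_sum Q bs) z)"
    and exact: "\<And>z. z \<in> verts Q \<Longrightarrow> f z ` spc (proj_sum Q bs) z = {\<phi> \<in> spc (proj_sum Q as) z. g z \<phi> = 0}"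
    using pres by (auto simp: presentation_def)
  note sub = lin_repD(1)[OF lin_rep_proj_sum]
  obtain outs where outs: "set outs = out_arcs Q x" "distinct outs"
    using finite_distinct_list[OF finite_arcs_at(2)[OF x]] by blast
  define n m k where "n = length as" and "m = length bs" and "k = length outs"
  have outs_nth: "outs ! j \<in> arcs Q" "tail Q (outs ! j) = x" if "j < k" for j
    using nth_mem[OF that[unfolded k_def]] outs(1) by auto
  have "\<exists>\<pi>. \<pi> \<in> spc (proj_sum Q as) (head Q (outs ! j)) \<and> g (head Q (outs ! j)) \<pi> = act E (outs ! j) e"
    if j: "j < k" for j
  proof -
    have "act E (outs ! j) e \<in> spc E (head Q (outs ! j))"
      using lin_repD(3)[OF lE outs_nth(1)[OF j]] outs_nth(2)[OF j] e(1) by simp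
    then show ?thesis using surj[OF outs_nth[OF j]] by (metis imageE)
  qed
  then obtain \<pi> where \<pi>: "\<And>j. j < k \<Longrightarrow> \<pi> j \<in> spc (proj_sum Q as) (head Q (outs ! j))"
    "\<And>j. j < k \<Longrightarrow> g (head Q (outs ! j)) (\<pi> j) = act E (outs ! j) e" by metis
  define as' bs' where "as' = as @ [x]" and "bs' = bs @ map (head Q) outs"
  have len: "length as' = Suc n" "length bs' = m + k"
    by (simp_all add: as'_def bs'_def n_def m_def k_def)
  have as'_nth: "as' ! i = (if i < n then as ! i else x)" if "i < Suc n" for i
    using that by (auto simp: as'_def n_def nth_append)
  have bs'_nth: "bs' ! i = (if i < m then bs ! i else head Q (outs ! (i - m)))" if "i < m + k" for i
    using that by (auto simp: bs'_def m_def k_def nth_append)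
  note trA = rep_hom_trunc[of "fun_scale (*) :: 'k \<Rightarrow> ('a list \<Rightarrow> 'k) \<Rightarrow> _" "proj_rep Q" as "[x]",
      OF f1.vector_space_axioms, folded sum_scale_def proj_sum_eq as'_def n_def]
  note trB = rep_hom_trunc[of "fun_scale (*) :: 'k \<Rightarrow> ('a list \<Rightarrow> 'k) \<Rightarrow> _"
      "proj_rep Q" bs "map (head Q) outs",
      OF f1.vector_space_axioms, folded sum_scale_def proj_sum_eq bs'_def m_def]
  note emb = rep_hom_embed[of "fun_scale (*) :: 'k \<Rightarrow> ('a list \<Rightarrow> 'k) \<Rightarrow> _" "proj_rep Q" as "[x]",
      OF f1.vector_space_axioms lin_rep_proj_rep, folded sum_scale_def proj_sum_eq as'_def]
  have low: "F i = 0" if "F \<in> spc (proj_sum Q as) z" "\<not> i < n"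
    for F :: "nat \<Rightarrow> 'a list \<Rightarrow> 'k" and z i
    using that by (auto simp: spc_proj_sum n_def zero_fun_def fun_eq_iff)
  have tr_low: "trunc n F = F" if "F \<in> spc (proj_sum Q as) z" for F :: "nat \<Rightarrow> 'a list \<Rightarrow> 'k" and z
    using low[OF that] by (auto simp: trunc_def fun_eq_iff)
  \<comment> \<open>The generator of the new relation \<open>j\<close>: the one-arrow path
    \<open>[outs ! j]\<close> in the new summand minus \<open>\<pi> j\<close> in the old ones. Both
    parts are sent to \<open>act E (outs ! j) e\<close>, so \<open>g'\<close> kills it.\<close>
  define r where "r j = (\<lambda>i q. if i < n then - \<pi> j i q else if i = n \<and> q = [outs ! j]
      then (1::'k) else 0)" for j
  have r: "r j \<in> spc (proj_sum Q as') (head Q (outs ! j))" if j: "j < k" for j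
    unfolding spc_proj_sum
  proof (intro allI impI)
    fix i q assume nz: "r j i q \<noteq> 0"
    show "i < length as' \<and> q \<in> paths Q (as' ! i) (head Q (outs ! j))"
    proof (cases "i < n")
      case True
      then show ?thesis using nz \<pi>(1)[OF j] as'_nth[of i] len by (auto simp: r_def spc_proj_sum)
    next
      case False
      then have "i = n" "q = [outs ! j]" using nz by (auto simp: r_def split: if_splits)
      then show ?thesis using as'_nth[of n] len arc_in_paths[OF outs_nth(1)[OF j]] outs_nth(2)[OF j]
          by simp
    qed
  qed
  define g' where "g' z F = g z (trunc n F) + free_hom s Q E x e z (F n)" for z F
  define S where "S z H = (\<Sum>j<k. free_hom sum_scale Q (proj_sum Q as') (head Q (outs ! j)) (r j) z
      (H j))" for z H
  define f' where "f' z G = f z (trunc m G) + S z (\<lambda>j. G (m + j))" for z G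
  have g'_hom: "rep_hom sum_scale s Q (proj_sum Q as') E g'"
    unfolding g'_def
  proof (rule rep_hom_add[OF vs lE])
    show "rep_hom sum_scale s Q (proj_sum Q as') E (\<lambda>z F. g z (trunc n F))"
        using rep_hom_comp[OF trA g] .
    have "rep_hom sum_scale (fun_scale (*)) Q (proj_sum Q as') (proj_rep Q x) (\<lambda>z F. F n)"
      using rep_hom_component[where i = n and as = as' and t = "fun_scale (*)" and R = "proj_rep Q"]
          as'_nth[of n] len
      by (simp add: sum_scale_def proj_sum_eq)
    from rep_hom_comp[OF this rep_hom_free[OF vs lE e(1)]]
    show "rep_hom sum_scale s Q (proj_sum Q as') E (\<lambda>z F. free_hom s Q E x e z (F n))" .
  qed
  have f'_hom: "rep_hom sum_scale sum_scale Q (proj_sum Q bs') (proj_sum Q as') f'"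
    unfolding f'_def S_def
  proof (intro rep_hom_add[OF ss.vector_space_axioms lin_rep_proj_sum]
      rep_hom_sum[OF ss.vector_space_axioms ss.vector_space_axioms lin_rep_proj_sum lin_rep_proj_sum])
    show "rep_hom sum_scale sum_scale Q (proj_sum Q bs') (proj_sum Q as') (\<lambda>z G. f z (trunc m G))"
      using rep_hom_comp[OF rep_hom_comp[OF trB f] emb] .
    fix j assume "j \<in> {..<k}"
    then have j: "j < k" by simp
    have "rep_hom sum_scale (fun_scale (*)) Q (proj_sum Q bs') (proj_rep Q (head Q (outs ! j))) (\<lambda>z
        G. G (m + j))"
      using rep_hom_component[where i = "m + j" and as = bs' and t = "fun_scale (*)"
          and R = "proj_rep Q"] bs'_nth[of "m + j"] j len
      by (simp add: sum_scale_def proj_sum_eq)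
    from rep_hom_comp[OF this rep_hom_free[OF ss.vector_space_axioms lin_rep_proj_sum r[OF j]]]
    show "rep_hom sum_scale sum_scale Q (proj_sum Q bs') (proj_sum Q as')
        (\<lambda>z G. free_hom sum_scale Q (proj_sum Q as') (head Q (outs ! j)) (r j) z (G (m + j)))" .
  qed
  have g'_low: "g' z F = g z F" if "F \<in> spc (proj_sum Q as) z" for F z
    using tr_low[OF that] low[OF that, of n] free_hom_zero_right[OF vs]
        by (simp add: g'_def zero_fun_def)
  have gr: "g' (head Q (outs ! j)) (r j) = 0" if j: "j < k" for j
  proof -
    let ?y = "head Q (outs ! j)"
    have y: "?y \<in> verts Q" using outs_nth[OF j] by simp
    have "trunc n (r j) = 0 - \<pi> j"
      using low[OF \<pi>(1)[OF j]] by (auto simp: r_def trunc_def fun_eq_iff)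
    then have "g ?y (trunc n (r j)) = - act E (outs ! j) e"
      using Fs.linear_map_on_diff[OF rep_homD(1)[OF g y] sub[OF y] ss.subspace_0[OF sub[OF y]]
          \<pi>(1)[OF j]]
        Fs.linear_map_on_zero[OF rep_homD(1)[OF g y] sub[OF y]] \<pi>(2)[OF j] by simp
    moreover have "[outs ! j] \<in> paths Q x ?y"
        using arc_in_paths[OF outs_nth(1)[OF j]] outs_nth(2)[OF j] by simp
    from free_hom_delta[OF vs this, of E e]
    have "free_hom s Q E x e ?y (r j n) = act E (outs ! j) e" by (simp add: r_def)
    ultimately show ?thesis by (simp add: g'_def)
  qed
  have Smem: "S z H \<in> spc (proj_sum Q as') z"
      if "z \<in> verts Q" "\<And>j. j < k \<Longrightarrow> H j \<in> spc (proj_rep Q (head Q (outs ! j))) z" for z H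
    unfolding S_def
    by (intro ss.subspace_sum[OF sub[OF that(1)]])
      (use rep_homD(3)[OF rep_hom_free[OF ss.vector_space_axioms lin_rep_proj_sum r]
          that(1) that(2)] in auto)
  have gS: "g' z (S z H) = 0" if z: "z \<in> verts Q" and H: "\<And>j. j < k \<Longrightarrow>
      H j \<in> spc (proj_rep Q (head Q (outs ! j))) z" for z H
  proof -
    have m: "free_hom sum_scale Q (proj_sum Q as') (head Q (outs ! j)) (r j) z (H j) \<in> spc (proj_sum
        Q as') z"
      if "j \<in> {..<k}" for j
      using rep_homD(3)[OF rep_hom_free[OF ss.vector_space_axioms lin_rep_proj_sum r] z H] that by auto
    have "g' z (S z H) = (\<Sum>j<k. g' z (free_hom sum_scale Q (proj_sum Q as') (head Q (outs ! j)) (r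
        j) z (H j)))"
      unfolding S_def by (rule Fs.linear_map_on_sum[OF rep_homD(1)[OF g'_hom z] sub[OF z] m])
    also have "\<dots> = 0"
    proof (rule sum.neutral, intro ballI)
      fix j assume "j \<in> {..<k}"
      then have j: "j < k" by simp
      have y: "head Q (outs ! j) \<in> verts Q" using outs_nth[OF j] by simp
      show "g' z (free_hom sum_scale Q (proj_sum Q as') (head Q (outs ! j)) (r j) z (H j)) = 0"
        using rep_hom_free_hom[OF ss.vector_space_axioms vs lin_rep_proj_sum g'_hom r[OF j] z]
          gr[OF j] free_hom_zero[OF vs lE y] by simp
    qed
    finally show ?thesis .
  qed
  have Sn: "S z H n q = (\<Sum>j<k. \<Sum>p\<in>paths Q (head Q (outs ! j)) z. if q = outs ! j # p then H j p else
      0)" for z H q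
  proof -
    have "fold (act (proj_sum Q as')) p (r j) n q = (if q = outs ! j # p then 1 else 0)" for j p
      using fold_act_proj_sum_delta[of n as' "r j" "[outs ! j]" p q] len by (simp add: r_def)
    then show ?thesis
      unfolding S_def free_hom_def sum_apply_apply sum_scale_apply by (intro sum.cong refl) simp
  qed
  have Sn_Nil: "S z H n [] = 0" for z H by (simp add: Sn)
  \<comment> \<open>The first arrow of a path out of \<open>x\<close> tells the generators apart, so
    \<open>H\<close> can be recovered from the component \<open>n\<close> of \<open>S z H\<close>.
    Both the injectivity of \<open>f'\<close> and the reduction of a kernel element below rest on
    this.\<close>
  have Sn_Cons: "S z H n (outs ! j # p) = H j p"
    if j: "j < k" and H: "H j \<in> spc (proj_rep Q (head Q (outs ! j))) z" for z H j p
  proof -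
    have "S z H n (outs ! j # p) = (\<Sum>i<k. if i = j then H j p else 0)"
      unfolding Sn
    proof (rule sum.cong)
      fix i assume "i \<in> {..<k}"
      then have "outs ! j = outs ! i \<longleftrightarrow> i = j" using outs(2) j by (auto simp: nth_eq_iff_index_eq k_def)
      then have "(\<Sum>pa\<in>paths Q (head Q (outs ! i)) z. if outs ! j # p = outs ! i # pa then H i pa
          else 0) =
          (if i = j then \<Sum>pa\<in>paths Q (head Q (outs ! j)) z. if p = pa then H j pa else 0 else 0)"
        by auto
      also have "\<dots> = (if i = j then H j p else 0)" using H by (auto simp: finite_paths spc_proj_rep)
      finally show "(\<Sum>pa\<in>paths Q (head Q (outs ! i)) z. if outs ! j # p = outs ! i # pa then H i pa
          else 0) =
          (if i = j then H j p else 0)" .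
    qed simp
    then show ?thesis using j by simp
  qed
  have Gmem: "G (m + j) \<in> spc (proj_rep Q (head Q (outs ! j))) z"
    if "G \<in> spc (proj_sum Q bs') z" "j < k" for G :: "nat \<Rightarrow> 'a list \<Rightarrow> 'k" and z j
    unfolding spc_proj_rep
  proof (intro allI impI)
    fix p assume "G (m + j) p \<noteq> 0"
    then have "p \<in> paths Q (bs' ! (m + j)) z" using that(1) unfolding spc_proj_sum by blast
    then show "p \<in> paths Q (head Q (outs ! j)) z" using that(2) bs'_nth[of "m + j"] by simp
  qed
  have trBmem: "trunc m G \<in> spc (proj_sum Q bs) z" if "G \<in> spc (proj_sum Q bs') z" "z \<in> verts Q"
    for G :: "nat \<Rightarrow> 'a list \<Rightarrow> 'k" and z using rep_homD(3)[OF trB that(2,1)] .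
  have "presentation s Q E bs' as' f' g'"
    unfolding presentation_def
  proof (intro conjI ballI g'_hom f'_hom)
    show "set as' \<subseteq> verts Q" using as x by (simp add: as'_def)
    show "set bs' \<subseteq> verts Q" using bs outs(1) by (auto simp: bs'_def)
    fix z assume z: "z \<in> verts Q"
    have "G = 0" if G: "G \<in> spc (proj_sum Q bs') z" "f' z G = 0" for G
    proof -
      have fG: "f z (trunc m G) \<in> spc (proj_sum Q as) z" using rep_homD(3)[OF f z trBmem[OF G(1) z]] .
      have high: "G (m + j) p = 0" if j: "j < k" for j p
      proof -
        have "f' z G n (outs ! j # p) = G (m + j) p"
          using low[OF fG, of n] Sn_Cons[where H = "\<lambda>j. G (m + j)", OF j Gmem[OF G(1) j]]
          by (simp add: f'_def)
        then show ?thesis by (simp add: G(2))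
      qed
      have "S z (\<lambda>j. G (m + j)) = 0"
        unfolding S_def
      proof (rule sum.neutral, intro ballI)
        fix j assume "j \<in> {..<k}"
        then have "G (m + j) = (\<lambda>_. 0)" using high by auto
        then show "free_hom sum_scale Q (proj_sum Q as') (head Q (outs ! j)) (r j) z (G (m + j)) = 0"
          using free_hom_zero_right[OF ss.vector_space_axioms] by simp
      qed
      then have "f z (trunc m G) = 0" using G(2) by (simp add: f'_def)
      then have t0: "trunc m G = 0"
        using FF.linear_map_on_inj_iff[OF rep_homD(1)[OF f z] sub[OF z]] finj[OF z]
            trBmem[OF G(1) z] by blast
      have "G i p = 0" for i p
      proof -
        consider "i < m" | "m \<le> i" "i < m + k" | "m + k \<le> i" by linarith
        then show ?thesis
        proof cases
          case 1 then show ?thesis using fun_cong[OF fun_cong[OF t0, of i], of p]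
              by (simp add: trunc_def)
        next
          case 2 then show ?thesis using high[of "i - m"] by simp
        next
          case 3 then show ?thesis using G(1) len(2) unfolding spc_proj_sum by (metis leD)
        qed
      qed
      then show ?thesis by (auto simp: fun_eq_iff)
    qed
    then show "inj_on (f' z) (spc (proj_sum Q bs') z)"
      using FF.linear_map_on_inj_iff[OF rep_homD(1)[OF f'_hom z] sub[OF z]] by blast
    show "f' z ` spc (proj_sum Q bs') z = {\<phi> \<in> spc (proj_sum Q as') z. g' z \<phi> = 0}"
    proof (intro subset_antisym subsetI)
      fix F assume "F \<in> f' z ` spc (proj_sum Q bs') z"
      then obtain G where G: "G \<in> spc (proj_sum Q bs') z" "F = f' z G" by auto
      have fG: "f z (trunc m G) \<in> spc (proj_sum Q as) z" using rep_homD(3)[OF f z trBmem[OF G(1) z]] .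
      have "g z (f z (trunc m G)) = 0" using exact[OF z] trBmem[OF G(1) z] by blast
      moreover have "g' z F = g' z (f z (trunc m G)) + g' z (S z (\<lambda>j. G (m + j)))"
        unfolding G(2) f'_def
        by (rule linear_map_onD(2)[OF rep_homD(1)[OF g'_hom z]])
          (use rep_homD(3)[OF emb z fG] Smem[OF z Gmem[OF G(1)]] in auto)
      ultimately have "g' z F = 0" using g'_low[OF fG] gS[OF z Gmem[OF G(1)]] by simp
      then show "F \<in> {\<phi> \<in> spc (proj_sum Q as') z. g' z \<phi> = 0}"
        using rep_homD(3)[OF f'_hom z G(1)] G(2) by simp
    next
      fix F assume "F \<in> {\<phi> \<in> spc (proj_sum Q as') z. g' z \<phi> = 0}"
      then have F: "F \<in> spc (proj_sum Q as') z" "g' z F = 0" by auto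
      \<comment> \<open>Subtracting this combination of the new relations clears every coefficient
        of the new summand at a nontrivial path.\<close>
      define H where "H j p = F n (outs ! j # p)" for j p
      have H: "H j \<in> spc (proj_rep Q (head Q (outs ! j))) z" if "j < k" for j
        unfolding spc_proj_rep
      proof (intro allI impI)
        fix p assume "H j p \<noteq> 0"
        then have "outs ! j # p \<in> paths Q (as' ! n) z" using F(1) unfolding H_def spc_proj_sum by blast
        then show "p \<in> paths Q (head Q (outs ! j)) z" by (simp add: Cons_in_paths)
      qed
      define \<Psi> where "\<Psi> = F - S z H"
      have SH: "S z H \<in> spc (proj_sum Q as') z" using Smem[OF z H] .
      have \<Psi>: "\<Psi> \<in> spc (proj_sum Q as') z" unfolding \<Psi>_def
          using ss.subspace_diff[OF sub[OF z] F(1) SH] .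
      have g\<Psi>: "g' z \<Psi> = 0"
        unfolding \<Psi>_def using Fs.linear_map_on_diff[OF rep_homD(1)[OF g'_hom z] sub[OF z] F(1) SH]
            F(2) gS[OF z H]
        by simp
      have \<Psi>n: "\<Psi> n q = 0" if ne: "q \<noteq> []" for q
      proof (rule ccontr)
        assume nz: "\<Psi> n q \<noteq> 0"
        then have "q \<in> paths Q (as' ! n) z" using \<Psi> unfolding spc_proj_sum by blast
        then have "q \<in> paths Q x z" using as'_nth[of n] by simp
        moreover obtain \<alpha> p where q: "q = \<alpha> # p" using ne by (cases q) auto
        ultimately have "\<alpha> \<in> set outs" using outs(1) by (auto simp: Cons_in_paths)
        then obtain j where j: "j < k" "\<alpha> = outs ! j" by (metis in_set_conv_nth k_def)
        then show False using nz Sn_Cons[where H = H and p = p, OF j(1) H[OF j(1)]]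
            by (simp add: \<Psi>_def q H_def)
      qed
      have trm: "trunc n \<Psi> \<in> spc (proj_sum Q as) z" using rep_homD(3)[OF trA z \<Psi>] .
      \<comment> \<open>A nonzero coefficient at the trivial path could be divided out and would
        make \<open>e\<close> a value of \<open>g\<close>, against the choice of \<open>e\<close>.
        The remainder then lies in the old summands, where the old presentation is exact.\<close>
      have "\<Psi> n [] = 0"
      proof (rule ccontr)
        assume c: "\<Psi> n [] \<noteq> 0"
        then have "[] \<in> paths Q (as' ! n) z" using \<Psi> unfolding spc_proj_sum by blast
        then have "[] \<in> paths Q x z" using as'_nth[of n] by simp
        then have zx: "z = x" by (simp add: Nil_in_paths)
        let ?c = "\<Psi> n []"
        have "free_hom s Q E x e z (\<Psi> n) = s ?c e" by (simp add: free_hom_def zx paths_same[OF x])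
        then have "s ?c e = - g z (trunc n \<Psi>)" using g\<Psi> by (simp add: g'_def add_eq_0_iff)
        then have "s (- inverse ?c) (g z (trunc n \<Psi>)) = s (inverse ?c) (s ?c e)" by simp
        also have "\<dots> = e" using c by simp
        finally have "e = g z (sum_scale (- inverse ?c) (trunc n \<Psi>))"
          by (simp only: linear_map_onD(3)[OF rep_homD(1)[OF g z] trm])
        moreover have "sum_scale (- inverse ?c) (trunc n \<Psi>) \<in> spc (proj_sum Q as) z"
          using ss.subspace_scale[OF sub[OF z] trm] .
        ultimately show False using e(2) zx by blast
      qed
      with \<Psi>n have n0: "\<Psi> n q = 0" for q by (cases "q = []") auto
      have "\<Psi> i q = 0" if "\<not> i < n" for i q
        using n0 that \<Psi> len(1) unfolding spc_proj_sum by (metis less_antisym)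
      then have "trunc n \<Psi> = \<Psi>" by (auto simp: trunc_def fun_eq_iff)
      then have \<Psi>l: "\<Psi> \<in> spc (proj_sum Q as) z" using trm by simp
      then have "\<Psi> \<in> f z ` spc (proj_sum Q bs) z" using exact[OF z] g'_low g\<Psi> by simp
      then obtain G0 where G0: "G0 \<in> spc (proj_sum Q bs) z" "\<Psi> = f z G0" by auto
      define G where "G i = (if i < m then G0 i else if i < m + k then H (i - m) else 0)" for i
      have G: "G \<in> spc (proj_sum Q bs') z"
        unfolding spc_proj_sum
      proof (intro allI impI)
        fix i p assume nz: "G i p \<noteq> 0"
        then have i: "i < m + k" by (auto simp: G_def split: if_splits)
        show "i < length bs' \<and> p \<in> paths Q (bs' ! i) z"
        proof (cases "i < m")
          case True
          then show ?thesis using nz G0(1) i bs'_nth[OF i] len by (simp add: G_def spc_proj_sum)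
        next
          case False
          then show ?thesis using nz H[of "i - m"] i bs'_nth[OF i] len by (simp add: G_def spc_proj_rep)
        qed
      qed
      have "trunc m G = G0"
      proof -
        have "G0 i = 0" if "\<not> i < m" for i
          using G0(1) that unfolding spc_proj_sum by (auto simp: m_def zero_fun_def fun_eq_iff)
        then show ?thesis by (auto simp: trunc_def G_def fun_eq_iff)
      qed
      moreover have "S z (\<lambda>j. G (m + j)) = S z H" unfolding S_def by (intro sum.cong) (auto simp: G_def)
      ultimately have "f' z G = \<Psi> + S z H" using G0(2) by (simp add: f'_def)
      then have "f' z G = F" by (simp add: \<Psi>_def)
      then show "F \<in> f' z ` spc (proj_sum Q bs') z" using G by blast
    qed
  qed
  moreover have "e \<in> g' x ` spc (proj_sum Q as') x"
  proof -
    define F where "F = (\<lambda>i (q :: 'a list). if i = n \<and> q = [] then 1 else (0::'k))"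
    have "F \<in> spc (proj_sum Q as') x" using as'_nth[of n] len x
        by (auto simp: F_def spc_proj_sum Nil_in_paths)
    moreover have "trunc n F = 0" by (auto simp: F_def trunc_def fun_eq_iff)
    then have "g' x F = e"
      using Fs.linear_map_on_zero[OF rep_homD(1)[OF g x] sub[OF x]]
          free_hom_delta[OF vs, of "[]" x x E e] x
      by (simp add: g'_def F_def Nil_in_paths)
    ultimately show ?thesis by blast
  qed
  moreover have "g z ` spc (proj_sum Q as) z \<subseteq> g' z ` spc (proj_sum Q as') z" if "z \<in> verts Q" for z
  proof
    fix v assume "v \<in> g z ` spc (proj_sum Q as) z"
    then obtain F where F: "F \<in> spc (proj_sum Q as) z" "v = g z F" by auto
    then have "v = g' z F" by (simp add: g'_low)
    then show "v \<in> g' z ` spc (proj_sum Q as') z" using rep_homD(3)[OF emb that F(1)]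
        by (rule image_eqI)
  qed
  ultimately show ?thesis using that by blast
qed

text \<open>The cokernel, supported on \<open>D\<close>, is filled vector by vector at a sink of its
  support. Every arrow out of a sink leads to a vertex where \<open>g\<close> is already onto, as
  \<open>presentation_step\<close> requires. The total codimension of the image decreases.\<close>

lemma presentation_rep_plus:
  fixes s :: "'k::field \<Rightarrow> 'u::ab_group_add \<Rightarrow> 'u"
  assumes vs: "vector_space s" and E: "is_rep s Q E" and "presentation s Q E bs as f g"
    and D: "finite D" and "\<And>x. x \<in> verts Q \<Longrightarrow> x \<notin> D \<Longrightarrow> g x ` spc (proj_sum Q as) x = spc E x"
  shows "rep_plus s Q E"
proof -
  interpret vs: vector_space s by fact
  interpret ss: vector_space "sum_scale :: 'k \<Rightarrow> (nat \<Rightarrow> 'a list \<Rightarrow> 'k) \<Rightarrow> _"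
      by (rule vector_space_sum_scale)
  interpret Fs: vector_space_pair "sum_scale :: 'k \<Rightarrow> (nat \<Rightarrow> 'a list \<Rightarrow> 'k) \<Rightarrow> _" s by unfold_locales
  note sub = lin_repD(1)[OF lin_rep_proj_sum]
  show ?thesis
    using assms(3,5)
  proof (induction "\<Sum>x\<in>D \<inter> verts Q. vs.dim (spc E x) - vs.dim (g x ` spc (proj_sum Q as) x)"
      arbitrary: as bs f g rule: less_induct)
    case less
    have g: "rep_hom sum_scale s Q (proj_sum Q as) E g" using less.prems(1)
        by (simp add: presentation_def)
    have gE: "g z ` spc (proj_sum Q as) z \<subseteq> spc E z" if "z \<in> verts Q" for z
      using rep_homD(3)[OF g that] by blast
    define X where "X = {x \<in> D \<inter> verts Q. g x ` spc (proj_sum Q as) x \<noteq> spc E x}"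
    show ?case
    proof (cases "X = {}")
      case True
      then have "\<And>x. x \<in> verts Q \<Longrightarrow> g x ` spc (proj_sum Q as) x = spc E x"
        using less.prems(2) by (auto simp: X_def)
      then have "short_exact sum_scale sum_scale s Q (proj_sum Q bs) (proj_sum Q as) E f g"
        using less.prems(1) by (auto simp: short_exact_def presentation_def)
      then show ?thesis using E less.prems(1) by (auto simp: rep_plus_def presentation_def)
    next
      case False
      have "finite X" "X \<subseteq> verts Q" using D by (auto simp: X_def)
      then obtain x where x: "x \<in> X" "\<And>\<alpha>. \<alpha> \<in> arcs Q \<Longrightarrow> tail Q \<alpha> = x \<Longrightarrow> head Q \<alpha> \<notin> X"
        using ex_sink[OF _ False] by blast
      have xQ: "x \<in> verts Q" "x \<in> D" using x(1) by (auto simp: X_def)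
      obtain e where e: "e \<in> spc E x" "e \<notin> g x ` spc (proj_sum Q as) x"
        using x(1) gE[OF xQ(1)] by (auto simp: X_def)
      have "g (head Q \<alpha>) ` spc (proj_sum Q as) (head Q \<alpha>) = spc E (head Q \<alpha>)"
        if "\<alpha> \<in> arcs Q" "tail Q \<alpha> = x" for \<alpha>
        using x(2)[OF that] less.prems(2)[of "head Q \<alpha>"] that by (auto simp: X_def)
      from presentation_step[OF vs E less.prems(1) xQ(1) e this]
      obtain as' bs' f' g' where g': "presentation s Q E bs' as' f' g'"
          "e \<in> g' x ` spc (proj_sum Q as') x"
        "\<And>z. z \<in> verts Q \<Longrightarrow> g z ` spc (proj_sum Q as) z \<subseteq> g' z ` spc (proj_sum Q as') z"
        by metis
      have g'h: "rep_hom sum_scale s Q (proj_sum Q as') E g'" using g'(1)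
          by (simp add: presentation_def)
      have g'E: "g' z ` spc (proj_sum Q as') z \<subseteq> spc E z" if "z \<in> verts Q" for z
        using rep_homD(3)[OF g'h that] by blast
      have Ifd: "fd_space s (g' z ` spc (proj_sum Q as') z)" if "z \<in> verts Q" for z
        using vs.fd_space_subspace[OF is_repD[OF E that]
            Fs.subspace_image_on[OF rep_homD(1)[OF g'h that] sub[OF that]] g'E[OF that]] .
      have "(\<Sum>x\<in>D \<inter> verts Q. vs.dim (spc E x) - vs.dim (g' x ` spc (proj_sum Q as') x)) <
          (\<Sum>x\<in>D \<inter> verts Q. vs.dim (spc E x) - vs.dim (g x ` spc (proj_sum Q as) x))"
      proof (rule sum_strict_mono_ex1)
        show "finite (D \<inter> verts Q)" using D by simp
        show "\<forall>z\<in>D \<inter> verts Q. vs.dim (spc E z) - vs.dim (g' z ` spc (proj_sum Q as') z) \<le>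
            vs.dim (spc E z) - vs.dim (g z ` spc (proj_sum Q as) z)"
          using vs.fd_space_dim_le[OF Ifd g'(3)] by (auto intro: diff_le_mono2)
        have "vs.dim (g x ` spc (proj_sum Q as) x) < vs.dim (g' x ` spc (proj_sum Q as') x)"
          using vs.fd_space_dim_less[OF Ifd[OF xQ(1)]
              Fs.subspace_image_on[OF rep_homD(1)[OF g xQ(1)] sub[OF xQ(1)]]]
            g'(2) g'(3)[OF xQ(1)] e(2) by blast
        \<comment> \<open>The codimensions are truncated differences. A larger image makes them
          strictly smaller only because it still fits into \<open>spc E x\<close>.\<close>
        moreover have "vs.dim (g' x ` spc (proj_sum Q as') x) \<le> vs.dim (spc E x)"
          using vs.fd_space_dim_le[OF is_repD[OF E xQ(1)] g'E[OF xQ(1)]] .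
        ultimately show "\<exists>z\<in>D \<inter> verts Q. vs.dim (spc E z) - vs.dim (g' z ` spc (proj_sum Q as') z) <
            vs.dim (spc E z) - vs.dim (g z ` spc (proj_sum Q as) z)"
          using xQ by (intro bexI[of _ x]) auto
      qed
      moreover have "g' z ` spc (proj_sum Q as') z = spc E z" if "z \<in> verts Q" "z \<notin> D" for z
        using less.prems(2)[OF that] g'(3)[OF that(1)] g'E[OF that(1)] by blast
      ultimately show ?thesis using less.hyps g'(1) by blast
    qed
  qed
qed

text \<open>Composing a presentation of \<open>L\<close> with the injection \<open>h\<close> keeps
  the kernel, hence the relations. The cokernel of the composite lives on \<open>D\<close>, where it
  can be repaired.\<close>

lemma rep_plus_inj:
  fixes s :: "'k::field \<Rightarrow> 'u::ab_group_add \<Rightarrow> 'u" and t :: "'k \<Rightarrow> 'w::ab_group_add \<Rightarrow> 'w"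
  assumes vs: "vector_space s" and vt: "vector_space t" and E: "is_rep s Q E" and L: "rep_plus t Q L"
    and h: "rep_hom t s Q L E h" "\<And>x. x \<in> verts Q \<Longrightarrow> inj_on (h x) (spc L x)"
    and D: "finite D" "\<And>x. x \<in> verts Q \<Longrightarrow> x \<notin> D \<Longrightarrow> h x ` spc L x = spc E x"
  shows "rep_plus s Q E"
proof -
  interpret ts: vector_space_pair t s using vs vt by (simp add: vector_space_pair_def)
  obtain as bs f g where *: "set as \<subseteq> verts Q" "set bs \<subseteq> verts Q"
      and ex: "short_exact sum_scale sum_scale t Q (proj_sum Q bs) (proj_sum Q as) L f g"
      and rL: "is_rep t Q L"
    using L by (auto simp: rep_plus_def)
  have g: "rep_hom sum_scale t Q (proj_sum Q as) L g" using ex by (simp add: short_exact_def)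
  have "h x (g x \<phi>) = 0 \<longleftrightarrow> g x \<phi> = 0" if "x \<in> verts Q" "\<phi> \<in> spc (proj_sum Q as) x" for x \<phi>
  proof -
    note sL = lin_repD(1)[OF is_rep_lin_rep[OF rL] that(1)]
    show ?thesis
      using ts.linear_map_on_inj_iff[OF rep_homD(1)[OF h(1) that(1)] sL] h(2)[OF that(1)]
        ts.linear_map_on_zero[OF rep_homD(1)[OF h(1) that(1)] sL] rep_homD(3)[OF g that] by auto
  qed
  then have "presentation s Q E bs as f (\<lambda>x v. h x (g x v))"
    using * ex rep_hom_comp[OF g h(1)] unfolding presentation_def short_exact_def by auto
  moreover have "(\<lambda>v. h x (g x v)) ` spc (proj_sum Q as) x = spc E x" if "x \<in> verts Q" "x \<notin> D" for x
    using ex D(2)[OF that] that(1) by (simp add: short_exact_def image_image[symmetric])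
  ultimately show ?thesis using presentation_rep_plus[OF vs E] D(1) by blast
qed

text \<open>The repair starts from P = P' = 0, for which all of \<open>E\<close> is
  cokernel.\<close>

lemma finite_support_rep_plus:
  fixes s :: "'k::field \<Rightarrow> 'u::ab_group_add \<Rightarrow> 'u"
  assumes vs: "vector_space s" and E: "is_rep s Q E" and D: "finite D"
    and supp: "\<And>x. x \<in> verts Q \<Longrightarrow> x \<notin> D \<Longrightarrow> spc E x = {0}"
  shows "rep_plus s Q E"
proof -
  have z: "spc (proj_sum Q [] :: ('v, 'a, _ \<Rightarrow> _ \<Rightarrow> 'k) rep) z = {0}" for z
    by (auto simp: spc_proj_sum fun_eq_iff)
  have "presentation s Q E [] [] (\<lambda>x v. 0) (\<lambda>x v. 0)"
    using rep_hom_zero[OF vector_space_sum_scale vs lin_rep_proj_sum is_rep_lin_rep[OF E]]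
      rep_hom_zero[OF vector_space_sum_scale vector_space_sum_scale lin_rep_proj_sum lin_rep_proj_sum]
    by (auto simp: presentation_def z)
  moreover have "(\<lambda>v. 0) ` spc (proj_sum Q [] :: ('v, 'a, _ \<Rightarrow> _ \<Rightarrow> 'k) rep) x = spc E x"
    if "x \<in> verts Q" "x \<notin> D" for x using supp[OF that] by (simp add: z)
  ultimately show ?thesis using presentation_rep_plus[OF vs E] D by blast
qed

lemma rep_plus_support:
  fixes s :: "'k::field \<Rightarrow> 'u::ab_group_add \<Rightarrow> 'u"
  assumes "vector_space s" "rep_plus s Q M"
  obtains A where "finite A" "A \<subseteq> verts Q" "\<And>x. x \<in> verts Q \<Longrightarrow> x \<notin> succs Q A \<Longrightarrow> spc M x = {0}"
proof -
  interpret vs: vector_space s by fact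
  interpret ss: vector_space "sum_scale :: 'k \<Rightarrow> (nat \<Rightarrow> 'a list \<Rightarrow> 'k) \<Rightarrow> _"
      by (rule vector_space_sum_scale)
  interpret Fs: vector_space_pair "sum_scale :: 'k \<Rightarrow> (nat \<Rightarrow> 'a list \<Rightarrow> 'k) \<Rightarrow> _" s by unfold_locales
  obtain as bs f g where as: "set as \<subseteq> verts Q" and M: "is_rep s Q M"
      and ex: "short_exact sum_scale sum_scale s Q (proj_sum Q bs) (proj_sum Q as) M f g"
    using assms(2) by (auto simp: rep_plus_def)
  have g: "rep_hom sum_scale s Q (proj_sum Q as) M g"
    and surj: "\<And>x. x \<in> verts Q \<Longrightarrow> g x ` spc (proj_sum Q as) x = spc M x"
    using ex by (auto simp: short_exact_def)
  have "spc M x = {0}" if x: "x \<in> verts Q" "x \<notin> succs Q (set as)" for x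
  proof -
    have "spc (proj_sum Q as :: ('v, 'a, _ \<Rightarrow> _ \<Rightarrow> 'k) rep) x = {0}"
      using x(2) by (fastforce simp: spc_proj_sum succs_def fun_eq_iff)
    then show ?thesis
      using surj[OF x(1)] Fs.linear_map_on_zero[OF rep_homD(1)[OF g x(1)]
          lin_repD(1)[OF lin_rep_proj_sum x(1)]]
      by simp
  qed
  then show ?thesis using that[of "set as"] as by blast
qed

end

section \<open>Extending finitely many conditions; the Fitting decomposition\<close>

text \<open>
  The restrictions to \<open>X\<close> of the functionals vanishing on \<open>S\<close> are cut out by
  \<open>span S \<inter> span X\<close>, which is finite dimensional and hence involves only finitely many elements of \<open>S\<close>.
\<close>

lemma (in vector_space) finite_conditions_extension:
  assumes "finite X"
  shows "\<exists>T \<subseteq> S. finite T \<and>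
    (\<forall>\<psi>. Vector_Spaces.linear scale ((*) :: 'a \<Rightarrow> 'a \<Rightarrow> 'a) \<psi> \<and> (\<forall>r\<in>T. \<psi> r = 0) \<longrightarrow>
       (\<exists>\<psi>'. Vector_Spaces.linear scale (*) \<psi>' \<and> (\<forall>r\<in>S. \<psi>' r = 0) \<and> (\<forall>u\<in>X. \<psi>' u = \<psi> u)))"
proof -
  interpret k: vector_space "(*) :: 'a \<Rightarrow> 'a \<Rightarrow> 'a" by (rule vector_space_mult)
  interpret p: vector_space_pair scale "(*) :: 'a \<Rightarrow> 'a \<Rightarrow> 'a" by unfold_locales
  have "fd_space scale (span X)" using assms span_superset[of X] by (auto simp: fd_space_def)
  then have "fd_space scale (span S \<inter> span X)"
    by (rule fd_space_subspace) (auto intro: subspace_inter)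
  then obtain B where B: "finite B" "B \<subseteq> span S \<inter> span X" "span B = span S \<inter> span X"
    by (auto simp: fd_space_def)
  have "\<exists>T. finite T \<and> T \<subseteq> S \<and> b \<in> span T" if "b \<in> span S" for b
    using that
  proof (induction rule: span_induct_alt)
    case base
    then show ?case by (auto intro!: exI[of _ "{}"])
  next
    case (step c x y)
    then obtain T where "finite T" "T \<subseteq> S" "y \<in> span T" by blast
    then have "scale c x + y \<in> span (insert x T)"
      by (intro span_add span_scale) (auto intro: span_base span_mono[THEN subsetD])
    then show ?case using \<open>finite T\<close> \<open>T \<subseteq> S\<close> step.hyps by (intro exI[of _ "insert x T"]) auto
  qed
  then obtain T where T: "\<And>b. b \<in> span S \<Longrightarrow> finite (T b) \<and> T b \<subseteq> S \<and> b \<in> span (T b)" by metis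
  show ?thesis
  proof (intro exI[of _ "\<Union>b\<in>B. T b"] conjI allI impI)
    show "finite (\<Union>b\<in>B. T b)" "(\<Union>b\<in>B. T b) \<subseteq> S" using T B(1,2) by blast+
    fix \<psi> assume "Vector_Spaces.linear scale (*) \<psi> \<and> (\<forall>r\<in>\<Union>b\<in>B. T b. \<psi> r = 0)"
    then have \<psi>: "Vector_Spaces.linear scale (*) \<psi>" and 0: "\<And>r. r \<in> (\<Union>b\<in>B. T b) \<Longrightarrow> \<psi> r = 0" by auto
    interpret \<psi>: Vector_Spaces.linear scale "(*)" \<psi> by fact
    have "\<psi> b = 0" if "b \<in> B" for b
      using \<psi>.eq_0_on_span[of "T b" b] 0 T B(2) that by blast
    then have \<psi>0: "\<psi> u = 0" if "u \<in> span S" "u \<in> span X" for u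
      using \<psi>.eq_0_on_span[of B u] that B(3) by blast
    obtain B1 where B1: "B1 \<subseteq> S" "independent B1" "S \<subseteq> span B1"
      using maximal_independent_subset by blast
    obtain B2 where B2: "B1 \<subseteq> B2" "B2 \<subseteq> B1 \<union> X" "independent B2" "B1 \<union> X \<subseteq> span B2"
      using maximal_independent_subset_extend[of B1 "B1 \<union> X"] B1(2) by blast
    \<comment> \<open>\<open>\<psi>'\<close> is 0 on a basis of \<open>span S\<close> and equals
      \<open>\<psi>\<close> on the elements of \<open>X\<close> that complete it. An element of
      \<open>X\<close> differs from a combination of the latter by a vector of
      \<open>span S \<inter> span X\<close>, where both functionals vanish.\<close>
    obtain \<psi>' where \<psi>': "Vector_Spaces.linear scale (*) \<psi>'" "\<forall>b\<in>B2. \<psi>' b = (if b \<in> B1 then 0 else \<psi> b)"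
      using p.linear_independent_extend[OF B2(3), of "\<lambda>b. if b \<in> B1 then 0 else \<psi> b"] by blast
    interpret \<psi>': Vector_Spaces.linear scale "(*)" \<psi>' by (rule \<psi>'(1))
    have "\<psi>' b = 0" if "b \<in> B1" for b using \<psi>'(2) B2(1) that by (metis subsetD)
    then have S0: "\<psi>' r = 0" if "r \<in> span B1" for r
      using \<psi>'.eq_0_on_span[of B1 r] that by blast
    have "\<psi>' u = \<psi> u" if u: "u \<in> X" for u
    proof -
      have "u \<in> span (B1 \<union> (B2 - B1))" using u B2(1,4) by (auto simp: Un_absorb1)
      then obtain w c where wc: "u = w + c" "w \<in> span B1" "c \<in> span (B2 - B1)"
        unfolding span_Un by blast
      have "w \<in> span S" using wc(2) B1(1) span_mono by blast
      moreover have c: "c \<in> span X" using wc(3) B2(2) span_mono[of "B2 - B1" X] by blast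
      then have "w \<in> span X" using span_diff[OF span_base[OF u] c] wc(1) by simp
      ultimately have "\<psi> w = 0" by (rule \<psi>0)
      moreover have "\<psi>' c = \<psi> c"
        by (rule p.linear_eq_on[OF \<psi>'(1) \<psi> wc(3)]) (use \<psi>'(2) in auto)
      ultimately show ?thesis using S0[OF wc(2)] by (simp add: wc(1) \<psi>.add \<psi>'.add)
    qed
    then show "\<exists>\<psi>'. Vector_Spaces.linear scale (*) \<psi>' \<and> (\<forall>r\<in>S. \<psi>' r = 0) \<and> (\<forall>u\<in>X. \<psi>' u = \<psi> u)"
      using \<psi>'(1) S0 B1(3) by blast
  qed
qed

lemma (in vector_space_pair) linear_map_on_eq:
  assumes "linear_map_on s1 s2 S T f" "linear_map_on s1 s2 S T' g" "vs1.subspace S" "B \<subseteq> S"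
      "S \<subseteq> vs1.span B"
    "\<And>b. b \<in> B \<Longrightarrow> f b = g b" "v \<in> S"
  shows "f v = g v"
proof -
  obtain f' where f': "Vector_Spaces.linear s1 s2 f'" "\<And>v. v \<in> S \<Longrightarrow> f' v = f v"
    using linear_map_on_extend[OF assms(1,3)] by blast
  obtain g' where g': "Vector_Spaces.linear s1 s2 g'" "\<And>v. v \<in> S \<Longrightarrow> g' v = g v"
    using linear_map_on_extend[OF assms(2,3)] by blast
  have "f' b = g' b" if "b \<in> B" for b
  proof -
    have "b \<in> S" using that assms(4) by blast
    then show ?thesis using f'(2) g'(2) assms(6)[OF that] by simp
  qed
  moreover have "v \<in> vs1.span B" using assms(5,7) by blast
  ultimately have "f' v = g' v" using linear_eq_on[OF f'(1) g'(1)] by blast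
  then show ?thesis using f'(2) g'(2) assms(7) by simp
qed

context slf_quiver
begin

text \<open>
  A family of linear maps is encoded by its matrix entries, that is by a functional on the space
  with basis the triples (vertex, row, column); compatibility with an arrow is then a set of linear
  conditions, so that finitely many of them determine what happens on \<open>D\<close>.
\<close>

lemma rep_hom_finite_determination:
  fixes s :: "'k::field \<Rightarrow> 'u::ab_group_add \<Rightarrow> 'u"
  assumes vs: "vector_space s" and N: "is_rep s Q N" and M: "is_rep s Q M" and D: "finite D"
      "D \<subseteq> verts Q"
  obtains A where "finite A" "A \<subseteq> arcs Q"
    "\<And>v. (\<And>x. x \<in> verts Q \<Longrightarrow> linear_map_on s s (spc N x) (spc M x) (v x)) \<Longrightarrow>
       (\<And>\<alpha> n. \<alpha> \<in> A \<Longrightarrow> n \<in> spc N (tail Q \<alpha>) \<Longrightarrow> v (head Q \<alpha>) (act N \<alpha> n) = act M \<alpha> (v (tail Q \<alpha>) n)) \<Longrightarrow>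
       \<exists>w. rep_hom s s Q N M w \<and> (\<forall>x\<in>D. \<forall>n\<in>spc N x. w x n = v x n)"
proof -
  interpret vs: vector_space s by fact
  interpret k: vector_space "(*) :: 'k \<Rightarrow> 'k \<Rightarrow> 'k" by (rule vector_space_mult)
  interpret V: vector_space "fun_scale (*) :: 'k \<Rightarrow> ('v \<times> 'u \<times> 'u \<Rightarrow> 'k) \<Rightarrow> _"
    by (intro vector_space_fun_scale vector_space_mult)
  interpret Vk: vector_space_pair "fun_scale (*) :: 'k \<Rightarrow> ('v \<times> 'u \<times> 'u \<Rightarrow> 'k) \<Rightarrow> _" "(*) :: 'k \<Rightarrow> 'k \<Rightarrow> 'k"
    by unfold_locales
  interpret ss: vector_space_pair s s by unfold_locales
  note lN = is_rep_lin_rep[OF N] and lM = is_rep_lin_rep[OF M]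
  have "\<exists>B. finite B \<and> B \<subseteq> spc R x \<and> vs.independent B \<and> vs.span B = spc R x"
    if "is_rep s Q R" "x \<in> verts Q" for R x
    using vs.fd_space_basis[OF is_repD[OF that]] by metis
  from this[OF N] this[OF M] obtain b c where
    b: "\<And>x. x \<in> verts Q \<Longrightarrow> finite (b x) \<and> b x \<subseteq> spc N x \<and> vs.independent (b x) \<and> vs.span (b x) = spc
        N x" and
    c: "\<And>x. x \<in> verts Q \<Longrightarrow> finite (c x) \<and> c x \<subseteq> spc M x \<and> vs.independent (c x) \<and> vs.span (c x) = spc M x"
    by metis
  define cN where "cN x = vs.representation (b x)" for x
  define cM where "cM x = vs.representation (c x)" for x
  have cN_sum: "(\<Sum>i\<in>b x. s (cN x n i) i) = n" if "x \<in> verts Q" "n \<in> spc N x" for x n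
    unfolding cN_def using vs.sum_representation_eq[of "b x" n "b x"] b[OF that(1)] that(2) by simp
  have cM_sum: "(\<Sum>i\<in>c x. s (cM x n i) i) = n" if "x \<in> verts Q" "n \<in> spc M x" for x n
    unfolding cM_def using vs.sum_representation_eq[of "c x" n "c x"] c[OF that(1)] that(2) by simp
  have cM_lin: "cM x (\<Sum>i\<in>I. s (r i) (m i)) j = (\<Sum>i\<in>I. r i * cM x (m i) j)"
    if x: "x \<in> verts Q" and m: "\<And>i. i \<in> I \<Longrightarrow> m i \<in> spc M x" for x I r m j
  proof -
    have mm: "m i \<in> vs.span (c x)" "s (r i) (m i) \<in> vs.span (c x)" if "i \<in> I" for i
      using m[OF that] c[OF x] by (auto intro: vs.subspace_scale lin_repD(1)[OF lM x])
    have "cM x (\<Sum>i\<in>I. s (r i) (m i)) j = (\<Sum>i\<in>I. cM x (s (r i) (m i)) j)"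
      unfolding cM_def using vs.representation_sum[of "c x" I "\<lambda>i. s (r i) (m i)"] c[OF x] mm(2) by simp
    also have "\<dots> = (\<Sum>i\<in>I. r i * cM x (m i) j)"
      unfolding cM_def using vs.representation_scale[of "c x"] c[OF x] mm(1) by (intro sum.cong) auto
    finally show ?thesis .
  qed
  define e where "e i = (\<lambda>j. if j = i then (1::'k) else 0)" for i :: "'v \<times> 'u \<times> 'u"
  have e_indep: "V.independent (range e)"
  proof
    assume "V.dependent (range e)"
    then obtain i where i: "e i \<in> V.span (range e - {e i})" by (auto simp: V.dependent_def)
    have "r i = 0" if "r \<in> V.span (range e - {e i})" for r
      using that by (induction rule: V.span_induct_alt) (auto simp: e_def fun_scale_def split:
          if_splits)
    from this[OF i] show False by (simp add: e_def)
  qed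
  have e_inj: "inj e" by (rule injI) (metis e_def one_neq_zero)
  \<comment> \<open>The coefficient at \<open>j\<close> of the difference between \<open>v\<close>
    after \<open>act N \<alpha>\<close> and \<open>act M \<alpha>\<close> after \<open>v\<close>,
    taken at the basis vector \<open>i\<close> and written as a combination of the unknown matrix
    entries \<open>e\<close>.\<close>
  define row where "row = (\<lambda>(\<alpha>, i, j).
      (\<Sum>i'\<in>b (head Q \<alpha>). fun_scale (*) (cN (head Q \<alpha>) (act N \<alpha> i) i') (e (head Q \<alpha>, i', j))) -
      (\<Sum>j'\<in>c (tail Q \<alpha>). fun_scale (*) (cM (head Q \<alpha>) (act M \<alpha> j') j) (e (tail Q \<alpha>, i, j'))))"
  have row: "\<psi> (row (\<alpha>, i, j)) =
      (\<Sum>i'\<in>b (head Q \<alpha>). cN (head Q \<alpha>) (act N \<alpha> i) i' * \<psi> (e (head Q \<alpha>, i', j))) -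
      (\<Sum>j'\<in>c (tail Q \<alpha>). \<psi> (e (tail Q \<alpha>, i, j')) * cM (head Q \<alpha>) (act M \<alpha> j') j)"
    if "Vector_Spaces.linear (fun_scale (*)) (*) \<psi>" for \<psi> \<alpha> i j
  proof -
    interpret \<psi>: Vector_Spaces.linear "fun_scale (*)" "(*)" \<psi> by fact
    show ?thesis by (simp add: row_def \<psi>.diff \<psi>.sum \<psi>.scale mult.commute)
  qed
  define I where "I = (SIGMA \<alpha>:arcs Q. b (tail Q \<alpha>) \<times> c (head Q \<alpha>))"
  define X where "X = e ` (SIGMA x:D. b x \<times> c x)"
  have X: "finite X" unfolding X_def using D b c by (intro finite_imageI finite_SigmaI) auto
  from V.finite_conditions_extension[where S = "row ` I", OF X]
  obtain T where T: "T \<subseteq> row ` I" "finite T"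
    "\<forall>\<psi>. Vector_Spaces.linear (fun_scale (*)) (*) \<psi> \<and> (\<forall>r\<in>T. \<psi> r = 0) \<longrightarrow>
       (\<exists>\<psi>'. Vector_Spaces.linear (fun_scale (*)) (*) \<psi>' \<and> (\<forall>r\<in>row ` I. \<psi>' r = 0) \<and> (\<forall>u\<in>X. \<psi>' u = \<psi> u))"
    by (elim exE conjE) (rule that)
  obtain J where J: "finite J" "J \<subseteq> I" "T = row ` J"
    using finite_subset_image[OF T(2,1)] by blast
  show ?thesis
  proof (rule that[of "fst ` J"])
    show "finite (fst ` J)" using J by simp
    show "fst ` J \<subseteq> arcs Q" using J by (auto simp: I_def)
    fix v assume v: "\<And>x. x \<in> verts Q \<Longrightarrow> linear_map_on s s (spc N x) (spc M x) (v x)"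
      and comm: "\<And>\<alpha> n. \<alpha> \<in> fst ` J \<Longrightarrow> n \<in> spc N (tail Q \<alpha>) \<Longrightarrow>
        v (head Q \<alpha>) (act N \<alpha> n) = act M \<alpha> (v (tail Q \<alpha>) n)"
    \<comment> \<open>The functional that assigns to each basis vector the corresponding matrix
      entry of \<open>v\<close>. Values are prescribed on vectors, so \<open>inv e\<close> recovers
      the index.\<close>
    obtain \<psi> where \<psi>: "Vector_Spaces.linear (fun_scale (*)) (*) \<psi>"
      and "\<forall>u\<in>range e. \<psi> u = (\<lambda>(x, i, j). cM x (v x i) j) (inv e u)"
      using Vk.linear_independent_extend[OF e_indep, of "\<lambda>u. (\<lambda>(x, i, j). cM x (v x i) j) (inv e
          u)"] by blast
    then have \<psi>e: "\<psi> (e (x, i, j)) = cM x (v x i) j" for x i j using inv_f_f[OF e_inj] by simp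
    have "\<psi> r = 0" if rT: "r \<in> T" for r
    proof -
      obtain \<alpha> i j where r: "(\<alpha>, i, j) \<in> J" "r = row (\<alpha>, i, j)" using rT J(3) by auto
      let ?x = "tail Q \<alpha>" and ?y = "head Q \<alpha>"
      have \<alpha>: "\<alpha> \<in> arcs Q" "\<alpha> \<in> fst ` J" and i: "i \<in> b ?x" using r(1) J(2)
          by (auto simp: I_def rev_image_eqI)
      have x: "?x \<in> verts Q" and y: "?y \<in> verts Q" using \<alpha> by auto
      have iN: "i \<in> spc N ?x" using i b[OF x] by blast
      have aN: "act N \<alpha> i \<in> spc N ?y" using lin_repD(3)[OF lN \<alpha>(1) iN] .
      have bN: "i' \<in> spc N ?y" if "i' \<in> b ?y" for i' using that b[OF y] by blast
      have cMx: "j' \<in> spc M ?x" if "j' \<in> c ?x" for j' using that c[OF x] by blast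
      have "(\<Sum>i'\<in>b ?y. cN ?y (act N \<alpha> i) i' * \<psi> (e (?y, i', j))) = cM ?y (\<Sum>i'\<in>b ?y. s (cN ?y (act N
          \<alpha> i) i') (v ?y i')) j"
        using cM_lin[OF y, of "b ?y" "v ?y"] linear_map_onD(1)[OF v[OF y] bN] by (simp add: \<psi>e)
      also have "(\<Sum>i'\<in>b ?y. s (cN ?y (act N \<alpha> i) i') (v ?y i')) = v ?y (\<Sum>i'\<in>b ?y. s (cN ?y (act N \<alpha>
          i) i') i')"
        using ss.linear_map_on_sum[OF v[OF y] lin_repD(1)[OF lN y], of "b ?y"
            "\<lambda>i'. s (cN ?y (act N \<alpha> i) i') i'"]
          bN vs.subspace_scale[OF lin_repD(1)[OF lN y]] linear_map_onD(3)[OF v[OF y] bN] by simp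
      also have "\<dots> = act M \<alpha> (v ?x i)" using cN_sum[OF y aN] comm[OF \<alpha>(2) iN] by simp
      finally have 1: "(\<Sum>i'\<in>b ?y. cN ?y (act N \<alpha> i) i' * \<psi> (e (?y, i', j))) = cM ?y (act M \<alpha> (v ?x
          i)) j" .
      have vM: "v ?x i \<in> spc M ?x" using linear_map_onD(1)[OF v[OF x] iN] .
      have "(\<Sum>j'\<in>c ?x. \<psi> (e (?x, i, j')) * cM ?y (act M \<alpha> j') j) =
          cM ?y (\<Sum>j'\<in>c ?x. s (cM ?x (v ?x i) j') (act M \<alpha> j')) j"
        using cM_lin[OF y, of "c ?x" "act M \<alpha>"] lin_repD(3)[OF lM \<alpha>(1) cMx] by (simp add: \<psi>e)
      also have "(\<Sum>j'\<in>c ?x. s (cM ?x (v ?x i) j') (act M \<alpha> j')) = act M \<alpha> (\<Sum>j'\<in>c ?x. s (cM ?x (v ?x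
          i) j') j')"
        using ss.linear_map_on_sum[OF lin_repD(2)[OF lM \<alpha>(1)] lin_repD(1)[OF lM x], of "c ?x"
            "\<lambda>j'. s (cM ?x (v ?x i) j') j'"]
          cMx vs.subspace_scale[OF lin_repD(1)[OF lM x]]
              linear_map_onD(3)[OF lin_repD(2)[OF lM \<alpha>(1)] cMx] by simp
      also have "\<dots> = act M \<alpha> (v ?x i)" using cM_sum[OF x vM] by simp
      finally show ?thesis using 1 by (simp add: r(2) row[OF \<psi>])
    qed
    with \<psi> have "Vector_Spaces.linear (fun_scale (*)) (*) \<psi> \<and> (\<forall>r\<in>T. \<psi> r = 0)" by simp
    from T(3)[THEN spec, THEN mp, OF this]
    obtain \<psi>' where \<psi>'_lin: "Vector_Spaces.linear (fun_scale (*)) (*) \<psi>'"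
      and \<psi>'_row: "\<forall>r\<in>row ` I. \<psi>' r = 0" and \<psi>'_X: "\<forall>u\<in>X. \<psi>' u = \<psi> u"
      by (elim exE conjE) (rule that)
    define w where "w x n = (\<Sum>i\<in>b x. s (cN x n i) (\<Sum>j\<in>c x. s (\<psi>' (e (x, i, j))) j))" for x n
    have wl: "linear_map_on s s (spc N x) (spc M x) (w x)" if x: "x \<in> verts Q" for x
    proof (rule linear_map_onI)
      fix u assume u: "u \<in> spc N x"
      show "w x u \<in> spc M x" unfolding w_def
        by (intro vs.subspace_sum vs.subspace_scale lin_repD(1)[OF lM x]) (use c[OF x] in auto)
      show "w x (s r u) = s r (w x u)" for r
        using vs.representation_scale[of "b x"] b[OF x] u by (simp add: w_def cN_def vs.scale_sum_right)
      fix v assume "v \<in> spc N x"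
      then show "w x (u + v) = w x u + w x v"
        using vs.representation_add[of "b x"] b[OF x] u
        by (simp add: w_def cN_def vs.scale_left_distrib sum.distrib)
    qed
    have w_basis: "w x i = (\<Sum>j\<in>c x. s (\<psi>' (e (x, i, j))) j)" if x: "x \<in> verts Q" and i: "i \<in> b x"
        for x i
    proof -
      have "w x i = (\<Sum>i'\<in>b x. if i' = i then \<Sum>j\<in>c x. s (\<psi>' (e (x, i, j))) j else 0)"
        unfolding w_def cN_def using vs.representation_basis[of "b x" i] b[OF x] i
            by (intro sum.cong) auto
      then show ?thesis using i b[OF x] by simp
    qed
    have "rep_hom s s Q N M w"
    proof (rule rep_homI[OF wl])
      fix \<alpha> n assume \<alpha>: "\<alpha> \<in> arcs Q" and n: "n \<in> spc N (tail Q \<alpha>)"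
      let ?x = "tail Q \<alpha>" and ?y = "head Q \<alpha>"
      have x: "?x \<in> verts Q" and y: "?y \<in> verts Q" using \<alpha> by auto
      have basis: "w ?y (act N \<alpha> i) = act M \<alpha> (w ?x i)" if i: "i \<in> b ?x" for i
      proof -
        have cMx: "j' \<in> spc M ?x" if "j' \<in> c ?x" for j' using that c[OF x] by blast
        note aM = lin_repD(3)[OF lM \<alpha> cMx]
        have eq: "(\<Sum>i'\<in>b ?y. cN ?y (act N \<alpha> i) i' * \<psi>' (e (?y, i', j))) =
            (\<Sum>j'\<in>c ?x. \<psi>' (e (?x, i, j')) * cM ?y (act M \<alpha> j') j)" if "j \<in> c ?y" for j
          using bspec[OF \<psi>'_row, of "row (\<alpha>, i, j)"] \<alpha> i that row[OF \<psi>'_lin, of \<alpha> i j]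
              by (simp add: I_def)
        have "w ?y (act N \<alpha> i) = (\<Sum>j\<in>c ?y. s (\<Sum>i'\<in>b ?y. cN ?y (act N \<alpha> i) i' * \<psi>' (e (?y, i', j))) j)"
          unfolding w_def vs.scale_sum_right vs.scale_sum_left by (subst sum.swap) simp
        also have "\<dots> = (\<Sum>j\<in>c ?y. s (\<Sum>j'\<in>c ?x. \<psi>' (e (?x, i, j')) * cM ?y (act M \<alpha> j') j) j)"
          using eq by (intro sum.cong) auto
        also have "\<dots> = (\<Sum>j'\<in>c ?x. s (\<psi>' (e (?x, i, j'))) (\<Sum>j\<in>c ?y. s (cM ?y (act M \<alpha> j') j) j))"
          unfolding vs.scale_sum_right vs.scale_sum_left by (subst sum.swap) simp
        also have "\<dots> = (\<Sum>j'\<in>c ?x. s (\<psi>' (e (?x, i, j'))) (act M \<alpha> j'))"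
          using cM_sum[OF y aM] by (intro sum.cong) auto
        also have "\<dots> = act M \<alpha> (\<Sum>j'\<in>c ?x. s (\<psi>' (e (?x, i, j'))) j')"
          using ss.linear_map_on_sum[OF lin_repD(2)[OF lM \<alpha>] lin_repD(1)[OF lM x], of "c ?x"
              "\<lambda>j'. s (\<psi>' (e (?x, i, j'))) j'"]
            cMx vs.subspace_scale[OF lin_repD(1)[OF lM x]] linear_map_onD(3)[OF lin_repD(2)[OF lM \<alpha>]
                cMx] by simp
        finally show ?thesis using w_basis[OF x i] by simp
      qed
      show "w ?y (act N \<alpha> n) = act M \<alpha> (w ?x n)"
        using ss.linear_map_on_eq[OF linear_map_on_comp[OF lin_repD(2)[OF lN \<alpha>] wl[OF y]]
            linear_map_on_comp[OF wl[OF x] lin_repD(2)[OF lM \<alpha>]] lin_repD(1)[OF lN x] _ _ basis n]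
                b[OF x] by auto
    qed
    moreover have "w x n = v x n" if "x \<in> D" and n: "n \<in> spc N x" for x n
    proof -
      have x: "x \<in> verts Q" using that D by blast
      have "w x i = v x i" if i: "i \<in> b x" for i
      proof -
        have "w x i = (\<Sum>j\<in>c x. s (cM x (v x i) j) j)"
          unfolding w_basis[OF x i] using \<psi>'_X i \<open>x \<in> D\<close> by (intro sum.cong) (auto simp: X_def \<psi>e)
        moreover have "v x i \<in> spc M x" using linear_map_onD(1)[OF v[OF x]] i b[OF x] by blast
        ultimately show ?thesis using cM_sum[OF x] by simp
      qed
      then show ?thesis using ss.linear_map_on_eq[OF wl[OF x] v[OF x] lin_repD(1)[OF lN x] _ _ _ n]
          b[OF x] by auto
    qed
    ultimately show "\<exists>w. rep_hom s s Q N M w \<and> (\<forall>x\<in>D. \<forall>n\<in>spc N x. w x n = v x n)" by blast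
  qed
qed

text \<open>Irreducibility is tested only on representations in the ambient space of M and N, while
  a pullback lives in a product. Every space of \<open>Y\<close> is finite dimensional and so embeds
  in an infinite-dimensional ambient space. The embeddings at different vertices are independent,
  and their images may overlap.\<close>

lemma rep_transport:
  fixes s :: "'k::field \<Rightarrow> 'u::ab_group_add \<Rightarrow> 'u" and t :: "'k \<Rightarrow> 'w::ab_group_add \<Rightarrow> 'w"
  assumes vs: "vector_space s" and inf: "\<nexists>B. finite B \<and> module.span s B = UNIV"
    and vt: "vector_space t" and Y: "is_rep t Q Y"
  obtains Y' \<phi> where "is_rep s Q Y'" "rep_hom t s Q Y Y' \<phi>"
    "\<And>x. x \<in> verts Q \<Longrightarrow> bij_betw (\<phi> x) (spc Y x) (spc Y' x)"
proof -
  interpret ts: vector_space_pair t s using vs vt by (simp add: vector_space_pair_def)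
  note lY = is_rep_lin_rep[OF Y]
  obtain B where B: "ts.vs2.independent B" "UNIV \<subseteq> ts.vs2.span B"
    using ts.vs2.maximal_independent_subset[of UNIV] by blast
  then have infB: "infinite B" using inf by blast
  have "\<exists>g. Vector_Spaces.linear t s g \<and> inj_on g (spc Y x)" if x: "x \<in> verts Q" for x
  proof -
    obtain C where C: "finite C" "C \<subseteq> spc Y x" "ts.vs1.independent C" "ts.vs1.span C = spc Y x"
      using ts.vs1.fd_space_basis[OF is_repD[OF Y x]] .
    obtain C' where C': "C' \<subseteq> B" "finite C'" "card C' = card C"
      using infinite_arbitrarily_large[OF infB] by blast
    obtain h where h: "bij_betw h C C'" using finite_same_card_bij[OF C(1) C'(2)] C'(3) by auto
    obtain g where g: "Vector_Spaces.linear t s g" "\<forall>c\<in>C. g c = h c"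
      using ts.linear_independent_extend[OF C(3)] by blast
    interpret g: Vector_Spaces.linear t s g by (rule g(1))
    have "g ` C = C'" "inj_on g C" using g(2) h by (auto simp: bij_betw_def inj_on_def)
    then have "inj_on g (ts.vs1.span C)"
      using g.inj_on_span_independent_image[of C] ts.vs2.independent_mono[OF B(1) C'(1)] by simp
    then show ?thesis using g(1) C(4) by auto
  qed
  then obtain \<phi> where \<phi>: "\<And>x. x \<in> verts Q \<Longrightarrow> Vector_Spaces.linear t s (\<phi> x)"
    "\<And>x. x \<in> verts Q \<Longrightarrow> inj_on (\<phi> x) (spc Y x)" by metis
  define Y' :: "('v, 'a, 'u) rep" where "Y' = \<lparr>spc = (\<lambda>x. \<phi> x ` spc Y x),
    act = (\<lambda>\<alpha> u. \<phi> (head Q \<alpha>) (act Y \<alpha> (the_inv_into (spc Y (tail Q \<alpha>)) (\<phi> (tail Q \<alpha>)) u)))\<rparr>"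
  have l: "linear_map_on t s (spc Y x) (spc Y' x) (\<phi> x)" if "x \<in> verts Q" for x
    using ts.linear_map_on_linear[OF \<phi>(1)[OF that]] by (simp add: Y'_def)
  have bij: "bij_betw (\<phi> x) (spc Y x) (spc Y' x)" if "x \<in> verts Q" for x
    using \<phi>(2)[OF that] by (simp add: bij_betw_def Y'_def)
  have "is_rep s Q Y'"
    unfolding is_rep_def
  proof (intro conjI ballI)
    fix x assume x: "x \<in> verts Q"
    show "fd_space s (spc Y' x)"
      using ts.fd_space_image[OF l[OF x] is_repD[OF Y x]] by (simp add: Y'_def)
  next
    fix \<alpha> assume \<alpha>: "\<alpha> \<in> arcs Q"
    have x: "tail Q \<alpha> \<in> verts Q" and y: "head Q \<alpha> \<in> verts Q" using \<alpha> by auto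
    show "linear_map_on s s (spc Y' (tail Q \<alpha>)) (spc Y' (head Q \<alpha>)) (act Y' \<alpha>)"
      using linear_map_on_comp[OF linear_map_on_comp[OF ts.linear_map_on_inverse[OF l[OF x]
          lin_repD(1)[OF lY x] bij[OF x]]
          lin_repD(2)[OF lY \<alpha>]] l[OF y]] by (simp add: Y'_def)
  qed
  moreover have "rep_hom t s Q Y Y' \<phi>"
  proof (rule rep_homI[OF l])
    fix \<alpha> v assume "\<alpha> \<in> arcs Q" "v \<in> spc Y (tail Q \<alpha>)"
    then show "\<phi> (head Q \<alpha>) (act Y \<alpha> v) = act Y' \<alpha> (\<phi> (tail Q \<alpha>) v)"
      using the_inv_into_f_f[OF \<phi>(2)] by (simp add: Y'_def)
  qed
  ultimately show ?thesis using that bij by blast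
qed

section \<open>Fitting's lemma for endomorphisms of a representation\<close>

lemma rep_hom_funpow: "lin_rep s Q M \<Longrightarrow> rep_hom s s Q M M \<theta> \<Longrightarrow> rep_hom s s Q M M (\<lambda>x. \<theta> x ^^ n)"
proof (induction n)
  case 0 then show ?case using rep_hom_id by (simp add: id_def)
next
  case (Suc n)
  from rep_hom_comp[OF Suc.IH[OF Suc.prems] Suc.prems(2)] show ?case by (simp add: comp_def)
qed

text \<open>The kernels of the powers increase and the images decrease inside a finite-dimensional
  space, so both become stationary, from a common \<open>n\<close> on. The first two conclusions
  describe the stable kernel and image without mention of \<open>n\<close>: when \<open>n\<close>
  varies with the vertex, the two families must still be closed under the arrows.\<close>

lemma fitting_decomposition:
  fixes s :: "'k::field \<Rightarrow> 'u::ab_group_add \<Rightarrow> 'u"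
  assumes "vector_space s" "fd_space s S" "linear_map_on s s S S \<theta>"
  obtains n where "{v \<in> S. \<exists>m. (\<theta> ^^ m) v = 0} = {v \<in> S. (\<theta> ^^ n) v = 0}"
    "(\<Inter>m. (\<theta> ^^ m) ` S) = (\<theta> ^^ n) ` S"
    "\<And>v. v \<in> S \<Longrightarrow> (\<theta> ^^ n) v = 0 \<Longrightarrow> v \<in> (\<theta> ^^ n) ` S \<Longrightarrow> v = 0"
    "\<And>v. v \<in> S \<Longrightarrow> \<exists>a\<in>S. \<exists>b\<in>(\<theta> ^^ n) ` S. (\<theta> ^^ n) a = 0 \<and> v = a + b"
proof -
  interpret vs: vector_space s by fact
  interpret p: vector_space_pair s s by unfold_locales
  have sub: "vs.subspace S" using assms(2) by (rule fd_spaceD)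
  have lin: "linear_map_on s s S S (\<theta> ^^ n)" for n
  proof (induction n)
    case 0 show ?case by (auto intro: linear_map_onI)
  next
    case (Suc n) from linear_map_on_comp[OF this assms(3)] show ?case by (simp add: comp_def)
  qed
  define K where "K n = {v \<in> S. (\<theta> ^^ n) v = 0}" for n
  define I where "I n = (\<theta> ^^ n) ` S" for n
  have Ksub: "vs.subspace (K n)" and Isub: "vs.subspace (I n)" and IS: "I n \<subseteq> S" and KS: "K n \<subseteq> S" for n
    using p.subspace_kernel_on[OF lin sub] p.subspace_image_on[OF lin sub] linear_map_onD(1)[OF lin]
    by (auto simp: K_def I_def)
  have Imono: "I (n + j) \<subseteq> I n" for n j
    using linear_map_onD(1)[OF lin] by (force simp: I_def funpow_add)
  have Kmono: "K n \<subseteq> K (n + j)" for n j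
  proof
    fix v assume v: "v \<in> K n"
    then have "(\<theta> ^^ (j + n)) v = (\<theta> ^^ j) 0" by (simp add: K_def funpow_add)
    then show "v \<in> K (n + j)" using v p.linear_map_on_zero[OF lin sub] by (simp add: K_def add.commute)
  qed
  obtain n1 where n1: "\<And>m. vs.dim (I n1) \<le> vs.dim (I m)"
    using ex_has_least_nat[of "\<lambda>_. True" 0 "\<lambda>m. vs.dim (I m)"] by auto
  obtain n2 where n2: "\<And>m. vs.dim S - vs.dim (K n2) \<le> vs.dim S - vs.dim (K m)"
    using ex_has_least_nat[of "\<lambda>_. True" 0 "\<lambda>m. vs.dim S - vs.dim (K m)"] by auto
  have I1: "I (n1 + j) = I n1" for j
    using vs.fd_space_dim_less[OF vs.fd_space_subspace[OF assms(2) Isub IS] Isub, of "n1 + j" n1]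
        Imono[of n1 j] n1[of "n1 + j"]
    by (auto simp: psubset_eq)
  have K2: "K (n2 + j) = K n2" for j
  proof (rule ccontr)
    assume "K (n2 + j) \<noteq> K n2"
    then have "vs.dim (K n2) < vs.dim (K (n2 + j))"
      using vs.fd_space_dim_less[OF vs.fd_space_subspace[OF assms(2) Ksub KS] Ksub] Kmono[of n2 j]
          by (auto simp: psubset_eq)
    moreover have "vs.dim (K (n2 + j)) \<le> vs.dim S" using vs.fd_space_dim_le[OF assms(2) KS] .
    ultimately show False using n2[of "n2 + j"] by simp
  qed
  define n where "n = n1 + n2"
  have I: "I (n + j) = I n" for j using I1[of "n2 + j"] I1[of n2] by (simp add: n_def add.assoc)
  have K: "K (n + j) = K n" for j using K2[of "n1 + j"] K2[of n1] by (simp add: n_def ac_simps)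
  have Kle: "K m \<subseteq> K n" and Ile: "I n \<subseteq> I m" for m
  proof -
    show "K m \<subseteq> K n" using Kmono[of m n] K[of m] by (simp add: add.commute)
    show "I n \<subseteq> I m" using Imono[of m n] I[of m] by (simp add: add.commute)
  qed
  show ?thesis
  proof (rule that[of n])
    show "{v \<in> S. \<exists>m. (\<theta> ^^ m) v = 0} = {v \<in> S. (\<theta> ^^ n) v = 0}" using Kle unfolding K_def by blast
    show "(\<Inter>m. (\<theta> ^^ m) ` S) = (\<theta> ^^ n) ` S" using Ile unfolding I_def by blast
    fix v assume v: "v \<in> S"
    show "v = 0" if 0: "(\<theta> ^^ n) v = 0" and im: "v \<in> (\<theta> ^^ n) ` S"
    proof -
      obtain u where u: "u \<in> S" "v = (\<theta> ^^ n) u" using im by auto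
      then have "u \<in> K (n + n)" using 0 by (simp add: K_def funpow_add)
      then have "u \<in> K n" using K[of n] by simp
      then show ?thesis using u by (simp add: K_def)
    qed
    \<comment> \<open>The images are stationary from \<open>n\<close> on, so the power
      \<open>n\<close> of \<open>\<theta>\<close> at \<open>v\<close> is the power
      \<open>n + n\<close> at some \<open>u\<close>. The power \<open>n\<close> at \<open>u\<close>
      is then the image part of \<open>v\<close>, and the rest of \<open>v\<close> is
      killed.\<close>
    have "(\<theta> ^^ n) v \<in> I (n + n)" using v I[of n] by (auto simp: I_def)
    then obtain u where u: "u \<in> S" "(\<theta> ^^ n) v = (\<theta> ^^ n) ((\<theta> ^^ n) u)" by (auto simp: I_def funpow_add)
    let ?b = "(\<theta> ^^ n) u"
    have b: "?b \<in> S" using linear_map_onD(1)[OF lin u(1)] .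
    have "(\<theta> ^^ n) (v - ?b) = 0" using p.linear_map_on_diff[OF lin sub v b] u(2) by simp
    then show "\<exists>a\<in>S. \<exists>b\<in>(\<theta> ^^ n) ` S. (\<theta> ^^ n) a = 0 \<and> v = a + b"
      using vs.subspace_diff[OF sub v b] u(1) by (intro bexI[of _ "v - ?b"] bexI[of _ ?b]) auto
  qed
qed

text \<open>A nonzero fixed vector lies in the image of every power, so the stable image
  \<open>Y\<close> is nonzero. As \<open>M\<close> is the direct sum of the stable kernel
  \<open>X\<close> and \<open>Y\<close>, indecomposability gives \<open>X = 0\<close>, and
  \<open>\<theta>\<close> is bijective at every vertex.\<close>

lemma indecomposable_endo_bij:
  fixes s :: "'k::field \<Rightarrow> 'u::ab_group_add \<Rightarrow> 'u"
  assumes vs: "vector_space s" and M: "indecomposable s Q M" and \<theta>: "rep_hom s s Q M M \<theta>"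
    and v: "x0 \<in> verts Q" "v \<in> spc M x0" "v \<noteq> 0" "\<theta> x0 v = v" and x: "x \<in> verts Q"
  shows "bij_betw (\<theta> x) (spc M x) (spc M x)"
proof -
  interpret vs: vector_space s by fact
  interpret p: vector_space_pair s s by unfold_locales
  have rM: "is_rep s Q M" using M by (simp add: indecomposable_def)
  note lM = is_rep_lin_rep[OF rM]
  define X :: "('v, 'a, 'u) rep" where "X = \<lparr>spc = (\<lambda>x. {v \<in> spc M x. \<exists>m. (\<theta> x ^^ m) v = 0}), act =
      act M\<rparr>"
  define Y :: "('v, 'a, 'u) rep" where "Y = \<lparr>spc = (\<lambda>x. \<Inter>m. (\<theta> x ^^ m) ` spc M x), act = act M\<rparr>"
  note pow = rep_hom_funpow[OF lM \<theta>]
  have fit: "\<exists>n. spc X x = {v \<in> spc M x. (\<theta> x ^^ n) v = 0} \<and> spc Y x = (\<theta> x ^^ n) ` spc M x \<and>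
      (\<forall>v \<in> spc X x \<inter> spc Y x. v = 0) \<and> (\<forall>v\<in>spc M x. \<exists>a\<in>spc X x. \<exists>b\<in>spc Y x. v = a + b)"
    if x: "x \<in> verts Q" for x
  proof -
    obtain n where n: "{v \<in> spc M x. \<exists>m. (\<theta> x ^^ m) v = 0} = {v \<in> spc M x. (\<theta> x ^^ n) v = 0}"
      "(\<Inter>m. (\<theta> x ^^ m) ` spc M x) = (\<theta> x ^^ n) ` spc M x"
      "\<And>v. v \<in> spc M x \<Longrightarrow> (\<theta> x ^^ n) v = 0 \<Longrightarrow> v \<in> (\<theta> x ^^ n) ` spc M x \<Longrightarrow> v = 0"
      "\<And>v. v \<in> spc M x \<Longrightarrow> \<exists>a\<in>spc M x. \<exists>b\<in>(\<theta> x ^^ n) ` spc M x. (\<theta> x ^^ n) a = 0 \<and> v = a + b"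
      by (rule fitting_decomposition[OF vs is_repD[OF rM x] rep_homD(1)[OF \<theta> x]]) (rule that)
    have X: "spc X x = {v \<in> spc M x. (\<theta> x ^^ n) v = 0}" and Y: "spc Y x = (\<theta> x ^^ n) ` spc M x"
      using n(1,2) by (simp_all add: X_def Y_def)
    have "\<exists>a\<in>spc X x. \<exists>b\<in>spc Y x. v = a + b" if v: "v \<in> spc M x" for v
    proof -
      obtain a b where "a \<in> spc M x" "b \<in> (\<theta> x ^^ n) ` spc M x" "(\<theta> x ^^ n) a = 0" "v = a + b"
        using n(4)[OF v] by metis
      then show ?thesis unfolding X Y by auto
    qed
    moreover have "v = 0" if "v \<in> spc X x \<inter> spc Y x" for v
      using n(3)[of v] that unfolding X Y by auto
    ultimately show ?thesis using X Y by blast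
  qed
  have fit_sum: "\<exists>a\<in>spc X x. \<exists>b\<in>spc Y x. w = a + b" if "x \<in> verts Q" "w \<in> spc M x" for x w
    using fit[OF that(1)] that(2) by blast
  have fit_Int: "w = 0" if "x \<in> verts Q" "w \<in> spc X x" "w \<in> spc Y x" for x w
    using fit[OF that(1)] that(2,3) by blast
  have XM: "spc X x \<subseteq> spc M x" for x by (auto simp: X_def)
  have YM: "spc Y x \<subseteq> spc M x" for x unfolding Y_def using image_eqI[of _ "\<theta> x ^^ 0"]
      by (auto dest: INT_D[of _ _ _ 0])
  have fd: "fd_space s (spc X x)" "fd_space s (spc Y x)" if x: "x \<in> verts Q" for x
  proof -
    obtain n where n: "spc X x = {v \<in> spc M x. (\<theta> x ^^ n) v = 0}" "spc Y x = (\<theta> x ^^ n) ` spc M x"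
      using fit[OF x] by blast
    note l = rep_homD(1)[OF pow x, of n] and sub = lin_repD(1)[OF lM x]
    show "fd_space s (spc X x)"
      using vs.fd_space_subspace[OF is_repD[OF rM x] p.subspace_kernel_on[OF l sub]] n(1) XM[of x]
          by simp
    show "fd_space s (spc Y x)"
      using vs.fd_space_subspace[OF is_repD[OF rM x] p.subspace_image_on[OF l sub]] n(2) YM[of x]
          by simp
  qed
  have actXY: "act M \<alpha> ` spc X (tail Q \<alpha>) \<subseteq> spc X (head Q \<alpha>)"
      "act M \<alpha> ` spc Y (tail Q \<alpha>) \<subseteq> spc Y (head Q \<alpha>)"
    if \<alpha>: "\<alpha> \<in> arcs Q" for \<alpha>
  proof -
    have 0: "act M \<alpha> 0 = 0" using p.linear_map_on_zero[OF lin_repD(2)[OF lM \<alpha>] lin_repD(1)[OF lM]] \<alpha>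
        by simp
    show "act M \<alpha> ` spc X (tail Q \<alpha>) \<subseteq> spc X (head Q \<alpha>)"
    proof
      fix u assume "u \<in> act M \<alpha> ` spc X (tail Q \<alpha>)"
      then obtain v m where v: "v \<in> spc M (tail Q \<alpha>)" "(\<theta> (tail Q \<alpha>) ^^ m) v = 0" "u = act M \<alpha> v"
          by (auto simp: X_def)
      then have "(\<theta> (head Q \<alpha>) ^^ m) u = 0" using rep_homD(2)[OF pow \<alpha> v(1)] 0 by simp
      then show "u \<in> spc X (head Q \<alpha>)" using lin_repD(3)[OF lM \<alpha> v(1)] v(3) by (auto simp: X_def)
    qed
    show "act M \<alpha> ` spc Y (tail Q \<alpha>) \<subseteq> spc Y (head Q \<alpha>)"
    proof
      fix u assume "u \<in> act M \<alpha> ` spc Y (tail Q \<alpha>)"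
      then obtain v where v: "v \<in> spc Y (tail Q \<alpha>)" "u = act M \<alpha> v" by auto
      have "u \<in> (\<theta> (head Q \<alpha>) ^^ m) ` spc M (head Q \<alpha>)" for m
      proof -
        obtain w where w: "w \<in> spc M (tail Q \<alpha>)" "v = (\<theta> (tail Q \<alpha>) ^^ m) w" using v(1)
            by (auto simp: Y_def)
        then show ?thesis using rep_homD(2)[OF pow \<alpha> w(1), of m] v(2) lin_repD(3)[OF lM \<alpha> w(1)]
            by (metis imageI)
      qed
      then show "u \<in> spc Y (head Q \<alpha>)" by (auto simp: Y_def)
    qed
  qed
  have rX: "is_rep s Q X"
    unfolding is_rep_def using fd(1) linear_map_on_mono[OF lin_repD(2)[OF lM] XM actXY(1)]
        by (simp add: X_def)
  have rY: "is_rep s Q Y"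
    unfolding is_rep_def using fd(2) linear_map_on_mono[OF lin_repD(2)[OF lM] YM actXY(2)]
        by (simp add: Y_def)
  have vp: "vector_space (prod_scale s s)" using vs vs by (rule vector_space_prod_scale)
  interpret pp: vector_space_pair "prod_scale s s" s using vp vs by (simp add: vector_space_pair_def)
  have lXY: "lin_rep (prod_scale s s) Q (rep_sum2 X Y)"
    unfolding lin_rep_def
  proof (intro conjI ballI)
    fix x assume x: "x \<in> verts Q"
    note sX = lin_repD(1)[OF is_rep_lin_rep[OF rX] x] and sY = lin_repD(1)[OF is_rep_lin_rep[OF rY] x]
    show "pp.vs1.subspace (spc (rep_sum2 X Y) x)"
      by (rule pp.vs1.subspaceI)
        (auto simp: rep_sum2_def prod_scale_def zero_prod_def intro: vs.subspace_0[OF sX]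
            vs.subspace_0[OF sY]
          vs.subspace_add[OF sX] vs.subspace_add[OF sY] vs.subspace_scale[OF sX]
              vs.subspace_scale[OF sY])
  next
    fix \<alpha> assume \<alpha>: "\<alpha> \<in> arcs Q"
    note lX = linear_map_onD[OF lin_repD(2)[OF is_rep_lin_rep[OF rX] \<alpha>]]
      and lY = linear_map_onD[OF lin_repD(2)[OF is_rep_lin_rep[OF rY] \<alpha>]]
    show "linear_map_on (prod_scale s s) (prod_scale s s) (spc (rep_sum2 X Y) (tail Q \<alpha>))
        (spc (rep_sum2 X Y) (head Q \<alpha>)) (act (rep_sum2 X Y) \<alpha>)"
      by (rule linear_map_onI) (auto simp: rep_sum2_def prod_scale_def lX(2,3) lY(2,3) intro: lX(1)
          lY(1))
  qed
  define \<sigma> :: "'v \<Rightarrow> 'u \<times> 'u \<Rightarrow> 'u" where "\<sigma> x = (\<lambda>(a, b). a + b)" for x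
  have \<sigma>: "rep_hom (prod_scale s s) s Q (rep_sum2 X Y) M \<sigma>"
  proof (rule rep_homI)
    fix x assume x: "x \<in> verts Q"
    show "linear_map_on (prod_scale s s) s (spc (rep_sum2 X Y) x) (spc M x) (\<sigma> x)"
      using XM[of x] YM[of x] vs.subspace_add[OF lin_repD(1)[OF lM x]]
      by (intro linear_map_onI) (auto simp: \<sigma>_def rep_sum2_def prod_scale_def vs.scale_right_distrib)
  next
    fix \<alpha> u assume \<alpha>: "\<alpha> \<in> arcs Q" and u: "u \<in> spc (rep_sum2 X Y) (tail Q \<alpha>)"
    then show "\<sigma> (head Q \<alpha>) (act (rep_sum2 X Y) \<alpha> u) = act M \<alpha> (\<sigma> (tail Q \<alpha>) u)"
      using linear_map_onD(2)[OF lin_repD(2)[OF lM \<alpha>]] XM[of "tail Q \<alpha>"] YM[of "tail Q \<alpha>"]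
      by (auto simp: \<sigma>_def rep_sum2_def X_def Y_def subset_iff)
  qed
  have \<sigma>bij: "bij_betw (\<sigma> x) (spc (rep_sum2 X Y) x) (spc M x)" if x: "x \<in> verts Q" for x
  proof -
    have "\<exists>u\<in>spc (rep_sum2 X Y) x. w = \<sigma> x u" if w: "w \<in> spc M x" for w
    proof -
      obtain a b where "a \<in> spc X x" "b \<in> spc Y x" "w = a + b" using fit_sum[OF x w] by blast
      then show ?thesis by (intro bexI[of _ "(a, b)"]) (auto simp: \<sigma>_def rep_sum2_def)
    qed
    moreover have "u = 0" if u: "u \<in> spc (rep_sum2 X Y) x" "\<sigma> x u = 0" for u
    proof -
      obtain a b where ab: "u = (a, b)" by (cases u)
      then have "a = - b" "a \<in> spc X x" "b \<in> spc Y x" using u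
          by (auto simp: \<sigma>_def rep_sum2_def add_eq_0_iff2)
      then have "a \<in> spc X x" "a \<in> spc Y x"
        using vs.subspace_neg[OF lin_repD(1)[OF is_rep_lin_rep[OF rY] x]] by auto
      then have "a = 0" by (rule fit_Int[OF x])
      then show ?thesis using \<open>a = - b\<close> ab by (simp add: zero_prod_def)
    qed
    ultimately show ?thesis
      unfolding bij_betw_def
      using pp.linear_map_on_inj_iff[OF rep_homD(1)[OF \<sigma> x] lin_repD(1)[OF lXY x]]
          rep_homD(3)[OF \<sigma> x] by blast
  qed
  have "rep_isomorphic s (prod_scale s s) Q M (rep_sum2 X Y)"
    unfolding rep_isomorphic_def
    using rep_hom_inverse[OF vp vs lXY \<sigma> \<sigma>bij] bij_betw_the_inv_into[OF \<sigma>bij] by blast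
  then have "is_zero_rep Q X \<or> is_zero_rep Q Y" using M rX rY unfolding indecomposable_def by blast
  moreover have "v \<in> spc Y x0"
  proof -
    have "(\<theta> x0 ^^ m) v = v" for m by (induction m) (simp_all add: v(4))
    then show ?thesis using v(2) by (auto simp: Y_def) (metis imageI)
  qed
  then have "\<not> is_zero_rep Q Y" using v by (auto simp: is_zero_rep_def)
  ultimately have "is_zero_rep Q X" by blast
  then have X0: "spc X x = {0}" using x by (simp add: is_zero_rep_def)
  have "\<forall>w\<in>spc M x. \<theta> x w = 0 \<longrightarrow> w = 0"
  proof (intro ballI impI)
    fix w assume "w \<in> spc M x" "\<theta> x w = 0"
    then have "w \<in> spc X x" by (auto simp: X_def intro!: exI[of _ 1])
    then show "w = 0" using X0 by simp
  qed
  then have "inj_on (\<theta> x) (spc M x)"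
    using p.linear_map_on_inj_iff[OF rep_homD(1)[OF \<theta> x] lin_repD(1)[OF lM x]] by blast
  moreover have "spc M x \<subseteq> \<theta> x ` spc M x"
  proof
    fix w assume "w \<in> spc M x"
    then have "w \<in> spc Y x" using fit_sum[OF x, of w] X0 by auto
    then have "w \<in> (\<Inter>m. (\<theta> x ^^ m) ` spc M x)" by (simp add: Y_def)
    then have "w \<in> (\<theta> x ^^ 1) ` spc M x" by (rule INT_D) simp
    then show "w \<in> \<theta> x ` spc M x" by simp
  qed
  ultimately show ?thesis using rep_homD(3)[OF \<theta> x] by (auto simp: bij_betw_def)
qed

end

section \<open>The category of finite extensions\<close>

text \<open>
  Outside a large enough finite \<open>F\<close> the support of \<open>M\<close> splits into a part that \<open>F\<close> reaches and a
  part that reaches \<open>F\<close>, with no arrow acting from the latter to the former.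
\<close>

definition bar_base ::
  "('k::field \<Rightarrow> 'u::ab_group_add \<Rightarrow> 'u) \<Rightarrow> ('v, 'a) pre_digraph \<Rightarrow> ('v, 'a, 'u) rep \<Rightarrow> 'v set \<Rightarrow> bool" where
  "bar_base s Q M F \<longleftrightarrow>
     (\<forall>x \<in> verts Q. x \<notin> succs Q F \<and> x \<notin> preds Q F \<longrightarrow> spc M x = {0}) \<and>
     (\<forall>\<alpha> \<in> arcs Q. tail Q \<alpha> \<notin> succs Q F \<and> head Q \<alpha> \<notin> preds Q F \<longrightarrow>
         (\<forall>v \<in> spc M (tail Q \<alpha>). act M \<alpha> v = 0)) \<and>
     rep_minus s Q (rep_res Q M (preds Q F)) \<and> rep_plus s Q (rep_res Q M (succs Q F))"

lemma rep_plusD: "rep_plus s Q M \<Longrightarrow> is_rep s Q M"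
  and rep_minusD: "rep_minus s Q M \<Longrightarrow> is_rep s Q M"
  and rep_barD: "rep_bar s Q M \<Longrightarrow> is_rep s Q M"
  by (simp_all add: rep_plus_def rep_minus_def rep_bar_def)

lemma fd_space_Times:
  assumes "vector_space s" "vector_space t" "fd_space s S" "fd_space t T"
  shows "fd_space (prod_scale s t) (S \<times> T)"
proof -
  interpret s: vector_space s by fact
  interpret t: vector_space t by fact
  interpret p: vector_space "prod_scale s t" using assms(1,2) by (rule vector_space_prod_scale)
  obtain B where B: "finite B" "B \<subseteq> S" "s.span B = S" and S: "s.subspace S"
    using assms(3) by (auto simp: fd_space_def)
  obtain C where C: "finite C" "C \<subseteq> T" "t.span C = T" and T: "t.subspace T"
    using assms(4) by (auto simp: fd_space_def)
  let ?D = "(\<lambda>b. (b, 0)) ` B \<union> (\<lambda>c. (0, c)) ` C"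
  have sub: "p.subspace (S \<times> T)"
    by (rule p.subspaceI) (auto simp: prod_scale_def zero_prod_def intro: s.subspace_0[OF S]
        t.subspace_0[OF T]
        s.subspace_add[OF S] t.subspace_add[OF T] s.subspace_scale[OF S] t.subspace_scale[OF T])
  have D: "?D \<subseteq> S \<times> T" using B(2) C(2) s.subspace_0[OF S] t.subspace_0[OF T] by auto
  have "u \<in> p.span ?D" if "u \<in> S \<times> T" for u
  proof -
    have 1: "(a, 0) \<in> p.span ?D" if "a \<in> s.span B" for a
      using that
    proof (induction rule: s.span_induct_alt)
      case base show ?case using p.span_zero by (simp add: zero_prod_def)
    next
      case (step c x y)
      have "prod_scale s t c (x, 0) + (y, 0) \<in> p.span ?D"
        using step by (intro p.span_add p.span_scale) (auto intro: p.span_base)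
      moreover have "prod_scale s t c (x, 0) + (y, 0) = (s c x + y, 0)" by (simp add: prod_scale_def)
      ultimately show ?case by (simp only:)
    qed
    have 2: "(0, b) \<in> p.span ?D" if "b \<in> t.span C" for b
      using that
    proof (induction rule: t.span_induct_alt)
      case base show ?case using p.span_zero by (simp add: zero_prod_def)
    next
      case (step c x y)
      have "prod_scale s t c (0, x) + (0, y) \<in> p.span ?D"
        using step by (intro p.span_add p.span_scale) (auto intro: p.span_base)
      moreover have "prod_scale s t c (0, x) + (0, y) = (0, t c x + y)" by (simp add: prod_scale_def)
      ultimately show ?case by (simp only:)
    qed
    have "fst u \<in> s.span B" "snd u \<in> t.span C" using that by (simp_all only: B(3) C(3) mem_Times_iff)
    from p.span_add[OF 1[OF this(1)] 2[OF this(2)]] show ?thesis by simp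
  qed
  then have "p.span ?D = S \<times> T" by (intro subset_antisym p.span_minimal[OF D sub] subsetI)
  then show ?thesis unfolding fd_space_def using sub B(1) C(1) D by (intro conjI exI[of _ ?D]) simp_all
qed

context slf_quiver
begin

lemma rep_hom_0:
  assumes "vector_space s" "vector_space t" "lin_rep s Q M" "rep_hom s t Q M N f" "x \<in> verts Q"
  shows "f x 0 = 0"
proof -
  interpret vector_space_pair s t using assms(1,2) by (simp add: vector_space_pair_def)
  show ?thesis by (rule linear_map_on_zero[OF rep_homD(1)[OF assms(4,5)] lin_repD(1)[OF assms(3,5)]])
qed

lemma act_0:
  assumes "vector_space s" "lin_rep s Q M" "\<alpha> \<in> arcs Q"
  shows "act M \<alpha> 0 = 0"
proof -
  interpret vector_space_pair s s using assms(1) by (simp add: vector_space_pair_def)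
  show ?thesis
    by (rule linear_map_on_zero[OF lin_repD(2)[OF assms(2,3)]
        lin_repD(1)[OF assms(2) tail_in_verts[OF assms(3)]]])
qed

lemma spc_0: "vector_space s \<Longrightarrow> lin_rep s Q M \<Longrightarrow> x \<in> verts Q \<Longrightarrow> 0 \<in> spc M x"
  using module.subspace_0[of s] lin_repD(1) by (metis module_iff_vector_space)

lemma supports_rep_sum2:
  assumes "vector_space s" "lin_rep s Q L" "lin_rep s Q N"
  shows "supports Q (rep_sum2 L N) \<alpha> \<longleftrightarrow> supports Q L \<alpha> \<or> supports Q N \<alpha>"
proof (cases "\<alpha> \<in> arcs Q")
  case True
  have 0: "0 \<in> spc L (tail Q \<alpha>)" "0 \<in> spc N (tail Q \<alpha>)"
    using spc_0[OF assms(1,2)] spc_0[OF assms(1,3)] True by auto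
  have "supports Q (rep_sum2 L N) \<alpha> \<longleftrightarrow>
      (\<exists>l\<in>spc L (tail Q \<alpha>). \<exists>n\<in>spc N (tail Q \<alpha>). act L \<alpha> l \<noteq> 0 \<or> act N \<alpha> n \<noteq> 0)"
    using True by (auto simp: supports_def rep_sum2_def zero_prod_def)
  also have "\<dots> \<longleftrightarrow> supports Q L \<alpha> \<or> supports Q N \<alpha>" using True 0 unfolding supports_def by blast
  finally show ?thesis .
qed (simp add: supports_def)

text \<open>The other end of the extension is the zero representation, which lies in both
  subcategories. No arrow is then exceptional.\<close>

lemma rep_bar_if_rep_plus_or_minus:
  fixes s :: "'k::field \<Rightarrow> 'u::ab_group_add \<Rightarrow> 'u"
  assumes vs: "vector_space s" and M: "rep_plus s Q M \<or> rep_minus s Q M"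
  shows "rep_bar s Q M"
proof -
  interpret vs: vector_space s by fact
  define Z :: "('v, 'a, 'u) rep" where "Z = \<lparr>spc = (\<lambda>x. {0}), act = (\<lambda>\<alpha> v. 0)\<rparr>"
  have Z: "is_rep s Q Z" by (auto simp: is_rep_def Z_def vs.fd_space_0 intro: linear_map_onI)
  have Zpm: "rep_plus s Q Z" "rep_minus s Q Z"
    by (intro finite_support_rep_plus[OF vs Z, of "{}"]
        finite_support_rep_minus[OF vs Z, of "{}"]; simp add: Z_def)+
  have rM: "is_rep s Q M" using M rep_plusD rep_minusD by blast
  note lM = is_rep_lin_rep[OF rM] and lZ = is_rep_lin_rep[OF Z]
  note ZM = rep_hom_zero[OF vs vs lZ lM] and MZ = rep_hom_zero[OF vs vs lM lZ]
      and MM = rep_hom_id[OF lM]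
  have 0: "0 \<in> spc M x" if "x \<in> verts Q" for x using spc_0[OF vs lM that] .
  show ?thesis
    using M
  proof
    assume "rep_plus s Q M"
    moreover have "finite_extension s Q M M Z (\<lambda>x v. v) (\<lambda>x v. 0)"
      unfolding finite_extension_def short_exact_def supports_rep_sum2[OF vs lM lZ]
      using MM MZ 0 by (auto simp: Z_def) (rule finite_subset[of _ "{}"], blast, simp)
    ultimately show ?thesis unfolding rep_bar_def using rM Zpm by blast
  next
    assume "rep_minus s Q M"
    moreover have "finite_extension s Q Z M M (\<lambda>x v. 0) (\<lambda>x v. v)"
      unfolding finite_extension_def short_exact_def supports_rep_sum2[OF vs lZ lM]
      using MM ZM 0 by (auto simp: Z_def) (rule finite_subset[of _ "{}"], blast, simp)
    ultimately show ?thesis unfolding rep_bar_def using rM Zpm by blast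
  qed
qed

lemma rep_bar_base:
  fixes s :: "'k::field \<Rightarrow> 'u::ab_group_add \<Rightarrow> 'u"
  assumes vs: "vector_space s" and M: "rep_bar s Q M"
  obtains F0 where "finite F0" "F0 \<subseteq> verts Q"
    "\<And>F. finite F \<Longrightarrow> F0 \<subseteq> F \<Longrightarrow> F \<subseteq> verts Q \<Longrightarrow> bar_base s Q M F"
proof -
  interpret p: vector_space_pair s s using vs by (simp add: vector_space_pair_def)
  obtain L N f g where rM: "is_rep s Q M" and L: "rep_plus s Q L" and N: "rep_minus s Q N"
    and ext: "finite_extension s Q L M N f g"
    using M unfolding rep_bar_def by blast
  note lM = is_rep_lin_rep[OF rM] and lL = is_rep_lin_rep[OF rep_plusD[OF L]]
      and lN = is_rep_lin_rep[OF rep_minusD[OF N]]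
  have f: "rep_hom s s Q L M f" and g: "rep_hom s s Q M N g"
    and ex: "\<And>x. x \<in> verts Q \<Longrightarrow> inj_on (f x) (spc L x)"
      "\<And>x. x \<in> verts Q \<Longrightarrow> f x ` spc L x = {v \<in> spc M x. g x v = 0}"
      "\<And>x. x \<in> verts Q \<Longrightarrow> g x ` spc M x = spc N x"
    and fin: "finite {\<alpha>. supports Q M \<alpha> \<and> \<not> supports Q (rep_sum2 L N) \<alpha>}" (is "finite ?E")
    using ext by (auto simp: finite_extension_def short_exact_def)
  obtain A where A: "finite A" "A \<subseteq> verts Q" "\<And>x. x \<in> verts Q \<Longrightarrow> x \<notin> succs Q A \<Longrightarrow> spc L x = {0}"
    using rep_plus_support[OF vs L] by blast
  obtain B where B: "finite B" "B \<subseteq> verts Q" "\<And>x. x \<in> verts Q \<Longrightarrow> x \<notin> preds Q B \<Longrightarrow> spc N x = {0}"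
    using rep_minus_support[OF vs N] by blast
  note f0 = rep_hom_0[OF vs vs lL f] and g0 = rep_hom_0[OF vs vs lM g]
  \<comment> \<open>\<open>A\<close> and \<open>B\<close> bound the supports of \<open>L\<close> and
    \<open>N\<close>. An arrow that supports \<open>M\<close> but starts outside Succ F and ends
    outside Pred F supports neither \<open>L\<close> nor \<open>N\<close>, so it is exceptional.
    With the heads of the exceptional arrows in F, there is no such arrow.\<close>
  show ?thesis
  proof (rule that[of "A \<union> B \<union> head Q ` ?E"])
    show "finite (A \<union> B \<union> head Q ` ?E)" using A B fin by simp
    show "A \<union> B \<union> head Q ` ?E \<subseteq> verts Q" using A B by (auto simp: supports_def)
    fix F assume F: "finite F" "A \<union> B \<union> head Q ` ?E \<subseteq> F" "F \<subseteq> verts Q"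
    have LS: "spc L x = {0}" if "x \<in> verts Q" "x \<notin> succs Q F" for x
      using A(3)[OF that(1)] that(2) succs_mono[of A F] F(2) by blast
    have NP: "spc N x = {0}" if "x \<in> verts Q" "x \<notin> preds Q F" for x
      using B(3)[OF that(1)] that(2) preds_mono[of B F] F(2) by blast
    have "spc M x = {0}" if x: "x \<in> verts Q" "x \<notin> succs Q F" "x \<notin> preds Q F" for x
    proof -
      have "g x v = 0" if "v \<in> spc M x" for v using rep_homD(3)[OF g x(1) that] NP[OF x(1,3)] by simp
      then have "{v \<in> spc M x. g x v = 0} = spc M x" by auto
      then show ?thesis using ex(2)[OF x(1)] LS[OF x(1,2)] f0[OF x(1)] by simp
    qed
    moreover have "act M \<alpha> v = 0"
      if \<alpha>: "\<alpha> \<in> arcs Q" "tail Q \<alpha> \<notin> succs Q F" "head Q \<alpha> \<notin> preds Q F" and v: "v \<in> spc M (tail Q \<alpha>)"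
          for \<alpha> v
    proof (rule ccontr)
      assume "act M \<alpha> v \<noteq> 0"
      then have "supports Q M \<alpha>" using \<alpha> v by (auto simp: supports_def)
      moreover have "\<not> supports Q L \<alpha>" using LS[of "tail Q \<alpha>"] \<alpha> act_0[OF vs lL]
          by (auto simp: supports_def)
      moreover have "\<not> supports Q N \<alpha>" using NP[of "head Q \<alpha>"] \<alpha> lin_repD(3)[OF lN \<alpha>(1)]
          by (auto simp: supports_def)
      ultimately have "\<alpha> \<in> ?E" by (simp add: supports_rep_sum2[OF vs lL lN])
      then show False using F(2,3) subset_preds[of F] \<alpha>(3) by blast
    qed
    \<comment> \<open>\<open>N\<close> vanishes outside Pred F, so \<open>g\<close> restricts to a
      surjection from the quotient onto \<open>N\<close>. Its kernel comes from \<open>L\<close>,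
      which lives on Succ A, and Succ A meets Pred F in a finite set.\<close>
    moreover have "rep_minus s Q (rep_res Q M (preds Q F))"
    proof (rule rep_minus_surj[OF vs is_rep_rep_res[OF vs rM] N, where f = g
        and D = "succs Q A \<inter> preds Q F"])
      show "rep_hom s s Q (rep_res Q M (preds Q F)) N g"
      proof (rule rep_homI)
        fix x assume x: "x \<in> verts Q"
        show "linear_map_on s s (spc (rep_res Q M (preds Q F)) x) (spc N x) (g x)"
          using spc_0[OF vs lM x] rep_homD(3)[OF g x]
          by (intro linear_map_on_mono[OF rep_homD(1)[OF g x]]) (auto simp: spc_rep_res)
      next
        fix \<alpha> v assume \<alpha>: "\<alpha> \<in> arcs Q" and v: "v \<in> spc (rep_res Q M (preds Q F)) (tail Q \<alpha>)"
        have x: "tail Q \<alpha> \<in> verts Q" and y: "head Q \<alpha> \<in> verts Q" using \<alpha> by auto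
        consider "tail Q \<alpha> \<in> preds Q F" "head Q \<alpha> \<in> preds Q F" | "tail Q \<alpha> \<in> preds Q F"
            "head Q \<alpha> \<notin> preds Q F"
          | "tail Q \<alpha> \<notin> preds Q F" by blast
        then show "g (head Q \<alpha>) (act (rep_res Q M (preds Q F)) \<alpha> v) = act N \<alpha> (g (tail Q \<alpha>) v)"
        proof cases
          case 1
          then show ?thesis using rep_homD(2)[OF g \<alpha>] v by (simp add: rep_res_def)
        next
          case 2
          then have "act N \<alpha> (g (tail Q \<alpha>) v) = 0"
            using lin_repD(3)[OF lN \<alpha> rep_homD(3)[OF g x]] NP[OF y] v by (simp add: spc_rep_res)
          then show ?thesis using 2 g0[OF y] by (simp add: rep_res_def)
        next
          case 3
          then show ?thesis using v g0[OF x] g0[OF y] act_0[OF vs lN \<alpha>] by (simp add: rep_res_def)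
        qed
      qed
      show "g x ` spc (rep_res Q M (preds Q F)) x = spc N x" if x: "x \<in> verts Q" for x
        using ex(3)[OF x] NP[OF x] g0[OF x] by (simp add: spc_rep_res)
      show "finite (succs Q A \<inter> preds Q F)" using A(1) F(1) by (rule finite_succs_Int_preds)
      show "inj_on (g x) (spc (rep_res Q M (preds Q F)) x)" if x: "x \<in> verts Q"
          "x \<notin> succs Q A \<inter> preds Q F" for x
      proof (cases "x \<in> preds Q F")
        case True
        then have "{v \<in> spc M x. g x v = 0} = {0}"
            using ex(2)[OF x(1)] A(3)[OF x(1)] f0[OF x(1)] x(2) by auto
        then have "inj_on (g x) (spc M x)"
          using p.linear_map_on_inj_iff[OF rep_homD(1)[OF g x(1)] lin_repD(1)[OF lM x(1)]] by blast
        then show ?thesis using True by (simp add: spc_rep_res)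
      qed (simp add: spc_rep_res)
    qed
    \<comment> \<open>\<open>L\<close> vanishes outside Succ F, so \<open>f\<close> embeds it in the
      subrepresentation. The cokernel comes from \<open>N\<close>, which lives on Pred B, and Pred B
      meets Succ F in a finite set.\<close>
    moreover have "rep_plus s Q (rep_res Q M (succs Q F))"
    proof (rule rep_plus_inj[OF vs vs is_rep_rep_res[OF vs rM] L, where h = f
        and D = "succs Q F \<inter> preds Q B"])
      have mem: "f x v \<in> spc (rep_res Q M (succs Q F)) x" if "x \<in> verts Q" "v \<in> spc L x" for x v
      proof (cases "x \<in> succs Q F")
        case True
        then show ?thesis using rep_homD(3)[OF f that] by (simp add: spc_rep_res)
      next
        case False
        then have "v = 0" using LS[OF that(1)] that(2) by simp
        then show ?thesis using f0[OF that(1)] False by (simp add: spc_rep_res)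
      qed
      show "rep_hom s s Q L (rep_res Q M (succs Q F)) f"
      proof (rule rep_homI)
        fix x assume x: "x \<in> verts Q"
        show "linear_map_on s s (spc L x) (spc (rep_res Q M (succs Q F)) x) (f x)"
          using mem[OF x] by (intro linear_map_on_mono[OF rep_homD(1)[OF f x]]) auto
      next
        fix \<alpha> v assume \<alpha>: "\<alpha> \<in> arcs Q" and v: "v \<in> spc L (tail Q \<alpha>)"
        have x: "tail Q \<alpha> \<in> verts Q" and y: "head Q \<alpha> \<in> verts Q" using \<alpha> by auto
        show "f (head Q \<alpha>) (act L \<alpha> v) = act (rep_res Q M (succs Q F)) \<alpha> (f (tail Q \<alpha>) v)"
        proof (cases "tail Q \<alpha> \<in> succs Q F")
          case True
          then show ?thesis using rep_homD(2)[OF f \<alpha> v] succs_head[OF \<alpha> True] by (simp add: rep_res_def)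
        next
          case False
          then have "v = 0" using LS[OF x] v by simp
          then show ?thesis using act_0[OF vs lL \<alpha>] f0[OF y] False by (simp add: rep_res_def)
        qed
      qed
      show "inj_on (f x) (spc L x)" if "x \<in> verts Q" for x using ex(1)[OF that] .
      show "finite (succs Q F \<inter> preds Q B)" using F(1) B(1) by (rule finite_succs_Int_preds)
      show "f x ` spc L x = spc (rep_res Q M (succs Q F)) x" if x: "x \<in> verts Q"
          "x \<notin> succs Q F \<inter> preds Q B" for x
      proof (cases "x \<in> succs Q F")
        case True
        then have "spc N x = {0}" using B(3)[OF x(1)] x(2) by blast
        then have "{v \<in> spc M x. g x v = 0} = spc M x" using rep_homD(3)[OF g x(1)] by auto
        then show ?thesis using ex(2)[OF x(1)] True by (simp add: spc_rep_res)
      next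
        case False
        then show ?thesis using LS[OF x(1)] f0[OF x(1)] by (simp add: spc_rep_res)
      qed
    qed
    ultimately show "bar_base s Q M F" by (simp add: bar_base_def)
  qed
qed

text \<open>Otherwise the projection of \<open>M\<close> onto its finitely co-presented quotient on
  Pred F would be bijective.\<close>

lemma not_rep_minus_witness:
  assumes vs: "vector_space s" and M: "is_rep s Q M" and "bar_base s Q M F" "\<not> rep_minus s Q M"
  obtains x m where "x \<in> verts Q" "x \<notin> preds Q F" "m \<in> spc M x" "m \<noteq> 0"
proof -
  have "\<exists>x\<in>verts Q. x \<notin> preds Q F \<and> spc M x \<noteq> {0}"
  proof (rule ccontr)
    assume "\<not> ?thesis"
    then have z: "spc M x = {0}" if "x \<in> verts Q" "x \<notin> preds Q F" for x using that by blast
    have "rep_minus s Q (rep_res Q M (preds Q F))" using assms(3) by (simp add: bar_base_def)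
    from rep_minus_surj[OF vs M this rep_hom_res_proj[OF vs M preds_tail], of "{}"] z
    have "rep_minus s Q M" by (simp add: spc_rep_res inj_on_def)
    then show False using assms(4) by simp
  qed
  then show ?thesis using that spc_0[OF vs is_rep_lin_rep[OF M]] by blast
qed

text \<open>Otherwise the inclusion into \<open>M\<close> of its finitely presented
  subrepresentation on Succ F would be bijective.\<close>

lemma not_rep_plus_witness:
  assumes vs: "vector_space s" and M: "is_rep s Q M" and "bar_base s Q M F" "\<not> rep_plus s Q M"
  obtains x m where "x \<in> verts Q" "x \<notin> succs Q F" "m \<in> spc M x" "m \<noteq> 0"
proof -
  have "\<exists>x\<in>verts Q. x \<notin> succs Q F \<and> spc M x \<noteq> {0}"
  proof (rule ccontr)
    assume "\<not> ?thesis"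
    then have z: "spc M x = {0}" if "x \<in> verts Q" "x \<notin> succs Q F" for x using that by blast
    have "rep_plus s Q (rep_res Q M (succs Q F))" using assms(3) by (simp add: bar_base_def)
    from rep_plus_inj[OF vs vs M this rep_hom_res_incl[OF vs M succs_head], of "{}"] z
    have "rep_plus s Q M" by (simp add: spc_rep_res inj_on_def)
    then show False using assms(4) by simp
  qed
  then show ?thesis using that spc_0[OF vs is_rep_lin_rep[OF M]] by blast
qed

text \<open>Irreducibility for a middle term \<open>Y\<close> in another ambient space:
  \<open>Y\<close> is copied into that of \<open>M\<close> and \<open>N\<close>. The copy is again a
  finite extension, since an isomorphism preserves exactness and every arrow that supports the copy
  supports \<open>Y\<close>.\<close>

lemma irreducible_in_rep_bar_factor:
  fixes s :: "'k::field \<Rightarrow> 'u::ab_group_add \<Rightarrow> 'u" and t :: "'k \<Rightarrow> 'w::ab_group_add \<Rightarrow> 'w"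
  assumes vs: "vector_space s" and inf: "\<nexists>B. finite B \<and> module.span s B = UNIV"
    and irr: "irreducible_in (rep_bar s Q) s Q M N f"
    and vt: "vector_space t" and Y: "is_rep t Q Y"
    and L: "rep_plus s Q L" and R: "rep_minus s Q R" and ex: "short_exact s t s Q L Y R a b"
    and fin: "finite {\<alpha>. supports Q Y \<alpha> \<and> \<not> supports Q (rep_sum2 L R) \<alpha>}"
    and h: "rep_hom s t Q M Y h" and g: "rep_hom t s Q Y N g"
    and fgh: "\<And>x v. x \<in> verts Q \<Longrightarrow> v \<in> spc M x \<Longrightarrow> f x v = g x (h x v)"
  shows "rep_section s t Q M Y h \<or> rep_retraction t s Q Y N g"
proof -
  obtain Y' \<phi> where Y': "is_rep s Q Y'" and \<phi>: "rep_hom t s Q Y Y' \<phi>"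
    and bij: "\<And>x. x \<in> verts Q \<Longrightarrow> bij_betw (\<phi> x) (spc Y x) (spc Y' x)"
    using rep_transport[OF vs inf vt Y] by blast
  note lY = is_rep_lin_rep[OF Y]
  define \<psi> where "\<psi> x = the_inv_into (spc Y x) (\<phi> x)" for x
  have \<psi>: "rep_hom s t Q Y' Y \<psi>" unfolding \<psi>_def by (rule rep_hom_inverse[OF vt vs lY \<phi> bij])
  have \<psi>\<phi>: "\<psi> x (\<phi> x v) = v" if "x \<in> verts Q" "v \<in> spc Y x" for x v
    using bij[OF that(1)] that(2) by (simp add: \<psi>_def bij_betw_def the_inv_into_f_f)
  have \<phi>im: "\<phi> x ` spc Y x = spc Y' x" if "x \<in> verts Q" for x using bij[OF that]
      by (simp add: bij_betw_def)
  have \<psi>im: "\<psi> x ` spc Y' x = spc Y x" if "x \<in> verts Q" for x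
    using bij_betw_the_inv_into[OF bij[OF that]] by (simp add: \<psi>_def bij_betw_def)
  have a: "rep_hom s t Q L Y a" and b: "rep_hom t s Q Y R b"
    and ex': "\<And>x. x \<in> verts Q \<Longrightarrow> inj_on (a x) (spc L x) \<and> a x ` spc L x = {v \<in> spc Y x. b x v = 0} \<and>
        b x ` spc Y x = spc R x"
    using ex by (auto simp: short_exact_def)
  have "short_exact s s s Q L Y' R (\<lambda>x v. \<phi> x (a x v)) (\<lambda>x v. b x (\<psi> x v))"
    unfolding short_exact_def
  proof (intro conjI ballI rep_hom_comp[OF a \<phi>] rep_hom_comp[OF \<psi> b])
    fix x assume x: "x \<in> verts Q"
    show "inj_on (\<lambda>v. \<phi> x (a x v)) (spc L x)"
      using ex'[OF x] bij[OF x] rep_homD(3)[OF a x] by (auto simp: bij_betw_def inj_on_def)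
    have "(\<lambda>v. \<phi> x (a x v)) ` spc L x = \<phi> x ` {v \<in> spc Y x. b x v = 0}"
      using ex'[OF x] by (simp add: image_image[symmetric])
    also have "\<dots> = {v \<in> spc Y' x. b x (\<psi> x v) = 0}"
      unfolding \<phi>im[OF x, symmetric] using \<psi>\<phi>[OF x] by auto
    finally show "(\<lambda>v. \<phi> x (a x v)) ` spc L x = {v \<in> spc Y' x. b x (\<psi> x v) = 0}" .
    show "(\<lambda>v. b x (\<psi> x v)) ` spc Y' x = spc R x"
      using ex'[OF x] \<psi>im[OF x] by (simp add: image_image[symmetric])
  qed
  moreover have "supports Q Y \<alpha>" if sup: "supports Q Y' \<alpha>" for \<alpha>
  proof -
    have \<alpha>: "\<alpha> \<in> arcs Q" using sup by (simp add: supports_def)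
    obtain u where u: "u \<in> spc Y' (tail Q \<alpha>)" "act Y' \<alpha> u \<noteq> 0" using sup by (auto simp: supports_def)
    then obtain y where y: "y \<in> spc Y (tail Q \<alpha>)" "u = \<phi> (tail Q \<alpha>) y" using \<phi>im[of "tail Q \<alpha>"] \<alpha>
        by auto
    then have "\<phi> (head Q \<alpha>) (act Y \<alpha> y) \<noteq> 0" using rep_homD(2)[OF \<phi> \<alpha>] u(2) by simp
    then have "act Y \<alpha> y \<noteq> 0" using rep_hom_0[OF vt vs lY \<phi>] \<alpha> by auto
    then show ?thesis using \<alpha> y(1) by (auto simp: supports_def)
  qed
  then have "finite {\<alpha>. supports Q Y' \<alpha> \<and> \<not> supports Q (rep_sum2 L R) \<alpha>}"
    by (intro finite_subset[OF _ fin]) auto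
  ultimately have bar: "rep_bar s Q Y'"
    unfolding rep_bar_def finite_extension_def using Y' L R by blast
  have fh: "f x v = g x (\<psi> x (\<phi> x (h x v)))" if "x \<in> verts Q" "v \<in> spc M x" for x v
    using fgh[OF that] \<psi>\<phi>[OF that(1) rep_homD(3)[OF h that]] by simp
  have "rep_section s s Q M Y' (\<lambda>x v. \<phi> x (h x v)) \<or> rep_retraction s s Q Y' N (\<lambda>x v. g x (\<psi> x v))"
    using irr bar rep_hom_comp[OF h \<phi>] rep_hom_comp[OF \<psi> g] fh unfolding irreducible_in_def by blast
  then show ?thesis
  proof
    assume "rep_section s s Q M Y' (\<lambda>x v. \<phi> x (h x v))"
    then obtain r where "rep_hom s s Q Y' M r" "\<And>x v. x \<in> verts Q \<Longrightarrow> v \<in> spc M x \<Longrightarrow> r x (\<phi> x (h x v)) = v"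
      by (auto simp: rep_section_def)
    then have "rep_section s t Q M Y h"
      unfolding rep_section_def using h rep_hom_comp[OF \<phi>]
          by (auto intro!: exI[of _ "\<lambda>x v. r x (\<phi> x v)"])
    then show ?thesis ..
  next
    assume "rep_retraction s s Q Y' N (\<lambda>x v. g x (\<psi> x v))"
    then obtain i where "rep_hom s s Q N Y' i" "\<And>x v. x \<in> verts Q \<Longrightarrow> v \<in> spc N x \<Longrightarrow> g x (\<psi> x (i x v)) = v"
      by (auto simp: rep_retraction_def)
    then have "rep_retraction t s Q Y N g"
      unfolding rep_retraction_def using g rep_hom_comp[OF _ \<psi>]
          by (auto intro!: exI[of _ "\<lambda>x v. \<psi> x (i x v)"])
    then show ?thesis ..
  qed
qed

lemma rep_section_if_bij:
  assumes "vector_space s" "lin_rep s Q M" "rep_hom s s Q M N f" "rep_hom s s Q N M w"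
    and bij: "\<And>x. x \<in> verts Q \<Longrightarrow> bij_betw (\<lambda>v. w x (f x v)) (spc M x) (spc M x)"
  shows "rep_section s s Q M N f"
proof -
  note wf = rep_hom_comp[OF assms(3,4)]
  note inv = rep_hom_inverse[OF assms(1,1,2) wf bij]
  show ?thesis
    unfolding rep_section_def
  proof (intro conjI exI[of _ "\<lambda>x v. the_inv_into (spc M x) (\<lambda>v. w x (f x v)) (w x v)"] ballI assms(3))
    show "rep_hom s s Q N M (\<lambda>x v. the_inv_into (spc M x) (\<lambda>v. w x (f x v)) (w x v))"
      by (rule rep_hom_comp[OF assms(4) inv])
    fix x v assume "x \<in> verts Q" "v \<in> spc M x"
    then show "the_inv_into (spc M x) (\<lambda>v. w x (f x v)) (w x (f x v)) = v"
      using bij by (auto simp: bij_betw_def intro: the_inv_into_f_f)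
  qed
qed

lemma rep_retraction_if_bij:
  assumes "vector_space s" "lin_rep s Q N" "rep_hom s s Q M N f" "rep_hom s s Q N M w"
    and bij: "\<And>x. x \<in> verts Q \<Longrightarrow> bij_betw (\<lambda>v. f x (w x v)) (spc N x) (spc N x)"
  shows "rep_retraction s s Q M N f"
proof -
  note fw = rep_hom_comp[OF assms(4,3)]
  note inv = rep_hom_inverse[OF assms(1,1,2) fw bij]
  show ?thesis
    unfolding rep_retraction_def
  proof (intro conjI exI[of _ "\<lambda>x v. w x (the_inv_into (spc N x) (\<lambda>v. f x (w x v)) v)"] ballI assms(3))
    show "rep_hom s s Q N M (\<lambda>x v. w x (the_inv_into (spc N x) (\<lambda>v. f x (w x v)) v))"
      by (rule rep_hom_comp[OF inv assms(4)])
    fix x v assume "x \<in> verts Q" "v \<in> spc N x"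
    then show "f x (w x (the_inv_into (spc N x) (\<lambda>v. f x (w x v)) v)) = v"
      using bij f_the_inv_into_f[of "\<lambda>v. f x (w x v)" "spc N x" v] by (auto simp: bij_betw_def)
  qed
qed

end

section \<open>Irreducible morphisms\<close>

context slf_quiver
begin

lemma irreducible_rep_minus:
  fixes s :: "'k::field \<Rightarrow> 'u::ab_group_add \<Rightarrow> 'u"
  assumes vs: "vector_space s" and irr: "irreducible_in (rep_bar s Q) s Q M N f"
      and N: "rep_minus s Q N"
  shows "rep_minus s Q M"
proof (rule ccontr)
  assume nM: "\<not> rep_minus s Q M"
  have bM: "rep_bar s Q M" and f: "rep_hom s s Q M N f" and nretr: "\<not> rep_retraction s s Q M N f"
    using irr by (simp_all add: irreducible_in_def)
  have rM: "is_rep s Q M" using rep_barD[OF bM] .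
  note lM = is_rep_lin_rep[OF rM] and lN = is_rep_lin_rep[OF rep_minusD[OF N]]
  note f0 = rep_hom_0[OF vs vs lM f]
  obtain F0 where F0: "finite F0" "F0 \<subseteq> verts Q"
    "\<And>F. finite F \<Longrightarrow> F0 \<subseteq> F \<Longrightarrow> F \<subseteq> verts Q \<Longrightarrow> bar_base s Q M F"
    using rep_bar_base[OF vs bM] by metis
  obtain B where B: "finite B" "B \<subseteq> verts Q" "\<And>x. x \<in> verts Q \<Longrightarrow> x \<notin> preds Q B \<Longrightarrow> spc N x = {0}"
    using rep_minus_support[OF vs N] by blast
  define G where "G = F0 \<union> B"
  \<comment> \<open>The added heads ensure that an arrow from Pred G to outside Pred F starts
    outside Succ G. By the choice of G it acts on \<open>M\<close> as zero. Arrows of this kind are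
    the only ones at which lifting a section of \<open>N\<close> from the quotient to
    \<open>M\<close> could fail.\<close>
  define F where "F = G \<union> head Q ` (\<Union>x\<in>succs Q G \<inter> preds Q G. out_arcs Q x)"
  have G: "finite G" "G \<subseteq> verts Q" "F0 \<subseteq> G" using F0 B by (auto simp: G_def)
  have "finite (succs Q G \<inter> preds Q G)" using G(1) G(1) by (rule finite_succs_Int_preds)
  moreover have "finite (out_arcs Q x)" if "x \<in> succs Q G \<inter> preds Q G" for x
    using finite_arcs_at(2) succs_verts[of G] that by blast
  ultimately have F: "finite F" "F \<subseteq> verts Q" "G \<subseteq> F" using G by (auto simp: F_def)
  have base: "bar_base s Q M F" "bar_base s Q M G" using F0(3) F G by auto
  let ?P = "preds Q F"
  let ?X = "rep_res Q M ?P"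
  have X: "rep_minus s Q ?X" using base(1) by (simp add: bar_base_def)
  note lX = is_rep_lin_rep[OF rep_minusD[OF X]]
  have NB: "x \<in> preds Q B" if "x \<in> verts Q" "n \<in> spc N x" "n \<noteq> 0" for x n using B(3) that by blast
  have "preds Q B \<subseteq> preds Q G" "preds Q G \<subseteq> ?P" using preds_mono F(3) by (auto simp: G_def)
  then have NP: "spc N x = {0}" if "x \<in> verts Q" "x \<notin> ?P" for x using B(3)[OF that(1)] that(2) by blast
  have h: "rep_hom s s Q M ?X (\<lambda>x v. if x \<in> ?P then v else 0)"
      by (rule rep_hom_res_proj[OF vs rM preds_tail])
  have Xmem: "v \<in> spc M x" if "x \<in> verts Q" "v \<in> spc ?X x" for x v
    using that spc_0[OF vs lM] by (auto simp: spc_rep_res split: if_splits)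
  have g: "rep_hom s s Q ?X N f"
  proof (rule rep_homI)
    fix x assume x: "x \<in> verts Q"
    show "linear_map_on s s (spc ?X x) (spc N x) (f x)"
      using Xmem[OF x] rep_homD(3)[OF f x] by (intro linear_map_on_mono[OF rep_homD(1)[OF f x]]) auto
  next
    fix \<alpha> v assume \<alpha>: "\<alpha> \<in> arcs Q" and v: "v \<in> spc ?X (tail Q \<alpha>)"
    have x: "tail Q \<alpha> \<in> verts Q" and y: "head Q \<alpha> \<in> verts Q" using \<alpha> by auto
    have c: "f (head Q \<alpha>) (act M \<alpha> v) = act N \<alpha> (f (tail Q \<alpha>) v)"
        using rep_homD(2)[OF f \<alpha> Xmem[OF x v]] .
    show "f (head Q \<alpha>) (act ?X \<alpha> v) = act N \<alpha> (f (tail Q \<alpha>) v)"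
    proof (cases "head Q \<alpha> \<in> ?P")
      case True
      then show ?thesis using c preds_tail[OF \<alpha> True] by (simp add: rep_res_def)
    next
      case False
      have "act N \<alpha> (f (tail Q \<alpha>) v) = 0"
        using lin_repD(3)[OF lN \<alpha> rep_homD(3)[OF f x Xmem[OF x v]]] NP[OF y False] by simp
      then show ?thesis using False f0[OF y] by (simp add: rep_res_def)
    qed
  qed
  have "f x v = f x (if x \<in> ?P then v else 0)" if "x \<in> verts Q" "v \<in> spc M x" for x v
    using rep_homD(3)[OF f that] NP[OF that(1)] f0[OF that(1)] by auto
  then have "rep_section s s Q M ?X (\<lambda>x v. if x \<in> ?P then v else 0) \<or> rep_retraction s s Q ?X N f"
    using irr rep_bar_if_rep_plus_or_minus[OF vs, of ?X] X h g unfolding irreducible_in_def by blast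
  then show False
  proof
    assume "rep_section s s Q M ?X (\<lambda>x v. if x \<in> ?P then v else 0)"
    then obtain r where r: "rep_hom s s Q ?X M r"
      "\<And>x v. x \<in> verts Q \<Longrightarrow> v \<in> spc M x \<Longrightarrow> r x (if x \<in> ?P then v else 0) = v"
      by (auto simp: rep_section_def)
    obtain x m where x: "x \<in> verts Q" "x \<notin> ?P" "m \<in> spc M x" "m \<noteq> 0"
      using not_rep_minus_witness[OF vs rM base(1) nM] by blast
    then show False using r(2)[OF x(1,3)] rep_hom_0[OF vs vs lX r(1) x(1)] by simp
  next
    assume "rep_retraction s s Q ?X N f"
    then obtain i where i: "rep_hom s s Q N ?X i" "\<And>x n. x \<in> verts Q \<Longrightarrow> n \<in> spc N x \<Longrightarrow> f x (i x n) = n"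
      by (auto simp: rep_retraction_def)
    note i0 = rep_hom_0[OF vs vs lN i(1)]
    have "rep_hom s s Q N M i"
    proof (rule rep_homI)
      fix x assume x: "x \<in> verts Q"
      show "linear_map_on s s (spc N x) (spc M x) (i x)"
        using Xmem[OF x] rep_homD(3)[OF i(1) x]
            by (intro linear_map_on_mono[OF rep_homD(1)[OF i(1) x]]) auto
    next
      fix \<alpha> n assume \<alpha>: "\<alpha> \<in> arcs Q" and n: "n \<in> spc N (tail Q \<alpha>)"
      have x: "tail Q \<alpha> \<in> verts Q" and y: "head Q \<alpha> \<in> verts Q" using \<alpha> by auto
      have iX: "i (tail Q \<alpha>) n \<in> spc ?X (tail Q \<alpha>)" using rep_homD(3)[OF i(1) x n] .
      show "i (head Q \<alpha>) (act N \<alpha> n) = act M \<alpha> (i (tail Q \<alpha>) n)"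
      proof (cases "head Q \<alpha> \<in> ?P")
        case True
        then show ?thesis using rep_homD(2)[OF i(1) \<alpha> n] preds_tail[OF \<alpha> True]
            by (simp add: rep_res_def)
      next
        case False
        have "act M \<alpha> (i (tail Q \<alpha>) n) = 0"
        proof (cases "n = 0")
          case True
          then show ?thesis using i0[OF x] act_0[OF vs lM \<alpha>] by simp
        next
          case n0: False
          then have tP: "tail Q \<alpha> \<in> preds Q G" using NB[OF x n] \<open>preds Q B \<subseteq> preds Q G\<close> by blast
          have "tail Q \<alpha> \<notin> succs Q G"
          proof
            assume "tail Q \<alpha> \<in> succs Q G"
            then have "head Q \<alpha> \<in> F" using tP \<alpha> by (auto simp: F_def)
            then show False using False subset_preds[OF F(2)] by blast
          qed
          moreover have "head Q \<alpha> \<notin> preds Q G" using False \<open>preds Q G \<subseteq> ?P\<close> by blast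
          ultimately show ?thesis using base(2) \<alpha> Xmem[OF x iX] by (simp add: bar_base_def)
        qed
        moreover have "act N \<alpha> n = 0" using lin_repD(3)[OF lN \<alpha> n] NP[OF y False] by simp
        ultimately show ?thesis using i0[OF y] by simp
      qed
    qed
    then have "rep_retraction s s Q M N f" unfolding rep_retraction_def using f i(2) by blast
    then show False using nretr by simp
  qed
qed

lemma irreducible_rep_plus:
  fixes s :: "'k::field \<Rightarrow> 'u::ab_group_add \<Rightarrow> 'u"
  assumes vs: "vector_space s" and irr: "irreducible_in (rep_bar s Q) s Q M N f" and M: "rep_plus s Q M"
  shows "rep_plus s Q N"
proof (rule ccontr)
  assume nN: "\<not> rep_plus s Q N"
  have bN: "rep_bar s Q N" and f: "rep_hom s s Q M N f" and nsec: "\<not> rep_section s s Q M N f"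
    using irr by (simp_all add: irreducible_in_def)
  have rN: "is_rep s Q N" using rep_barD[OF bN] .
  note lM = is_rep_lin_rep[OF rep_plusD[OF M]] and lN = is_rep_lin_rep[OF rN]
  note f0 = rep_hom_0[OF vs vs lM f]
  obtain F0 where F0: "finite F0" "F0 \<subseteq> verts Q"
    "\<And>F. finite F \<Longrightarrow> F0 \<subseteq> F \<Longrightarrow> F \<subseteq> verts Q \<Longrightarrow> bar_base s Q N F"
    using rep_bar_base[OF vs bN] by metis
  obtain A where A: "finite A" "A \<subseteq> verts Q" "\<And>x. x \<in> verts Q \<Longrightarrow> x \<notin> succs Q A \<Longrightarrow> spc M x = {0}"
    using rep_plus_support[OF vs M] by blast
  define G where "G = F0 \<union> A"
  \<comment> \<open>The added tails ensure that an arrow from outside Succ F into Succ G ends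
    outside Pred G, so that it acts on \<open>N\<close> as zero. Arrows of this kind are the only
    ones at which extending a retraction by zero to all of \<open>N\<close> could fail.\<close>
  define F where "F = G \<union> tail Q ` (\<Union>x\<in>succs Q G \<inter> preds Q G. in_arcs Q x)"
  have G: "finite G" "G \<subseteq> verts Q" "F0 \<subseteq> G" using F0 A by (auto simp: G_def)
  have "finite (succs Q G \<inter> preds Q G)" using G(1) G(1) by (rule finite_succs_Int_preds)
  moreover have "finite (in_arcs Q x)" if "x \<in> succs Q G \<inter> preds Q G" for x
    using finite_arcs_at(1) succs_verts[of G] that by blast
  ultimately have F: "finite F" "F \<subseteq> verts Q" "G \<subseteq> F" using G by (auto simp: F_def)
  have base: "bar_base s Q N F" "bar_base s Q N G" using F0(3) F G by auto
  let ?S = "succs Q F"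
  let ?X = "rep_res Q N ?S"
  have X: "rep_plus s Q ?X" using base(1) by (simp add: bar_base_def)
  note lX = is_rep_lin_rep[OF rep_plusD[OF X]]
  have "succs Q A \<subseteq> succs Q G" "succs Q G \<subseteq> ?S" using succs_mono F(3) by (auto simp: G_def)
  then have MS: "spc M x = {0}" if "x \<in> verts Q" "x \<notin> ?S" for x using A(3)[OF that(1)] that(2) by blast
  have g: "rep_hom s s Q ?X N (\<lambda>x v. v)" by (rule rep_hom_res_incl[OF vs rN succs_head])
  have h: "rep_hom s s Q M ?X f"
  proof (rule rep_homI)
    fix x assume x: "x \<in> verts Q"
    have "f x v \<in> spc ?X x" if v: "v \<in> spc M x" for v
    proof (cases "x \<in> ?S")
      case True
      then show ?thesis using rep_homD(3)[OF f x v] by (simp add: spc_rep_res)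
    next
      case False
      then have "v = 0" using MS[OF x] v by simp
      then show ?thesis using f0[OF x] False by (simp add: spc_rep_res)
    qed
    then show "linear_map_on s s (spc M x) (spc ?X x) (f x)"
      by (intro linear_map_on_mono[OF rep_homD(1)[OF f x]]) auto
  next
    fix \<alpha> v assume \<alpha>: "\<alpha> \<in> arcs Q" and v: "v \<in> spc M (tail Q \<alpha>)"
    have x: "tail Q \<alpha> \<in> verts Q" and y: "head Q \<alpha> \<in> verts Q" using \<alpha> by auto
    show "f (head Q \<alpha>) (act M \<alpha> v) = act ?X \<alpha> (f (tail Q \<alpha>) v)"
    proof (cases "tail Q \<alpha> \<in> ?S")
      case True
      then show ?thesis using rep_homD(2)[OF f \<alpha> v] succs_head[OF \<alpha> True] by (simp add: rep_res_def)
    next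
      case False
      then have "v = 0" using MS[OF x] v by simp
      then show ?thesis using False act_0[OF vs lM \<alpha>] f0[OF y] by (simp add: rep_res_def)
    qed
  qed
  have "rep_section s s Q M ?X f \<or> rep_retraction s s Q ?X N (\<lambda>x v. v)"
    using irr rep_bar_if_rep_plus_or_minus[OF vs, of ?X] X h g unfolding irreducible_in_def by blast
  then show False
  proof
    assume "rep_retraction s s Q ?X N (\<lambda>x v. v)"
    then obtain i where i: "rep_hom s s Q N ?X i" "\<And>x v. x \<in> verts Q \<Longrightarrow> v \<in> spc N x \<Longrightarrow> i x v = v"
      by (auto simp: rep_retraction_def)
    obtain x m where x: "x \<in> verts Q" "x \<notin> ?S" "m \<in> spc N x" "m \<noteq> 0"
      using not_rep_plus_witness[OF vs rN base(1) nN] by blast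
    then show False using i(2)[OF x(1,3)] rep_homD(3)[OF i(1) x(1,3)] by (simp add: spc_rep_res)
  next
    assume "rep_section s s Q M ?X f"
    then obtain r where r: "rep_hom s s Q ?X M r" "\<And>x v. x \<in> verts Q \<Longrightarrow> v \<in> spc M x \<Longrightarrow> r x (f x v) = v"
      by (auto simp: rep_section_def)
    note r0 = rep_hom_0[OF vs vs lX r(1)]
    \<comment> \<open>The projection of \<open>N\<close> to its part on Succ F is only linear at
      each vertex, not a morphism. The composite with \<open>r\<close> becomes one because the
      offending arrows either act on \<open>N\<close> as zero or end where \<open>M\<close>
      vanishes.\<close>
    define r' where "r' x n = r x (if x \<in> ?S then n else 0)" for x n
    have Nmem: "(if x \<in> ?S then n else 0) \<in> spc ?X x" if "n \<in> spc N x" for x n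
      using that by (simp add: spc_rep_res)
    have "rep_hom s s Q N M r'"
    proof (rule rep_homI)
      fix x assume x: "x \<in> verts Q"
      have "linear_map_on s s (spc N x) (spc ?X x) (\<lambda>n. if x \<in> ?S then n else 0)"
        using Nmem vs by (intro linear_map_onI) (auto simp: module_iff_vector_space[symmetric]
            module.scale_zero_right)
      from linear_map_on_comp[OF this rep_homD(1)[OF r(1) x]]
      show "linear_map_on s s (spc N x) (spc M x) (r' x)" by (simp add: r'_def[abs_def])
    next
      fix \<alpha> n assume \<alpha>: "\<alpha> \<in> arcs Q" and n: "n \<in> spc N (tail Q \<alpha>)"
      have x: "tail Q \<alpha> \<in> verts Q" and y: "head Q \<alpha> \<in> verts Q" using \<alpha> by auto
      show "r' (head Q \<alpha>) (act N \<alpha> n) = act M \<alpha> (r' (tail Q \<alpha>) n)"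
      proof (cases "tail Q \<alpha> \<in> ?S")
        case True
        then show ?thesis
          using rep_homD(2)[OF r(1) \<alpha>, of n] succs_head[OF \<alpha> True] n by (simp add: r'_def rep_res_def)
      next
        case tS: False
        then have 0: "act M \<alpha> (r' (tail Q \<alpha>) n) = 0" using r0[OF x] act_0[OF vs lM \<alpha>]
            by (simp add: r'_def)
        have "r' (head Q \<alpha>) (act N \<alpha> n) = 0"
        proof (cases "head Q \<alpha> \<in> succs Q G")
          case False
          then have "spc M (head Q \<alpha>) = {0}" using A(3)[OF y] \<open>succs Q A \<subseteq> succs Q G\<close> by blast
          then show ?thesis
            using rep_homD(3)[OF r(1) y Nmem[OF lin_repD(3)[OF lN \<alpha> n]]] by (simp add: r'_def)
        next
          case True
          have "head Q \<alpha> \<notin> preds Q G"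
          proof
            assume "head Q \<alpha> \<in> preds Q G"
            then have "tail Q \<alpha> \<in> F" using True \<alpha> by (auto simp: F_def)
            then show False using tS subset_succs[OF F(2)] by blast
          qed
          moreover have "tail Q \<alpha> \<notin> succs Q G" using tS \<open>succs Q G \<subseteq> ?S\<close> by blast
          ultimately have "act N \<alpha> n = 0" using base(2) \<alpha> n by (simp add: bar_base_def)
          then show ?thesis using r0[OF y] by (simp add: r'_def)
        qed
        then show ?thesis using 0 by simp
      qed
    qed
    moreover have "r' x (f x v) = v" if "x \<in> verts Q" "v \<in> spc M x" for x v
      using r(2)[OF that] MS[OF that(1)] that(2) f0[OF that(1)] by (auto simp: r'_def)
    ultimately have "rep_section s s Q M N f" unfolding rep_section_def using f by blast
    then show False using nsec by simp
  qed
qed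

text \<open>\<open>M\<close> lives on Pred B and \<open>N\<close> on Succ A, so the image of
  \<open>f\<close> lives on a finite set. If \<open>M\<close> embeds in the image as a section,
  \<open>M\<close> has finite support and is finitely presented. If the inclusion of the image is a
  retraction, \<open>N\<close> has finite support and is finitely co-presented.\<close>

lemma irreducible_rep_minus_to_rep_plus:
  fixes s :: "'k::field \<Rightarrow> 'u::ab_group_add \<Rightarrow> 'u"
  assumes vs: "vector_space s" and irr: "irreducible_in (rep_bar s Q) s Q M N f"
    and M: "rep_minus s Q M" and N: "rep_plus s Q N"
  shows "rep_plus s Q M \<or> rep_minus s Q N"
proof -
  interpret p: vector_space_pair s s using vs by (simp add: vector_space_pair_def)
  have f: "rep_hom s s Q M N f" using irr by (simp add: irreducible_in_def)
  note rM = rep_minusD[OF M] and rN = rep_plusD[OF N]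
  note lM = is_rep_lin_rep[OF rM] and lN = is_rep_lin_rep[OF rN]
  obtain A where A: "finite A" "A \<subseteq> verts Q" "\<And>x. x \<in> verts Q \<Longrightarrow> x \<notin> succs Q A \<Longrightarrow> spc N x = {0}"
    using rep_plus_support[OF vs N] by blast
  obtain B where B: "finite B" "B \<subseteq> verts Q" "\<And>x. x \<in> verts Q \<Longrightarrow> x \<notin> preds Q B \<Longrightarrow> spc M x = {0}"
    using rep_minus_support[OF vs M] by blast
  let ?D = "succs Q A \<inter> preds Q B"
  have D: "finite ?D" using A(1) B(1) by (rule finite_succs_Int_preds)
  define X where "X = \<lparr>spc = (\<lambda>x. f x ` spc M x), act = act N\<rparr>"
  have fX: "f x v \<in> spc X x" if "v \<in> spc M x" for x v using that by (simp add: X_def)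
  have XN: "spc X x \<subseteq> spc N x" if "x \<in> verts Q" for x using rep_homD(3)[OF f that] by (auto simp: X_def)
  have aX: "act N \<alpha> ` spc X (tail Q \<alpha>) \<subseteq> spc X (head Q \<alpha>)" if "\<alpha> \<in> arcs Q" for \<alpha>
  proof
    fix u assume "u \<in> act N \<alpha> ` spc X (tail Q \<alpha>)"
    then obtain v where "v \<in> spc M (tail Q \<alpha>)" "u = act N \<alpha> (f (tail Q \<alpha>) v)" by (auto simp: X_def)
    then show "u \<in> spc X (head Q \<alpha>)"
      using rep_homD(2)[OF f that] lin_repD(3)[OF lM that] by (simp add: X_def image_iff) metis
  qed
  have rX: "is_rep s Q X"
    unfolding is_rep_def
  proof (intro conjI ballI)
    fix x assume "x \<in> verts Q"
    then show "fd_space s (spc X x)"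
      using p.fd_space_image[OF rep_homD(1)[OF f] is_repD[OF rM]] by (simp add: X_def)
  next
    fix \<alpha> assume \<alpha>: "\<alpha> \<in> arcs Q"
    show "linear_map_on s s (spc X (tail Q \<alpha>)) (spc X (head Q \<alpha>)) (act X \<alpha>)"
      using linear_map_on_mono[OF lin_repD(2)[OF lN \<alpha>] XN[OF tail_in_verts[OF \<alpha>]] aX[OF \<alpha>]]
          by (simp add: X_def)
  qed
  have X0: "spc X x = {0}" if x: "x \<in> verts Q" "x \<notin> ?D" for x
  proof -
    have "spc X x \<subseteq> {0}"
      using A(3)[OF x(1)] B(3)[OF x(1)] x(2) XN[OF x(1)] rep_hom_0[OF vs vs lM f x(1)]
          by (auto simp: X_def)
    then show ?thesis using spc_0[OF vs is_rep_lin_rep[OF rX] x(1)] by blast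
  qed
  have "rep_bar s Q X"
    using rep_bar_if_rep_plus_or_minus[OF vs] finite_support_rep_minus[OF vs rX D X0] by blast
  moreover have "rep_hom s s Q M X f"
  proof (rule rep_homI)
    fix x assume x: "x \<in> verts Q"
    show "linear_map_on s s (spc M x) (spc X x) (f x)"
      by (rule linear_map_on_mono[OF rep_homD(1)[OF f x]]) (auto simp: X_def)
  next
    fix \<alpha> v assume "\<alpha> \<in> arcs Q" "v \<in> spc M (tail Q \<alpha>)"
    then show "f (head Q \<alpha>) (act M \<alpha> v) = act X \<alpha> (f (tail Q \<alpha>) v)" using rep_homD(2)[OF f]
        by (simp add: X_def)
  qed
  moreover have "rep_hom s s Q X N (\<lambda>x v. v)"
  proof (rule rep_homI)
    fix x assume x: "x \<in> verts Q"
    show "linear_map_on s s (spc X x) (spc N x) (\<lambda>v. v)" using XN[OF x] by (intro linear_map_onI) auto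
  qed (simp add: X_def)
  ultimately have "rep_section s s Q M X f \<or> rep_retraction s s Q X N (\<lambda>x v. v)"
    using irr unfolding irreducible_in_def by blast
  then show ?thesis
  proof
    assume "rep_section s s Q M X f"
    then obtain r where r: "rep_hom s s Q X M r" "\<And>x v. x \<in> verts Q \<Longrightarrow> v \<in> spc M x \<Longrightarrow> r x (f x v) = v"
      by (auto simp: rep_section_def)
    have "spc M x = {0}" if x: "x \<in> verts Q" "x \<notin> ?D" for x
    proof -
      have "v = 0" if v: "v \<in> spc M x" for v
        using r(2)[OF x(1) v] X0[OF x] fX[OF v] rep_hom_0[OF vs vs is_rep_lin_rep[OF rX] r(1) x(1)]
            by simp
      then show ?thesis using spc_0[OF vs lM x(1)] by blast
    qed
    then show ?thesis using finite_support_rep_plus[OF vs rM D] by blast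
  next
    assume "rep_retraction s s Q X N (\<lambda>x v. v)"
    then obtain i where i: "rep_hom s s Q N X i" "\<And>x v. x \<in> verts Q \<Longrightarrow> v \<in> spc N x \<Longrightarrow> i x v = v"
      by (auto simp: rep_retraction_def)
    have "spc N x = {0}" if x: "x \<in> verts Q" "x \<notin> ?D" for x
    proof -
      have "v = 0" if v: "v \<in> spc N x" for v
        using i(2)[OF x(1) v] X0[OF x] rep_homD(3)[OF i(1) x(1) v] by simp
      then show ?thesis using spc_0[OF vs lN x(1)] by blast
    qed
    then show ?thesis using finite_support_rep_minus[OF vs rN D] by blast
  qed
qed

text \<open>The members of a finite spanning set have finite supports, and a vector concentrated at
  one further vertex would not be in their span. Finite-dimensional representations therefore lie in
  both subcategories, which excludes them from the last two cases of the theorem.\<close>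

lemma finite_dimensional_rep_support:
  fixes s :: "'k::field \<Rightarrow> 'u::ab_group_add \<Rightarrow> 'u"
  assumes vs: "vector_space s" and M: "finite_dimensional_rep s Q M"
  shows "finite {x \<in> verts Q. spc M x \<noteq> {0}}"
proof -
  interpret f: vector_space "fun_scale s :: 'k \<Rightarrow> ('v \<Rightarrow> 'u) \<Rightarrow> _" using vs
      by (rule vector_space_fun_scale)
  interpret vs: vector_space s by fact
  have rM: "is_rep s Q M" and "fd_space (fun_scale s) (total_space Q M)"
    using M by (simp_all add: finite_dimensional_rep_def)
  then obtain B where B: "finite B" "B \<subseteq> total_space Q M" "f.span B = total_space Q M"
    by (auto simp: fd_space_def)
  have "{x \<in> verts Q. spc M x \<noteq> {0}} \<subseteq> (\<Union>m\<in>B. {x. m x \<noteq> 0})"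
  proof
    fix x assume "x \<in> {x \<in> verts Q. spc M x \<noteq> {0}}"
    then obtain v where x: "x \<in> verts Q" and v: "v \<in> spc M x" "v \<noteq> 0"
      using spc_0[OF vs is_rep_lin_rep[OF rM]] by blast
    show "x \<in> (\<Union>m\<in>B. {x. m x \<noteq> 0})"
    proof (rule ccontr)
      assume n: "x \<notin> (\<Union>m\<in>B. {x. m x \<noteq> 0})"
      have "m x = 0" if "m \<in> f.span B" for m
        using that by (induction rule: f.span_induct_alt) (use n in \<open>auto simp: fun_scale_def\<close>)
      moreover have "(\<lambda>y. if y = x then v else 0) \<in> total_space Q M"
        using x v spc_0[OF vs is_rep_lin_rep[OF rM]] by (auto simp: total_space_def)
      ultimately show False using v(2) B(3) by fastforce
    qed
  qed
  moreover have "finite (\<Union>m\<in>B. {x. m x \<noteq> 0})" using B(1,2) by (auto simp: total_space_def)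
  ultimately show ?thesis by (rule finite_subset)
qed

end

text \<open>
  With \<open>P\<close> closed under predecessors and \<open>S\<close> under successors, this is the pullback of
  \<open>M|\<^sub>P \<rightarrow> N/N|\<^sub>S \<leftarrow> N\<close> in the coordinates \<open>(m, n - f m)\<close>. These make it visibly an extension of
  \<open>M|\<^sub>P\<close> by \<open>N|\<^sub>S\<close>, with the last summand as cocycle.
\<close>

definition glued_rep ::
  "('v, 'a) pre_digraph \<Rightarrow> 'v set \<Rightarrow> 'v set \<Rightarrow> ('v, 'a, 'u::ab_group_add) rep \<Rightarrow> ('v, 'a, 'u) rep
    \<Rightarrow> ('v \<Rightarrow> 'u \<Rightarrow> 'u) \<Rightarrow> ('v, 'a, 'u \<times> 'u) rep" where
  "glued_rep Q P S M N f =
     \<lparr>spc = (\<lambda>x. spc (rep_res Q M P) x \<times> spc (rep_res Q N S) x),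
      act = (\<lambda>\<alpha> (m, n). (act (rep_res Q M P) \<alpha> m, act (rep_res Q N S) \<alpha> n +
         (if tail Q \<alpha> \<in> P \<and> head Q \<alpha> \<notin> P then f (head Q \<alpha>) (act M \<alpha> m) else 0)))\<rparr>"

context slf_quiver
begin

lemma irreducible_rep_minus_or_rep_plus:
  fixes s :: "'k::field \<Rightarrow> 'u::ab_group_add \<Rightarrow> 'u"
  assumes vs: "vector_space s" and inf: "\<nexists>B. finite B \<and> module.span s B = UNIV"
    and iM: "indecomposable s Q M" and iN: "indecomposable s Q N"
    and irr: "irreducible_in (rep_bar s Q) s Q M N f"
  shows "rep_minus s Q M \<or> rep_plus s Q N"
proof (rule ccontr)
  assume "\<not> ?thesis"
  then have nM: "\<not> rep_minus s Q M" and nN: "\<not> rep_plus s Q N" by auto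
  interpret vs: vector_space s by fact
  have vp: "vector_space (prod_scale s s)" using vs vs by (rule vector_space_prod_scale)
  have bM: "rep_bar s Q M" and bN: "rep_bar s Q N" and f: "rep_hom s s Q M N f"
    and nsec: "\<not> rep_section s s Q M N f" and nretr: "\<not> rep_retraction s s Q M N f"
    using irr by (simp_all add: irreducible_in_def)
  note rM = rep_barD[OF bM] and rN = rep_barD[OF bN]
  note lM = is_rep_lin_rep[OF rM] and lN = is_rep_lin_rep[OF rN]
  note f0 = rep_hom_0[OF vs vs lM f]
  obtain F1 where F1: "finite F1" "F1 \<subseteq> verts Q"
    "\<And>F. finite F \<Longrightarrow> F1 \<subseteq> F \<Longrightarrow> F \<subseteq> verts Q \<Longrightarrow> bar_base s Q M F"
    using rep_bar_base[OF vs bM] by metis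
  obtain F2 where F2: "finite F2" "F2 \<subseteq> verts Q"
    "\<And>F. finite F \<Longrightarrow> F2 \<subseteq> F \<Longrightarrow> F \<subseteq> verts Q \<Longrightarrow> bar_base s Q N F"
    using rep_bar_base[OF vs bN] by metis
  define F0 where "F0 = F1 \<union> F2"
  have F0: "finite F0" "F0 \<subseteq> verts Q" using F1 F2 by (auto simp: F0_def)
  have base: "bar_base s Q M F" "bar_base s Q N F" if "finite F" "F0 \<subseteq> F" "F \<subseteq> verts Q" for F
    using F1(3) F2(3) that by (auto simp: F0_def)
  \<comment> \<open>The region where two partially defined maps must agree in order to be glued: an
    arrow that enters Succ F0 from outside and does not act on \<open>N\<close> as zero ends in Pred
    F0, hence in D. Dually, an arrow leaving Pred F0 that does not act on \<open>M\<close> as zero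
    starts in D.\<close>
  define D where "D = succs Q F0 \<inter> preds Q F0"
  have D: "finite D" "D \<subseteq> verts Q"
    using finite_succs_Int_preds[OF F0(1) F0(1)] succs_verts by (auto simp: D_def)
  obtain A where A: "finite A" "A \<subseteq> arcs Q" and ext:
    "\<And>v. (\<And>x. x \<in> verts Q \<Longrightarrow> linear_map_on s s (spc N x) (spc M x) (v x)) \<Longrightarrow>
       (\<And>\<alpha> n. \<alpha> \<in> A \<Longrightarrow> n \<in> spc N (tail Q \<alpha>) \<Longrightarrow> v (head Q \<alpha>) (act N \<alpha> n) = act M \<alpha> (v (tail Q \<alpha>) n)) \<Longrightarrow>
       \<exists>w. rep_hom s s Q N M w \<and> (\<forall>x\<in>D. \<forall>n\<in>spc N x. w x n = v x n)"
    by (rule rep_hom_finite_determination[OF vs rN rM D]) blast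
  \<comment> \<open>F is chosen after \<open>A\<close>, and both ends of every arrow of
    \<open>A\<close> are put into S and P. The map \<open>v\<close> below commutes with arrows that
    start in S, the map \<open>u\<close> with arrows that end in P, so both meet the conditions
    imposed by \<open>A\<close>.\<close>
  define F where "F = F0 \<union> tail Q ` A \<union> head Q ` A"
  have F: "finite F" "F0 \<subseteq> F" "F \<subseteq> verts Q" using F0 A by (auto simp: F_def)
  define P S where "P = preds Q F" and "S = succs Q F"
  have AF: "tail Q \<alpha> \<in> S" "head Q \<alpha> \<in> S" "tail Q \<alpha> \<in> P" "head Q \<alpha> \<in> P" if "\<alpha> \<in> A" for \<alpha>
    using subset_preds[OF F(3)] subset_succs[OF F(3)] that by (auto simp: P_def S_def F_def)
  have mono: "preds Q F0 \<subseteq> P" "succs Q F0 \<subseteq> S" using preds_mono succs_mono F(2)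
      by (auto simp: P_def S_def)
  have supp: "spc M x = {0}" "spc N x = {0}" if "x \<in> verts Q" "x \<notin> succs Q F0" "x \<notin> preds Q F0" for x
    using base[OF F0(1) _ F0(2)] that by (auto simp: bar_base_def)
  have cross: "act M \<alpha> m = 0" if "\<alpha> \<in> arcs Q" "tail Q \<alpha> \<notin> succs Q F0" "head Q \<alpha> \<notin> preds Q F0"
      "m \<in> spc M (tail Q \<alpha>)" for \<alpha> m
    using base(1)[OF F0(1) _ F0(2)] that by (simp add: bar_base_def)
  have crossN: "act N \<alpha> n = 0" if "\<alpha> \<in> arcs Q" "tail Q \<alpha> \<notin> succs Q F0" "head Q \<alpha> \<notin> preds Q F0"
      "n \<in> spc N (tail Q \<alpha>)" for \<alpha> n
    using base(2)[OF F0(1) _ F0(2)] that by (simp add: bar_base_def)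
  let ?MP = "rep_res Q M P" and ?NS = "rep_res Q N S"
  have MP: "rep_minus s Q ?MP" and NS: "rep_plus s Q ?NS"
    using base[OF F] by (simp_all add: bar_base_def P_def S_def)
  note lMP = is_rep_lin_rep[OF rep_minusD[OF MP]] and lNS = is_rep_lin_rep[OF rep_plusD[OF NS]]
  have MPM: "m \<in> spc M x" if "x \<in> verts Q" "m \<in> spc ?MP x" for x m
    using that spc_0[OF vs lM] by (auto simp: spc_rep_res split: if_splits)
  have NSN: "n \<in> spc N x" if "x \<in> verts Q" "n \<in> spc ?NS x" for x n
    using that spc_0[OF vs lN] by (auto simp: spc_rep_res split: if_splits)
  have fNS: "f x m \<in> spc ?NS x" if x: "x \<in> verts Q" "x \<notin> P" and m: "m \<in> spc M x" for x m
    using rep_homD(3)[OF f x(1) m] supp(2)[OF x(1)] x(2) mono by (auto simp: spc_rep_res)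
  have NS_act: "act ?NS \<alpha> n = act N \<alpha> n" if "\<alpha> \<in> arcs Q" "n \<in> spc ?NS (tail Q \<alpha>)" for \<alpha> n
  proof (cases "tail Q \<alpha> \<in> S")
    case True
    then show ?thesis using succs_head[OF that(1)] by (simp add: rep_res_def S_def)
  next
    case False
    then have "n = 0" using that(2) by (simp add: spc_rep_res)
    then show ?thesis using act_0[OF vs lN that(1)] act_0[OF vs lNS that(1)] by simp
  qed
  have tP: "tail Q \<alpha> \<in> P" if "\<alpha> \<in> arcs Q" "head Q \<alpha> \<in> P" for \<alpha>
    using preds_tail that by (simp add: P_def)
  define Y where "Y = glued_rep Q P S M N f"
  define cr where "cr \<alpha> m = (if tail Q \<alpha> \<in> P \<and> head Q \<alpha> \<notin> P then f (head Q \<alpha>) (act M \<alpha> m) else 0)"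
      for \<alpha> m
  have spcY: "spc Y x = spc ?MP x \<times> spc ?NS x" for x by (simp add: Y_def glued_rep_def)
  have actY: "act Y \<alpha> (m, n) = (act ?MP \<alpha> m, act ?NS \<alpha> n + cr \<alpha> m)" for \<alpha> m n
    by (simp add: Y_def glued_rep_def cr_def)
  have cr_mem: "cr \<alpha> m \<in> spc ?NS (head Q \<alpha>)" if "\<alpha> \<in> arcs Q" "m \<in> spc ?MP (tail Q \<alpha>)" for \<alpha> m
    using fNS[of "head Q \<alpha>"] lin_repD(3)[OF lM that(1)] MPM[OF _ that(2)] spc_0[OF vs lNS] that(1)
    by (auto simp: cr_def)
  have cr_add: "cr \<alpha> (m + m') = cr \<alpha> m + cr \<alpha> m'" and cr_scale: "cr \<alpha> (s c m) = s c (cr \<alpha> m)"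
    if \<alpha>: "\<alpha> \<in> arcs Q" and m: "m \<in> spc ?MP (tail Q \<alpha>)" "m' \<in> spc ?MP (tail Q \<alpha>)" for \<alpha> m m' c
  proof -
    have y: "head Q \<alpha> \<in> verts Q" using \<alpha> by simp
    have mm: "m \<in> spc M (tail Q \<alpha>)" "m' \<in> spc M (tail Q \<alpha>)" using MPM m \<alpha> by auto
    note a = linear_map_onD[OF lin_repD(2)[OF lM \<alpha>]] and b = linear_map_onD[OF rep_homD(1)[OF f y]]
    show "cr \<alpha> (m + m') = cr \<alpha> m + cr \<alpha> m'"
      using a(2)[OF mm] b(2)[OF a(1)[OF mm(1)] a(1)[OF mm(2)]] by (simp add: cr_def)
    show "cr \<alpha> (s c m) = s c (cr \<alpha> m)"
      using a(3)[OF mm(1)] b(3)[OF a(1)[OF mm(1)]] by (simp add: cr_def)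
  qed
  have cr_0: "cr \<alpha> 0 = 0" if "\<alpha> \<in> arcs Q" for \<alpha> using act_0[OF vs lM that] f0 that by (simp add: cr_def)
  have rY: "is_rep (prod_scale s s) Q Y"
    unfolding is_rep_def
  proof (intro conjI ballI)
    fix x assume x: "x \<in> verts Q"
    show "fd_space (prod_scale s s) (spc Y x)"
      unfolding spcY by (intro fd_space_Times vs is_repD[OF rep_minusD[OF MP] x]
          is_repD[OF rep_plusD[OF NS] x])
  next
    fix \<alpha> assume \<alpha>: "\<alpha> \<in> arcs Q"
    note a = linear_map_onD[OF lin_repD(2)[OF lMP \<alpha>]] and b = linear_map_onD[OF lin_repD(2)[OF lNS \<alpha>]]
    note sub = lin_repD(1)[OF lNS head_in_verts[OF \<alpha>]]
    show "linear_map_on (prod_scale s s) (prod_scale s s) (spc Y (tail Q \<alpha>)) (spc Y (head Q \<alpha>)) (act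
        Y \<alpha>)"
    proof (rule linear_map_onI)
      fix u assume "u \<in> spc Y (tail Q \<alpha>)"
      then obtain m n where u: "u = (m, n)" "m \<in> spc ?MP (tail Q \<alpha>)" "n \<in> spc ?NS (tail Q \<alpha>)"
          by (auto simp: spcY)
      show "act Y \<alpha> u \<in> spc Y (head Q \<alpha>)"
        using a(1)[OF u(2)] vs.subspace_add[OF sub b(1)[OF u(3)] cr_mem[OF \<alpha> u(2)]]
            by (simp add: u(1) actY spcY)
      show "act Y \<alpha> (prod_scale s s c u) = prod_scale s s c (act Y \<alpha> u)" for c
        using a(3)[OF u(2)] b(3)[OF u(3)] cr_scale[OF \<alpha> u(2) u(2)]
        by (simp add: u(1) actY prod_scale_def vs.scale_right_distrib)
      fix u' assume "u' \<in> spc Y (tail Q \<alpha>)"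
      then obtain m' n' where u': "u' = (m', n')" "m' \<in> spc ?MP (tail Q \<alpha>)"
          "n' \<in> spc ?NS (tail Q \<alpha>)" by (auto simp: spcY)
      show "act Y \<alpha> (u + u') = act Y \<alpha> u + act Y \<alpha> u'"
        using a(2)[OF u(2) u'(2)] b(2)[OF u(3) u'(3)] cr_add[OF \<alpha> u(2) u'(2)]
            by (simp add: u(1) u'(1) actY)
    qed
  qed
  note lY = is_rep_lin_rep[OF rY]
  have incl: "rep_hom s (prod_scale s s) Q ?NS Y (\<lambda>x n. (0, n))"
  proof (rule rep_homI)
    fix x assume x: "x \<in> verts Q"
    show "linear_map_on s (prod_scale s s) (spc ?NS x) (spc Y x) (\<lambda>n. (0, n))"
      using spc_0[OF vs lMP x] by (intro linear_map_onI) (auto simp: spcY prod_scale_def)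
  next
    fix \<alpha> n assume "\<alpha> \<in> arcs Q"
    then show "(0, act ?NS \<alpha> n) = act Y \<alpha> (0, n)" using act_0[OF vs lMP] cr_0 by (simp add: actY)
  qed
  have proj: "rep_hom (prod_scale s s) s Q Y ?MP (\<lambda>x. fst)"
    by (intro rep_homI linear_map_onI) (auto simp: spcY actY prod_scale_def)
  have exact: "short_exact s (prod_scale s s) s Q ?NS Y ?MP (\<lambda>x n. (0, n)) (\<lambda>x. fst)"
    unfolding short_exact_def
  proof (intro conjI ballI incl proj)
    fix x assume x: "x \<in> verts Q"
    show "inj_on (\<lambda>n. (0, n)) (spc ?NS x)" by (auto simp: inj_on_def)
    show "(\<lambda>n. (0, n)) ` spc ?NS x = {v \<in> spc Y x. fst v = 0}" using spc_0[OF vs lMP x]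
        by (auto simp: spcY)
    show "fst ` spc Y x = spc ?MP x" using spc_0[OF vs lNS x] by (force simp: spcY)
  qed
  have fin: "finite {\<alpha>. supports Q Y \<alpha> \<and> \<not> supports Q (rep_sum2 ?NS ?MP) \<alpha>}"
  proof (rule finite_subset)
    \<comment> \<open>An exceptional arrow acts through the cocycle, so it leaves P and does not act
      on \<open>M\<close> as zero. By the choice of F0 it starts in Succ F0, which lies in S. The
      finite set of vertices in both S and P has finitely many outgoing arrows.\<close>
    show "{\<alpha>. supports Q Y \<alpha> \<and> \<not> supports Q (rep_sum2 ?NS ?MP) \<alpha>} \<subseteq> (\<Union>x\<in>S \<inter> P. out_arcs Q x)"
    proof
      fix \<alpha> assume "\<alpha> \<in> {\<alpha>. supports Q Y \<alpha> \<and> \<not> supports Q (rep_sum2 ?NS ?MP) \<alpha>}"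
      then have sup: "supports Q Y \<alpha>" and nsup: "\<not> supports Q ?NS \<alpha>" "\<not> supports Q ?MP \<alpha>"
        by (auto simp: supports_rep_sum2[OF vs lNS lMP])
      have \<alpha>: "\<alpha> \<in> arcs Q" using sup by (simp add: supports_def)
      obtain m n where mn: "m \<in> spc ?MP (tail Q \<alpha>)" "n \<in> spc ?NS (tail Q \<alpha>)" "act Y \<alpha> (m, n) \<noteq> 0"
        using sup by (auto simp: supports_def spcY)
      have "act ?MP \<alpha> m = 0" "act ?NS \<alpha> n = 0" using nsup mn \<alpha> by (auto simp: supports_def)
      then have "cr \<alpha> m \<noteq> 0" using mn(3) by (auto simp: actY zero_prod_def)
      then have c: "tail Q \<alpha> \<in> P" "head Q \<alpha> \<notin> P" "act M \<alpha> m \<noteq> 0" using f0 \<alpha>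
          by (auto simp: cr_def split: if_splits)
      have "tail Q \<alpha> \<in> succs Q F0"
        using cross[OF \<alpha> _ _ MPM[OF tail_in_verts[OF \<alpha>] mn(1)]] c(2,3) mono(1) by blast
      then show "\<alpha> \<in> (\<Union>x\<in>S \<inter> P. out_arcs Q x)" using c(1) \<alpha> mono(2) by auto
    qed
    have "finite (S \<inter> P)" using F(1) F(1) unfolding S_def P_def by (rule finite_succs_Int_preds)
    moreover have "finite (out_arcs Q x)" if "x \<in> S \<inter> P" for x
      using finite_arcs_at(2) succs_verts[of F] that by (auto simp: S_def)
    ultimately show "finite (\<Union>x\<in>S \<inter> P. out_arcs Q x)" by blast
  qed
  \<comment> \<open>In the coordinates (m, n - f m), where m is the part in P, the morphism to the
    pullback sends m to (m, f m - f m) inside P and to (0, f m) outside. The projection to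
    \<open>N\<close> adds f m back.\<close>
  define h where "h x m = (if x \<in> P then (m, 0) else (0, f x m))" for x and m :: 'u
  define g where "g x u = snd u + f x (fst u)" for x and u :: "'u \<times> 'u"
  have h: "rep_hom s (prod_scale s s) Q M Y h"
  proof (rule rep_homI)
    fix x assume x: "x \<in> verts Q"
    show "linear_map_on s (prod_scale s s) (spc M x) (spc Y x) (h x)"
    proof (cases "x \<in> P")
      case True
      then show ?thesis using spc_0[OF vs lNS x]
        by (intro linear_map_onI) (auto simp: h_def spcY spc_rep_res[of M P] prod_scale_def)
    next
      case False
      then show ?thesis using spc_0[OF vs lMP x] fNS[OF x False]
          linear_map_onD(2,3)[OF rep_homD(1)[OF f x]]
        by (intro linear_map_onI) (auto simp: h_def spcY prod_scale_def)
    qed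
  next
    fix \<alpha> m assume \<alpha>: "\<alpha> \<in> arcs Q" and m: "m \<in> spc M (tail Q \<alpha>)"
    have x: "tail Q \<alpha> \<in> verts Q" and y: "head Q \<alpha> \<in> verts Q" using \<alpha> by auto
    consider "tail Q \<alpha> \<in> P" "head Q \<alpha> \<in> P" | "tail Q \<alpha> \<in> P" "head Q \<alpha> \<notin> P" | "tail Q \<alpha> \<notin> P"
        "head Q \<alpha> \<notin> P"
      using tP[OF \<alpha>] by blast
    then show "h (head Q \<alpha>) (act M \<alpha> m) = act Y \<alpha> (h (tail Q \<alpha>) m)"
    proof cases
      case 1
      then show ?thesis using act_0[OF vs lNS \<alpha>] by (simp add: h_def actY cr_def act_rep_res)
    next
      case 2
      then have "act ?MP \<alpha> m = 0" by (simp add: rep_res_def)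
      then show ?thesis using 2 act_0[OF vs lNS \<alpha>] by (simp add: h_def actY cr_def)
    next
      case 3
      then show ?thesis
        using rep_homD(2)[OF f \<alpha> m] NS_act[OF \<alpha> fNS[OF x 3(1) m]] act_0[OF vs lMP \<alpha>] cr_0[OF \<alpha>]
        by (simp add: h_def actY)
    qed
  qed
  have g: "rep_hom (prod_scale s s) s Q Y N g"
  proof (rule rep_homI)
    fix x assume x: "x \<in> verts Q"
    note b = linear_map_onD[OF rep_homD(1)[OF f x] MPM[OF x]]
    show "linear_map_on (prod_scale s s) s (spc Y x) (spc N x) (g x)"
    proof (rule linear_map_onI)
      fix u assume "u \<in> spc Y x"
      then obtain m n where u: "u = (m, n)" "m \<in> spc ?MP x" "n \<in> spc ?NS x" by (auto simp: spcY)
      show "g x u \<in> spc N x"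
        using vs.subspace_add[OF lin_repD(1)[OF lN x] NSN[OF x u(3)] b(1)[OF u(2)]]
            by (simp add: g_def u(1))
      show "g x (prod_scale s s c u) = s c (g x u)" for c
        using b(3)[OF u(2)] by (simp add: g_def u(1) prod_scale_def vs.scale_right_distrib)
      fix u' assume "u' \<in> spc Y x"
      then obtain m' n' where u': "u' = (m', n')" "m' \<in> spc ?MP x" by (auto simp: spcY)
      show "g x (u + u') = g x u + g x u'"
        using b(2)[OF u(2) MPM[OF x u'(2)]] by (simp add: g_def u(1) u'(1))
    qed
  next
    fix \<alpha> u assume \<alpha>: "\<alpha> \<in> arcs Q" and "u \<in> spc Y (tail Q \<alpha>)"
    then obtain m n where u: "u = (m, n)" "m \<in> spc ?MP (tail Q \<alpha>)" "n \<in> spc ?NS (tail Q \<alpha>)"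
        by (auto simp: spcY)
    have x: "tail Q \<alpha> \<in> verts Q" and y: "head Q \<alpha> \<in> verts Q" using \<alpha> by auto
    note m = MPM[OF x u(2)] and n = NSN[OF x u(3)]
    have "cr \<alpha> m + f (head Q \<alpha>) (act ?MP \<alpha> m) = f (head Q \<alpha>) (act M \<alpha> m)"
    proof -
      consider "tail Q \<alpha> \<in> P" "head Q \<alpha> \<in> P" | "tail Q \<alpha> \<in> P" "head Q \<alpha> \<notin> P" | "tail Q \<alpha> \<notin> P" by blast
      then show ?thesis
      proof cases
        case 3
        then have "m = 0" using u(2) by (simp add: spc_rep_res)
        then show ?thesis using cr_0[OF \<alpha>] act_0[OF vs lMP \<alpha>] act_0[OF vs lM \<alpha>] f0[OF y] by simp
      qed (use f0[OF y] in \<open>simp_all add: cr_def rep_res_def\<close>)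
    qed
    then have "g (head Q \<alpha>) (act Y \<alpha> u) = act N \<alpha> n + act N \<alpha> (f (tail Q \<alpha>) m)"
      using rep_homD(2)[OF f \<alpha> m] NS_act[OF \<alpha> u(3)] by (simp add: g_def u(1) actY add.assoc)
    also have "\<dots> = act N \<alpha> (n + f (tail Q \<alpha>) m)"
      using linear_map_onD(2)[OF lin_repD(2)[OF lN \<alpha>] n rep_homD(3)[OF f x m]] by simp
    finally show "g (head Q \<alpha>) (act Y \<alpha> u) = act N \<alpha> (g (tail Q \<alpha>) u)" by (simp add: g_def u(1))
  qed
  have "f x m = g x (h x m)" if "x \<in> verts Q" "m \<in> spc M x" for x m
    using f0[OF that(1)] by (simp add: g_def h_def)
  from irreducible_in_rep_bar_factor[OF vs inf irr vp rY NS MP exact fin h g this]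
  show False
  proof
    assume "rep_section s (prod_scale s s) Q M Y h"
    then obtain r where r: "rep_hom (prod_scale s s) s Q Y M r"
      "\<And>x m. x \<in> verts Q \<Longrightarrow> m \<in> spc M x \<Longrightarrow> r x (h x m) = m"
      by (auto simp: rep_section_def)
    \<comment> \<open>Extended by zero outside S, so that it is linear at every vertex of
      \<open>N\<close>. It commutes with arrows starting in S but need not commute with arrows
      entering S.\<close>
    define v where "v x n = (if x \<in> S then r x (0, n) else 0)" for x n
    have inr: "linear_map_on s s (spc ?NS x) (spc M x) (\<lambda>n. r x (0, n))" if "x \<in> verts Q" for x
      by (rule linear_map_on_comp[OF rep_homD(1)[OF incl that] rep_homD(1)[OF r(1) that]])
    have vl: "linear_map_on s s (spc N x) (spc M x) (v x)" if x: "x \<in> verts Q" for x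
    proof (cases "x \<in> S")
      case True
      then show ?thesis using inr[OF x] by (simp add: v_def[abs_def] spc_rep_res)
    next
      case False
      then show ?thesis using spc_0[OF vs lM x] by (intro linear_map_onI) (auto simp: v_def)
    qed
    have vc: "v (head Q \<alpha>) (act N \<alpha> n) = act M \<alpha> (v (tail Q \<alpha>) n)"
      if \<alpha>: "\<alpha> \<in> arcs Q" "tail Q \<alpha> \<in> S" and n: "n \<in> spc N (tail Q \<alpha>)" for \<alpha> n
    proof -
      have n': "n \<in> spc ?NS (tail Q \<alpha>)" using n \<alpha>(2) by (simp add: spc_rep_res)
      have "head Q \<alpha> \<in> S" using succs_head[OF \<alpha>(1)] \<alpha>(2) by (simp add: S_def)
      then show ?thesis
        using rep_homD(2)[OF rep_hom_comp[OF incl r(1)] \<alpha>(1) n'] NS_act[OF \<alpha>(1) n'] \<alpha>(2)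
            by (simp add: v_def)
    qed
    obtain w where w: "rep_hom s s Q N M w" "\<And>x n. x \<in> D \<Longrightarrow> n \<in> spc N x \<Longrightarrow> w x n = v x n"
      using ext[of v] vl vc AF A(2) by blast
    \<comment> \<open>Only arrows entering Succ F0 from outside could break the gluing. Such an
      arrow ends in D, where \<open>v\<close> and \<open>w\<close> agree, or acts on
      \<open>N\<close> as zero.\<close>
    define w' where "w' x = (if x \<in> succs Q F0 then v x else w x)" for x
    have w': "rep_hom s s Q N M w'"
    proof (rule rep_homI)
      fix x assume "x \<in> verts Q"
      then show "linear_map_on s s (spc N x) (spc M x) (w' x)"
        using vl rep_homD(1)[OF w(1)] by (simp add: w'_def)
    next
      fix \<alpha> n assume \<alpha>: "\<alpha> \<in> arcs Q" and n: "n \<in> spc N (tail Q \<alpha>)"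
      have x: "tail Q \<alpha> \<in> verts Q" and y: "head Q \<alpha> \<in> verts Q" using \<alpha> by auto
      show "w' (head Q \<alpha>) (act N \<alpha> n) = act M \<alpha> (w' (tail Q \<alpha>) n)"
      proof (cases "tail Q \<alpha> \<in> succs Q F0")
        case True
        then show ?thesis using vc[OF \<alpha> _ n] mono(2) succs_head[OF \<alpha> True] by (auto simp: w'_def)
      next
        case tail: False
        have wc: "w (head Q \<alpha>) (act N \<alpha> n) = act M \<alpha> (w (tail Q \<alpha>) n)" using rep_homD(2)[OF w(1) \<alpha> n] .
        have "w' (head Q \<alpha>) (act N \<alpha> n) = w (head Q \<alpha>) (act N \<alpha> n)"
        proof (cases "head Q \<alpha> \<in> preds Q F0")
          case True
          then show ?thesis using w(2)[OF _ lin_repD(3)[OF lN \<alpha> n]] by (auto simp: w'_def D_def)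
        next
          case False
          then have "act N \<alpha> n = 0" using crossN[OF \<alpha> tail _ n] by simp
          then show ?thesis
            using rep_hom_0[OF vs vs lN w(1) y] rep_hom_0[OF vp vs lY r(1) y]
            by (simp add: w'_def v_def zero_prod_def)
        qed
        then show ?thesis using wc tail by (simp add: w'_def)
      qed
    qed
    \<comment> \<open>Outside P, \<open>M\<close> lives only on Succ F0, where \<open>w'\<close> is
      \<open>v\<close>. There \<open>h x m\<close> is (0, f m), so \<open>r\<close> sends it back to
      \<open>m\<close>, and \<open>w'\<close> after \<open>f\<close> has a nonzero fixed
      vector.\<close>
    obtain x m where x: "x \<in> verts Q" "x \<notin> P" "m \<in> spc M x" "m \<noteq> 0"
      using not_rep_minus_witness[OF vs rM base(1)[OF F] nM] unfolding P_def by blast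
    have xS: "x \<in> succs Q F0" using supp(1)[OF x(1)] x(2-4) mono(1) by blast
    have "w' x (f x m) = m" using r(2)[OF x(1,3)] x(2) xS mono(2) by (auto simp: w'_def v_def h_def)
    from indecomposable_endo_bij[OF vs iM rep_hom_comp[OF f w'] x(1,3,4) this]
    have "rep_section s s Q M N f" by (intro rep_section_if_bij[OF vs lM f w'])
    then show False using nsec by simp
  next
    assume "rep_retraction (prod_scale s s) s Q Y N g"
    then obtain i where i: "rep_hom s (prod_scale s s) Q N Y i"
      "\<And>x n. x \<in> verts Q \<Longrightarrow> n \<in> spc N x \<Longrightarrow> g x (i x n) = n"
      by (auto simp: rep_retraction_def)
    define u where "u x n = fst (i x n)" for x n
    have u: "rep_hom s s Q N ?MP u" unfolding u_def by (rule rep_hom_comp[OF i(1) proj])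
    have ul: "linear_map_on s s (spc N x) (spc M x) (u x)" if x: "x \<in> verts Q" for x
      using MPM[OF x] rep_homD(3)[OF u x] by (intro linear_map_on_mono[OF rep_homD(1)[OF u x]]) auto
    have uc: "u (head Q \<alpha>) (act N \<alpha> n) = act M \<alpha> (u (tail Q \<alpha>) n)"
      if \<alpha>: "\<alpha> \<in> arcs Q" "head Q \<alpha> \<in> P" and n: "n \<in> spc N (tail Q \<alpha>)" for \<alpha> n
      using rep_homD(2)[OF u \<alpha>(1) n] tP[OF \<alpha>] \<alpha>(2) by (simp add: act_rep_res)
    obtain w where w: "rep_hom s s Q N M w" "\<And>x n. x \<in> D \<Longrightarrow> n \<in> spc N x \<Longrightarrow> w x n = u x n"
      using ext[of u] ul uc AF A(2) by blast
    \<comment> \<open>Only arrows leaving Pred F0 could break the gluing. Such an arrow starts in D,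
      where \<open>u\<close> and \<open>w\<close> agree, or acts on \<open>M\<close> as
      zero.\<close>
    define w' where "w' x = (if x \<in> preds Q F0 then u x else w x)" for x
    have w': "rep_hom s s Q N M w'"
    proof (rule rep_homI)
      fix x assume "x \<in> verts Q"
      then show "linear_map_on s s (spc N x) (spc M x) (w' x)"
        using ul rep_homD(1)[OF w(1)] by (simp add: w'_def)
    next
      fix \<alpha> n assume \<alpha>: "\<alpha> \<in> arcs Q" and n: "n \<in> spc N (tail Q \<alpha>)"
      have x: "tail Q \<alpha> \<in> verts Q" and y: "head Q \<alpha> \<in> verts Q" using \<alpha> by auto
      show "w' (head Q \<alpha>) (act N \<alpha> n) = act M \<alpha> (w' (tail Q \<alpha>) n)"
      proof (cases "head Q \<alpha> \<in> preds Q F0")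
        case True
        then show ?thesis using uc[OF \<alpha> _ n] mono(1) preds_tail[OF \<alpha> True] by (auto simp: w'_def)
      next
        case head: False
        have wc: "w (head Q \<alpha>) (act N \<alpha> n) = act M \<alpha> (w (tail Q \<alpha>) n)" using rep_homD(2)[OF w(1) \<alpha> n] .
        have "act M \<alpha> (w' (tail Q \<alpha>) n) = act M \<alpha> (w (tail Q \<alpha>) n)"
        proof (cases "tail Q \<alpha> \<in> succs Q F0")
          case True
          then show ?thesis using w(2)[OF _ n] by (auto simp: w'_def D_def)
        next
          case False
          then have "act M \<alpha> (u (tail Q \<alpha>) n) = 0" "act M \<alpha> (w (tail Q \<alpha>) n) = 0"
            using cross[OF \<alpha> False head] linear_map_onD(1)[OF ul[OF x] n] rep_homD(3)[OF w(1) x n]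
                by auto
          then show ?thesis by (simp add: w'_def)
        qed
        then show ?thesis using wc head by (simp add: w'_def)
      qed
    qed
    \<comment> \<open>Outside S the second coordinate of \<open>i x n\<close> is 0, so that
      \<open>g\<close> sends it to \<open>f x (u x n)\<close>. As \<open>N\<close> lives there only
      on Pred F0, where \<open>w'\<close> is \<open>u\<close>, the map \<open>f\<close> after
      \<open>w'\<close> fixes \<open>n\<close>.\<close>
    obtain x n where x: "x \<in> verts Q" "x \<notin> S" "n \<in> spc N x" "n \<noteq> 0"
      using not_rep_plus_witness[OF vs rN base(2)[OF F] nN] unfolding S_def by blast
    have xP: "x \<in> preds Q F0" using supp(2)[OF x(1)] x(2-4) mono(2) by blast
    have "snd (i x n) = 0" using rep_homD(3)[OF i(1) x(1,3)] x(2) by (auto simp: spcY spc_rep_res[of N])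
    then have "f x (w' x n) = n" using i(2)[OF x(1,3)] xP by (simp add: w'_def u_def g_def)
    from indecomposable_endo_bij[OF vs iN rep_hom_comp[OF w' f] x(1,3,4) this]
    have "rep_retraction s s Q M N f" by (intro rep_retraction_if_bij[OF vs lN f w'])
    then show False using nretr by simp
  qed
qed

end

theorem proposition4p4:
  fixes s :: "'k::field \<Rightarrow> 'u::ab_group_add \<Rightarrow> 'u"
    and Q :: "('v, 'a) pre_digraph"
    and M N :: "('v, 'a, 'u) rep"
    and f :: "'v \<Rightarrow> 'u \<Rightarrow> 'u"
  assumes "vector_space s"
    and "\<nexists>B. finite B \<and> module.span s B = UNIV"
    and "strongly_locally_finite Q"
    and "indecomposable s Q M" and "indecomposable s Q N"
    and "irreducible_in (rep_bar s Q) s Q M N f"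
  shows "(rep_plus s Q M \<and> rep_plus s Q N) \<or>
         (rep_minus s Q M \<and> rep_minus s Q N) \<or>
         (rep_minus s Q M \<and> \<not> finite_dimensional_rep s Q M \<and> doubly_infinite s Q N) \<or>
         (rep_plus s Q N \<and> \<not> finite_dimensional_rep s Q N \<and> doubly_infinite s Q M)"
proof -
  interpret slf_quiver Q by unfold_locales (rule assms(3))
  have bar: "rep_bar s Q M" "rep_bar s Q N" using assms(6) by (simp_all add: irreducible_in_def)
  have fd: "rep_plus s Q R" "rep_minus s Q R" if "finite_dimensional_rep s Q R" for R
  proof -
    have "is_rep s Q R" using that by (simp add: finite_dimensional_rep_def)
    then show "rep_plus s Q R" "rep_minus s Q R"
      using finite_support_rep_plus[OF assms(1) _ finite_dimensional_rep_support[OF assms(1) that]]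
        finite_support_rep_minus[OF assms(1) _ finite_dimensional_rep_support[OF assms(1) that]]
            by blast+
  qed
  have "rep_minus s Q N \<Longrightarrow> rep_minus s Q M" using irreducible_rep_minus[OF assms(1,6)] .
  moreover have "rep_plus s Q M \<Longrightarrow> rep_plus s Q N" using irreducible_rep_plus[OF assms(1,6)] .
  moreover have "rep_minus s Q M \<or> rep_plus s Q N"
    using irreducible_rep_minus_or_rep_plus[OF assms(1,2,4,5,6)] .
  moreover have "rep_minus s Q M \<Longrightarrow> rep_plus s Q N \<Longrightarrow> rep_plus s Q M \<or> rep_minus s Q N"
    using irreducible_rep_minus_to_rep_plus[OF assms(1,6)] .
  \<comment> \<open>Suppose the first two cases fail. If M is in rep^-, then N is in neither
    subcategory, and M is infinite dimensional since otherwise M, and with it N, would be in rep^+.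
    If M is not in rep^-, then N is in rep^+ but not in rep^-, so that N is infinite dimensional,
    and M is not in rep^+.\<close>
  ultimately show ?thesis
    using fd assms(4,5) bar unfolding doubly_infinite_def by blast
qed

end
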